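(* For every $r_1\in(0,r_*]$ there exists $\delta_1\in(0,\delta_*]$ such that for every $0<\delta\le\delta_1$ there is a nonnegative function $\Phi\in Z$ with $\|\Phi-\Phi_{LSW}\|_Z\le r_1$ and $$\Phi=\bar I_\delta[\Phi],$$ and this solution is isolated in $Z$, i.e. some neighbourhood of $\Phi$ in $Z$ contains no other solution of $\Phi=\bar I_\delta[\Phi]$.
   Context: Let $\lambda_{LSW}=3(1/2)^{2/3}$. For $\delta\ge0$ let $$a_\delta(z)=\frac1{1+z-\lambda_{LSW}z^{1/3}+\delta z^{1/3}},\qquad b_\delta(z)=2-\tfrac13\lambda_{LSW}z^{-2/3}+\tfrac13\delta z^{-2/3}$$ (for $\delta=0$, $a_0$ is singular at $z=\tfrac12$). Function space: fix constants $\beta_1>0$, $\beta_2>1$. $Z$ is the space of real-valued measurable functions $\Phi$ on $[0,\infty)$ with finite norm $\|\Phi\|_Z=\lceil\Phi\rceil_Z+\lfloor\Phi\rfloor_Z$, where $\lceil\Phi\rceil_Z=\sup_{0\le z\le1}|\Phi(z)|$ and $\lfloor\Phi\rfloor_Z=\sup_{z\ge1}|\Phi(z)e^{\beta_1z}z^{\beta_2}|$. Convolution (note the factor $\tfrac12$): $(\Phi_1*\Phi_2)(z)=\tfrac12\int_0^z\Phi_1(z-y)\Phi_2(y)\,dy$. LSW solution: $\Phi_{LSW}(z)=C_*\exp\big(-\int_0^z a_0(\xi)b_0(\xi)\,d\xi\big)$ for $0\le z<\tfrac12$, $\Phi_{LSW}(z)=0$ for $z\ge\tfrac12$, with $C_*$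 chosen such that $\int_0^\infty z\Phi_{LSW}\,dz=1$. For $\delta>0$, $z\mapsto\psi(z;\varepsilon,\tilde\varepsilon,\delta)$ is the solution of $\psi'=-a_\delta(z)\big(b_\delta(z)-\tilde\varepsilon z-\varepsilon\big)\psi$ on $[0,\infty)$ normalized by $\int_0^1z\psi\,dz=1$, and $$I[\Phi;\varepsilon,\tilde\varepsilon,\delta](z)=\varepsilon\int_z^\infty\xi\,a_\delta(\xi)\,\frac{\psi(z;\varepsilon,\tilde\varepsilon,\delta)}{\psi(\xi;\varepsilon,\tilde\varepsilon,\delta)}\,(\Phi*\Phi)(\xi)\,d\xi.$$ Put $\gamma_1(z)=z$, $\gamma_2(z)=1$, $$K_{i,\delta}=\int_0^1\gamma_i(z)\exp\Big(\int_z^1a_\delta(y)b_\delta(y)\,dy\Big)dz,\qquad R_0[h]=\int_{1/2}^1\xi\,a_0(\xi)\,h(\xi)\exp\Big(-\int_\xi^1a_0(y)b_0(y)\,dy\Big)d\xi,$$ $\epsilon_\delta=1/(K_{1,\delta}R_0[\Phi_{LSW}*\Phi_{LSW}])$, $\tilde\epsilon_\delta=\epsilon_\delta K_{2,\delta}/K_{1,\delta}$, and $U_\delta=\{(\varepsilon,\tilde\varepsilon):\tfrac12\epsilon_\delta\le\varepsilon\le2\epsilon_\delta,\ \tfrac12\tilde\epsilon_\delta\le\tilde\varepsilon\le2\tilde\epsilon_\delta\}$. There are constants $r_*,\delta_*>0$ such that for all $0<\delta\le\delta_*$ and all $\Phi\in Z$ with $\|\Phi-\Phi_{LSW}\|_Z\le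 r_*$ the compatibility conditions $\varepsilon\int_0^\infty zI[\Phi;\varepsilon,\tilde\varepsilon,\delta]\,dz=\varepsilon$, $\varepsilon\int_0^\infty I[\Phi;\varepsilon,\tilde\varepsilon,\delta]\,dz=\tilde\varepsilon$ have exactly one solution $(\varepsilon,\tilde\varepsilon)\in U_\delta$; it depends on $\Phi$ only through $h=\Phi*\Phi$ and is denoted $(\varepsilon[h;\delta],\tilde\varepsilon[h;\delta])$. For such $\delta,\Phi$ define $$\bar I_\delta[\Phi]=I\big[\Phi;\,\varepsilon[\Phi*\Phi;\delta],\,\tilde\varepsilon[\Phi*\Phi;\delta],\,\delta\big].$$ *)

theory Defs
  imports "HOL-Analysis.Analysis"
begin

text \<open>
  All functions live on \<open>[0,\<infinity>)\<close> and are represented as functions of type \<open>real \<Rightarrow> real\<close>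
  whose values on the negative half-line are irrelevant.  For \<open>z \<ge> 0\<close> the term \<open>z powr (1/3)\<close> is
  the usual cube root.  The value \<open>0 powr (-2/3) = 0\<close> and the value \<open>0\<close> of the quotient at the
  singularity \<open>z = 1/2\<close> of \<open>a_fun 0\<close> only concern single points under integrals.
\<close>

definition lambda_LSW :: real where
  "lambda_LSW = 3 * (1/2) powr (2/3)"

definition a_fun :: "real \<Rightarrow> real \<Rightarrow> real" where
  "a_fun \<delta> z = 1 / (1 + z - lambda_LSW * z powr (1/3) + \<delta> * z powr (1/3))"

definition b_fun :: "real \<Rightarrow> real \<Rightarrow> real" where
  "b_fun \<delta> z = 2 - 1/3 * lambda_LSW * z powr (-2/3) + 1/3 * \<delta> * z powr (-2/3)"

definition Z_space :: "real \<Rightarrow> real \<Rightarrow> (real \<Rightarrow> real) set" where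
  "Z_space \<beta>1 \<beta>2 = {\<Phi>. \<Phi> \<in> borel_measurable (lebesgue_on {0..})
     \<and> bdd_above ((\<lambda>z. \<bar>\<Phi> z\<bar>) ` {0..1})
     \<and> bdd_above ((\<lambda>z. \<bar>\<Phi> z * exp (\<beta>1 * z) * z powr \<beta>2\<bar>) ` {1..})}"

definition Z_norm :: "real \<Rightarrow> real \<Rightarrow> (real \<Rightarrow> real) \<Rightarrow> real" where
  "Z_norm \<beta>1 \<beta>2 \<Phi> = (SUP z\<in>{0..1}. \<bar>\<Phi> z\<bar>)
     + (SUP z\<in>{1..}. \<bar>\<Phi> z * exp (\<beta>1 * z) * z powr \<beta>2\<bar>)"

definition Z_dist :: "real \<Rightarrow> real \<Rightarrow> (real \<Rightarrow> real) \<Rightarrow> (real \<Rightarrow> real) \<Rightarrow> real" where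
  "Z_dist \<beta>1 \<beta>2 \<Phi> \<Psi> = Z_norm \<beta>1 \<beta>2 (\<lambda>z. \<Phi> z - \<Psi> z)"

definition conv :: "(real \<Rightarrow> real) \<Rightarrow> (real \<Rightarrow> real) \<Rightarrow> real \<Rightarrow> real" where
  "conv \<Phi>1 \<Phi>2 z = 1/2 * (LINT y:{0..z}|lebesgue. \<Phi>1 (z - y) * \<Phi>2 y)"

definition LSW_profile :: "real \<Rightarrow> real" where
  "LSW_profile z = (if 0 \<le> z \<and> z < 1/2
     then exp (- (LINT \<xi>:{0..z}|lebesgue. a_fun 0 \<xi> * b_fun 0 \<xi>)) else 0)"

definition C_LSW :: real where
  "C_LSW = 1 / (LINT z:{0..}|lebesgue. z * LSW_profile z)"

definition Phi_LSW :: "real \<Rightarrow> real" where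
  "Phi_LSW z = C_LSW * LSW_profile z"

text \<open>
  For \<open>\<delta> > 0\<close> the right-hand side of the equation is singular at \<open>0\<close> (it behaves like
  \<open>z powr (-2/3)\<close>), so a solution on \<open>[0,\<infinity>)\<close> is continuous there and satisfies the equation for
  \<open>z > 0\<close>.  The value \<open>0\<close> on the negative half-line only makes the function unique as a function
  on all reals, see \<open>psi_ex1\<close> below.
\<close>

definition is_psi :: "real \<Rightarrow> real \<Rightarrow> real \<Rightarrow> (real \<Rightarrow> real) \<Rightarrow> bool" where
  "is_psi \<epsilon> \<epsilon>t \<delta> \<psi> \<longleftrightarrow>
     continuous_on {0..} \<psi>
     \<and> (\<forall>z>0. (\<psi> has_real_derivative - a_fun \<delta> z * (b_fun \<delta> z - \<epsilon>t * z - \<epsilon>) * \<psi> z) (at z))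
     \<and> (LINT z:{0..1}|lebesgue. z * \<psi> z) = 1
     \<and> (\<forall>z<0. \<psi> z = 0)"

definition psi :: "real \<Rightarrow> real \<Rightarrow> real \<Rightarrow> real \<Rightarrow> real" where
  "psi \<epsilon> \<epsilon>t \<delta> = (THE \<psi>. is_psi \<epsilon> \<epsilon>t \<delta> \<psi>)"

text \<open>
  \<open>I_h\<close> is the operator \<open>I\<close> with the convolution replaced by an arbitrary function \<open>h\<close>; it makes
  explicit that the compatibility conditions depend on \<open>\<Phi>\<close> only through \<open>conv \<Phi> \<Phi>\<close>.
\<close>

definition I_h :: "(real \<Rightarrow> real) \<Rightarrow> real \<Rightarrow> real \<Rightarrow> real \<Rightarrow> real \<Rightarrow> real" where
  "I_h h \<epsilon> \<epsilon>t \<delta> z =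
     \<epsilon> * (LINT \<xi>:{z..}|lebesgue. \<xi> * a_fun \<delta> \<xi> * (psi \<epsilon> \<epsilon>t \<delta> z / psi \<epsilon> \<epsilon>t \<delta> \<xi>) * h \<xi>)"

definition I_op :: "(real \<Rightarrow> real) \<Rightarrow> real \<Rightarrow> real \<Rightarrow> real \<Rightarrow> real \<Rightarrow> real" where
  "I_op \<Phi> \<epsilon> \<epsilon>t \<delta> = I_h (conv \<Phi> \<Phi>) \<epsilon> \<epsilon>t \<delta>"

definition K_const :: "(real \<Rightarrow> real) \<Rightarrow> real \<Rightarrow> real" where
  "K_const \<gamma> \<delta> = (LINT z:{0..1}|lebesgue.
     \<gamma> z * exp (LINT y:{z..1}|lebesgue. a_fun \<delta> y * b_fun \<delta> y))"

abbreviation K1 :: "real \<Rightarrow> real" where "K1 \<equiv> K_const (\<lambda>z. z)"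
abbreviation K2 :: "real \<Rightarrow> real" where "K2 \<equiv> K_const (\<lambda>z. 1)"

definition R0 :: "(real \<Rightarrow> real) \<Rightarrow> real" where
  "R0 h = (LINT \<xi>:{1/2..1}|lebesgue.
     \<xi> * a_fun 0 \<xi> * h \<xi> * exp (- (LINT y:{\<xi>..1}|lebesgue. a_fun 0 y * b_fun 0 y)))"

definition eps_d :: "real \<Rightarrow> real" where
  "eps_d \<delta> = 1 / (K1 \<delta> * R0 (conv Phi_LSW Phi_LSW))"

definition epst_d :: "real \<Rightarrow> real" where
  "epst_d \<delta> = eps_d \<delta> * K2 \<delta> / K1 \<delta>"

definition U_set :: "real \<Rightarrow> (real \<times> real) set" where
  "U_set \<delta> = {(\<epsilon>, \<epsilon>t). 1/2 * eps_d \<delta> \<le> \<epsilon> \<and> \<epsilon> \<le> 2 * eps_d \<delta>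
                     \<and> 1/2 * epst_d \<delta> \<le> \<epsilon>t \<and> \<epsilon>t \<le> 2 * epst_d \<delta>}"

definition compatible :: "(real \<Rightarrow> real) \<Rightarrow> real \<Rightarrow> real \<times> real \<Rightarrow> bool" where
  "compatible h \<delta> = (\<lambda>(\<epsilon>, \<epsilon>t).
     \<epsilon> * (LINT z:{0..}|lebesgue. z * I_h h \<epsilon> \<epsilon>t \<delta> z) = \<epsilon>
     \<and> \<epsilon> * (LINT z:{0..}|lebesgue. I_h h \<epsilon> \<epsilon>t \<delta> z) = \<epsilon>t)"

definition eps_sol :: "(real \<Rightarrow> real) \<Rightarrow> real \<Rightarrow> real \<times> real" where
  "eps_sol h \<delta> = (THE p. p \<in> U_set \<delta> \<and> compatible h \<delta> p)"

definition I_bar :: "real \<Rightarrow> (real \<Rightarrow> real) \<Rightarrow> real \<Rightarrow> real" where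
  "I_bar \<delta> \<Phi> = I_op \<Phi> (fst (eps_sol (conv \<Phi> \<Phi>) \<delta>)) (snd (eps_sol (conv \<Phi> \<Phi>) \<delta>)) \<delta>"

text \<open>
  The operator \<open>I_bar \<delta>\<close> is only meaningful on the ball of radius \<open>r\<close> in which the compatibility
  conditions are uniquely solvable, so being a solution includes lying in this ball.
\<close>

definition is_solution :: "real \<Rightarrow> real \<Rightarrow> real \<Rightarrow> real \<Rightarrow> (real \<Rightarrow> real) \<Rightarrow> bool" where
  "is_solution \<beta>1 \<beta>2 r \<delta> \<Phi> \<longleftrightarrow>
     \<Phi> \<in> Z_space \<beta>1 \<beta>2 \<and> Z_dist \<beta>1 \<beta>2 \<Phi> Phi_LSW \<le> r \<and> (\<forall>z\<ge>0. \<Phi> z = I_bar \<delta> \<Phi> z)"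

subsection \<open>Well-definedness of psi\<close>

lemma denominator_pos:
  fixes t \<delta> :: real
  assumes "\<delta> > 0" "t \<ge> 0"
  shows "1 + t ^ 3 - lambda_LSW * t + \<delta> * t > 0"
proof -
  define s :: real where "s = (1/2) powr (1/3)"
  have s0: "s > 0" by (simp add: s_def)
  have s2: "s ^ 2 = (1/2) powr (2/3)"
    by (simp add: s_def power2_eq_square flip: powr_add)
  have s3: "s ^ 3 = 1/2"
    by (simp add: s_def eval_nat_numeral powr_add[symmetric] del: power_Suc)
       (simp add: mult.assoc powr_add[symmetric] )
  have "(t - s)^2 * (t + 2 * s) = t ^ 3 - 3 * s^2 * t + 2 * s ^ 3"
    by (simp add: power2_eq_square power3_eq_cube algebra_simps)
  hence eq: "1 + t ^ 3 - lambda_LSW * t = (t - s)^2 * (t + 2 * s)"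
    using s2 s3 by (simp add: lambda_LSW_def)
  show ?thesis
  proof (cases "t = 0")
    case False
    hence "\<delta> * t > 0" using assms by simp
    moreover have "(t - s)^2 * (t + 2 * s) \<ge> 0" using assms s0 by simp
    ultimately show ?thesis using eq by linarith
  qed simp
qed

lemma psi_ex1:
  assumes d: "\<delta> > 0"
  shows "\<exists>!\<psi>. is_psi \<epsilon> \<epsilon>t \<delta> \<psi>"
proof -
  text \<open>The substitution \<open>z = t ^ 3\<close> removes the singularity at \<open>0\<close>.\<close>
  define D where "D t = 1 + t ^ 3 - lambda_LSW * t + \<delta> * t" for t :: real
  define q where "q t = (6 * t^2 - lambda_LSW + \<delta> - 3 * t^2 * (\<epsilon>t * t^3 + \<epsilon>)) / D t" for t
  define H where "H s = integral {0..s} q" for s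
  define G where "G z = H (z powr (1/3))" for z
  have Dpos: "D t > 0" if "t \<ge> 0" for t
    using denominator_pos[OF d that] by (simp add: D_def)
  have Dc: "continuous_on A D" for A
    unfolding D_def by (intro continuous_intros)
  have qc: "continuous_on {0..s} q" for s
    unfolding q_def
    by (intro continuous_intros Dc ballI) (use Dpos in \<open>fastforce\<close>)
  have Hd0: "(H has_real_derivative q s) (at s within {0..s+1})" if "s \<ge> 0" for s
    unfolding H_def using integral_has_real_derivative[OF qc, of s "s + 1"] that by simp
  have Hd: "(H has_real_derivative q s) (at s)" if "s > 0" for s
    using Hd0[of s] that at_within_interior[of s "{0..s+1}"] by auto
  have Hc: "continuous_on {0..} H"
    unfolding continuous_on_eq_continuous_within
  proof
    fix s :: real assume s: "s \<in> {0..}"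
    have "continuous (at s within {0..s+1}) H"
      using Hd0[of s] s by (auto intro: DERIV_continuous)
    moreover have "at s within {0..s+1} = at s within {0..}"
      by (rule at_within_nhd[of _ "{..<s+1}"]) auto
    ultimately show "continuous (at s within {0..}) H" by simp
  qed
  have Gc: "continuous_on {0..} G"
    unfolding G_def
    by (rule continuous_on_compose2[OF Hc], rule continuous_on_powr')
       (auto intro: continuous_on_id continuous_on_const)
  have cube: "(z powr (1/3)) ^ 3 = z" if "z > 0" for z :: real
    using that by (simp add: powr_power)
  have Gd: "(G has_real_derivative a_fun \<delta> z * (b_fun \<delta> z - \<epsilon>t * z - \<epsilon>)) (at z)"
    if z: "z > 0" for z
  proof -
    define t where "t = z powr (1/3)"
    have t: "t > 0" "t ^ 3 = z" using z cube by (auto simp: t_def)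
    have m: "z powr (-2/3) = 1 / t^2"
      using z by (simp add: t_def powr_power powr_minus_divide)
    have "((\<lambda>z. z powr (1/3)) has_real_derivative (1/3) * z powr (1/3 - 1)) (at z)"
      using z by (intro has_real_derivative_powr) auto
    moreover have "z powr (1/3 - 1) = 1 / t^2" using m by simp
    ultimately have "((\<lambda>z. z powr (1/3)) has_real_derivative (1/3) * (1 / t^2)) (at z)"
      by metis
    from DERIV_chain2[OF Hd[OF t(1), unfolded t_def] this]
    have "(G has_real_derivative q t * ((1/3) * (1 / t^2))) (at z)"
      unfolding G_def t_def by simp
    moreover have "q t * ((1/3) * (1 / t^2)) = a_fun \<delta> z * (b_fun \<delta> z - \<epsilon>t * z - \<epsilon>)"
    proof -
      have a: "a_fun \<delta> z = 1 / D t"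
        unfolding a_fun_def D_def t_def[symmetric] using t by simp
      have b: "b_fun \<delta> z = 2 - 1/3 * lambda_LSW * (1 / t^2) + 1/3 * \<delta> * (1 / t^2)"
        unfolding b_fun_def m ..
      have "6 * t^2 - lambda_LSW + \<delta> - 3 * t^2 * (\<epsilon>t * t^3 + \<epsilon>)
            = 3 * t^2 * (b_fun \<delta> z - \<epsilon>t * z - \<epsilon>)"
        unfolding b using t by (simp add: field_simps)
      thus ?thesis unfolding a q_def using t Dpos[of t] by simp
    qed
    ultimately show ?thesis by simp
  qed
  define N where "N = (LINT z:{0..1}|lebesgue. z * exp (- G z))"
  have Nint: "(LINT z:{0..1}|lebesgue. z * (c * exp (- G z))) = c * N" for c
  proof -
    have "(\<lambda>z. z * (c * exp (- G z))) = (\<lambda>z. c * (z * exp (- G z)))"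
      by (simp add: fun_eq_iff)
    thus ?thesis unfolding N_def by simp
  qed
  have "N > 0"
  proof -
    have c: "continuous_on {0..1} (\<lambda>z. z * exp (- G z))"
      by (intro continuous_intros continuous_on_subset[OF Gc]) auto
    have N: "N = integral {0..1} (\<lambda>z. z * exp (- G z))"
      unfolding N_def
      by (intro set_lebesgue_integral_eq_integral absolutely_integrable_continuous_real c)
    have "N \<ge> 0" unfolding N
      by (intro integral_nonneg integrable_continuous_real c) auto
    moreover have "N \<noteq> 0"
    proof
      assume "N = 0"
      hence "\<forall>z\<in>{0..1}. z * exp (- G z) = 0"
        unfolding N by (subst (asm) integral_eq_0_iff[OF c]) auto
      from bspec[OF this, of 1] show False by simp
    qed
    ultimately show ?thesis by simp
  qed
  define \<phi> where "\<phi> z = (if z < 0 then 0 else 1 / N * exp (- G z))" for z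
  have "is_psi \<epsilon> \<epsilon>t \<delta> \<phi>"
    unfolding is_psi_def
  proof (intro conjI allI impI)
    have "continuous_on {0..} (\<lambda>z. 1 / N * exp (- G z))"
      by (intro continuous_intros Gc)
    thus "continuous_on {0..} \<phi>"
      by (rule continuous_on_eq) (auto simp: \<phi>_def)
    have "(LINT z:{0..1}|lebesgue. z * \<phi> z)
          = (LINT z:{0..1}|lebesgue. z * (1 / N * exp (- G z)))"
      by (rule set_lebesgue_integral_cong) (auto simp: \<phi>_def)
    also have "\<dots> = 1" using \<open>N > 0\<close> by (subst Nint) simp
    finally show "(LINT z:{0..1}|lebesgue. z * \<phi> z) = 1" .
    fix z :: real
    show "\<phi> z = 0" if "z < 0" using that by (simp add: \<phi>_def)
    show "(\<phi> has_real_derivative - a_fun \<delta> z * (b_fun \<delta> z - \<epsilon>t * z - \<epsilon>) * \<phi> z) (at z)"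
      if z: "z > 0"
    proof -
      have "((\<lambda>z. 1 / N * exp (- G z)) has_real_derivative
              - a_fun \<delta> z * (b_fun \<delta> z - \<epsilon>t * z - \<epsilon>) * (1 / N * exp (- G z))) (at z)"
        by (rule derivative_eq_intros Gd[OF z] refl | simp)+
      moreover have "\<forall>\<^sub>F x in nhds z. 1 / N * exp (- G x) = \<phi> x"
        by (rule eventually_mono[OF eventually_nhds_in_open[of "{0<..}" z]])
           (use z in \<open>auto simp: \<phi>_def\<close>)
      ultimately show ?thesis using z
        by (subst (asm) DERIV_cong_ev[OF refl _ refl]) (auto simp: \<phi>_def)
    qed
  qed
  moreover have "\<psi> = \<phi>" if p: "is_psi \<epsilon> \<epsilon>t \<delta> \<psi>" for \<psi>
  proof -
    define F where "F z = \<psi> z * exp (G z)" for z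
    have "continuous_on {0..} F"
      unfolding F_def using p by (intro continuous_intros Gc) (auto simp: is_psi_def)
    moreover have "(F has_real_derivative 0) (at z)" if z: "z > 0" for z
    proof -
      have "(\<psi> has_real_derivative - a_fun \<delta> z * (b_fun \<delta> z - \<epsilon>t * z - \<epsilon>) * \<psi> z) (at z)"
        using p z by (auto simp: is_psi_def)
      thus ?thesis unfolding F_def
        by (auto intro!: derivative_eq_intros Gd[OF z] simp: algebra_simps)
    qed
    ultimately have F: "F z = F 0" if "z \<ge> 0" for z
    proof (cases "z = 0")
      case False
      with that have "z > 0" by simp
      thus ?thesis
        using \<open>continuous_on {0..} F\<close> \<open>\<And>z. z > 0 \<Longrightarrow> (F has_real_derivative 0) (at z)\<close>
        by (intro DERIV_isconst_end) (auto intro: continuous_on_subset)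
    qed simp
    have eq: "\<psi> z = F 0 * exp (- G z)" if "z \<ge> 0" for z
      using F[OF that] by (simp add: F_def[of z] exp_minus field_simps)
    have "1 = (LINT z:{0..1}|lebesgue. z * \<psi> z)" using p by (simp add: is_psi_def)
    also have "\<dots> = (LINT z:{0..1}|lebesgue. z * (F 0 * exp (- G z)))"
      by (rule set_lebesgue_integral_cong) (auto simp: eq)
    also have "\<dots> = F 0 * N" by (rule Nint)
    finally have "F 0 = 1 / N" using \<open>N > 0\<close> by (simp add: field_simps)
    thus ?thesis using p by (auto simp: fun_eq_iff \<phi>_def eq is_psi_def)
  qed
  ultimately show ?thesis by blast
qed

end

theory Submission
  imports Defs "HOL-Real_Asymp.Real_Asymp"
begin

text \<open>
The proof is a contraction argument; its point is that the equation almost decouples from the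
unknown as \<open>\<delta>\<close> tends to \<open>0\<close>.

Since \<open>a b = (ln (1/a))' + a\<close>, everything is explicit in terms of the primitive \<open>prim_a\<close> of \<open>a\<close>.
With \<open>phi = a exp (- prim_a)\<close>, the limit profile is the multiple \<open>C_LSW * phi 0\<close> on \<open>[0, 1/2)\<close>, and
for \<open>\<delta> > 0\<close> the operator is
\<open>I(z) = phi(z) * (LINT x:{z..}. \<epsilon> x exp (prim_a x) exp (- damping) h(x))\<close>, where \<open>h\<close> is the convolution
and the damping is linear in \<open>\<epsilon>\<close> and \<open>\<epsilon>t\<close> (lemma \<open>I_h_explicit\<close>). Let \<open>L\<close> be the integral of \<open>a\<close> over
\<open>[0, 1]\<close>. It is of order \<open>1 / sqrt \<delta>\<close>, because \<open>a\<close> has a double pole at \<open>1/2\<close> when \<open>\<delta> = 0\<close>. The box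
\<open>U_set\<close> forces \<open>\<epsilon>\<close> and \<open>\<epsilon>t\<close> to be at most a constant times \<open>exp (- L)\<close>.

Two effects now combine. First, the damping is of size \<open>exp (- L) L\<close>, so it can be replaced by \<open>0\<close>.
Secondly, \<open>phi exp (prim_a) = a\<close>, which is at most \<open>2 / \<delta>\<close>, so that replacing the integral over
\<open>[z, \<infinity>)\<close> by the one over \<open>[0, \<infinity>)\<close> costs at most \<open>exp (- L) / \<delta>\<close> for \<open>z \<le> 1\<close>; and for \<open>z > 1\<close> the whole
expression is of order \<open>exp (- L)\<close>. Hence \<open>I = q phi\<close> on \<open>[0, 1]\<close> and \<open>I = 0\<close> beyond, up to an
error of order \<open>exp (- L) L / \<delta>\<close>, with a single number \<open>q\<close> that depends on \<open>h\<close>, and the same holds for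
differences of two such expressions (lemma \<open>I_h_difference\<close>). The first compatibility
condition says that \<open>I\<close> has first moment \<open>1\<close>. It determines \<open>q\<close> up to the same small error,
whatever \<open>h\<close> is. As \<open>phi \<delta>\<close> converges uniformly to its limit (lemma \<open>phi_convergence\<close>), the
operator maps the whole ball into a small neighbourhood of \<open>Phi_LSW\<close>.

For the Lipschitz bound, two arguments at distance \<open>d\<close> give values of \<open>q\<close> that differ by a small multiple of
\<open>d + \<pi>\<close>, where \<open>\<pi>\<close> measures the distance of the rescaled parameters. As \<open>q\<close> is the product of
\<open>\<epsilon>\<close> with an integral of \<open>h\<close> and stays away from \<open>0\<close>, this bounds the difference of the \<open>\<epsilon>\<close>,
and then the second compatibility condition bounds the difference of the \<open>\<epsilon>t\<close>, by a multiple
of \<open>d\<close> plus a small multiple of \<open>\<pi>\<close>. So \<open>\<pi>\<close> can be absorbed, and for small \<open>\<delta>\<close> the operator is a contraction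
(lemmas \<open>Lipschitz_estimate\<close> and \<open>I_bar_properties\<close>).

The assumed unique solvability of the compatibility conditions makes the parameters in \<open>I_bar\<close>
well defined elements of \<open>U_set\<close>; all bounds on them come from this box and from the two
conditions. Banach's theorem, applied to nonnegative continuous functions close to
\<open>Phi_LSW\<close>, gives the solution. The contraction property holds on the whole ball of radius
\<open>r_star\<close>, so this solution is even the only one in that ball, hence isolated.
\<close>

section \<open>The coefficient a\<close>

text \<open>The denominator of \<open>a\<close>. It is a cubic polynomial in the cube root of \<open>z\<close>, which for
  \<open>\<delta> = 0\<close> has a double zero at \<open>z = 1/2\<close>.\<close>
definition den :: "real \<Rightarrow> real \<Rightarrow> real" where
  "den \<delta> z = 1 + z - lambda_LSW * z powr (1/3) + \<delta> * z powr (1/3)"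

lemma a_fun_den: "a_fun \<delta> z = 1 / den \<delta> z"
  by (simp add: a_fun_def den_def)

lemma cbrt_cubed: "(z powr (1/3)) ^ 3 = z" if "z \<ge> 0" for z :: real
  using that by (cases "z = 0") (auto simp: powr_power)

lemma den_factor:
  assumes "z \<ge> 0"
  defines "s \<equiv> (1/2) powr (1/3::real)" and "t \<equiv> z powr (1/3)"
  shows "den 0 z = (t - s)^2 * (t + 2 * s)"
proof -
  have s2: "s ^ 2 = (1/2) powr (2/3)"
    by (simp add: s_def power2_eq_square flip: powr_add)
  have s3: "s ^ 3 = 1/2" unfolding s_def by (rule cbrt_cubed) simp
  have "(t - s)^2 * (t + 2 * s) = t ^ 3 - 3 * s^2 * t + 2 * s ^ 3"
    by (simp add: power2_eq_square power3_eq_cube algebra_simps)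
  thus ?thesis using s2 s3 cbrt_cubed[OF assms(1)]
    by (simp add: den_def lambda_LSW_def t_def)
qed

lemma den_split: "den \<delta> z = den 0 z + \<delta> * z powr (1/3)"
  by (simp add: den_def)

lemma den0_nonneg: "z \<ge> 0 \<Longrightarrow> den 0 z \<ge> 0"
  using den_factor[of z] by simp

lemma den0_pos:
  assumes "z \<ge> 0" "z \<noteq> 1/2"
  shows "den 0 z > 0"
proof -
  have "z powr (1/3) \<noteq> (1/2) powr (1/3)"
    using assms cbrt_cubed[of z] cbrt_cubed[of "1/2"] by auto
  moreover have "z powr (1/3) + 2 * (1/2) powr (1/3) > 0"
    by (intro add_nonneg_pos) auto
  ultimately show ?thesis
    using den_factor[OF assms(1)] by simp
qed

lemma den_pos: "\<delta> > 0 \<Longrightarrow> z \<ge> 0 \<Longrightarrow> den \<delta> z > 0"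
  using denominator_pos[of \<delta> "z powr (1/3)"] cbrt_cubed[of z] by (simp add: den_def)

lemma den_mono: "\<delta> \<le> \<delta>' \<Longrightarrow> den \<delta> z \<le> den \<delta>' z"
  by (simp add: den_def mult_right_mono)

lemma lambda_le: "lambda_LSW \<le> 19/10" and lambda_pos: "lambda_LSW > 0"
proof -
  define s where "s = (1/2) powr (1/3::real)"
  have s3: "s ^ 3 = 1/2" unfolding s_def by (rule cbrt_cubed) simp
  have l: "lambda_LSW = 3 * s^2"
    by (simp add: lambda_LSW_def s_def power2_eq_square flip: powr_add)
  have "lambda_LSW ^ 3 = 27 * (s^3)^2" unfolding l by (simp add: power_mult_distrib)
  hence "lambda_LSW ^ 3 \<le> (19/10)^3" using s3 by (simp add: power_divide)
  thus "lambda_LSW \<le> 19/10" by (subst (asm) power_mono_iff) (auto simp: lambda_LSW_def)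
  show "lambda_LSW > 0" by (simp add: lambda_LSW_def)
qed

text \<open>The quadratic vanishing at \<open>1/2\<close> is what makes \<open>a\<close> so large there: it produces the
  divergence of the integral of \<open>a\<close> as \<open>\<delta>\<close> tends to \<open>0\<close>.\<close>
lemma den0_le_square:
  assumes "0 \<le> z" "z \<le> 1"
  shows "den 0 z \<le> 8 * (z - 1/2)^2"
proof -
  define s where "s = (1/2) powr (1/3::real)"
  define t where "t = z powr (1/3)"
  have s3: "s ^ 3 = 1/2" unfolding s_def by (rule cbrt_cubed) simp
  have t3: "t ^ 3 = z" unfolding t_def by (rule cbrt_cubed) (use assms in simp)
  have st: "s \<ge> 0" "t \<ge> 0" by (auto simp: s_def t_def)
  have "z - 1/2 = (t - s) * (t^2 + t * s + s^2)"
    unfolding t3[symmetric] s3[symmetric] by (simp add: power2_eq_square power3_eq_cube algebra_simps)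
  hence sq: "(z - 1/2)^2 = (t-s)^2 * (t^2 + t * s + s^2)^2"
    by (simp add: power_mult_distrib)
  have "(t^2 + t * s + s^2)^2 = s * s^3 + 2 * t * s^3 + (t^4 + 2*t^3 * s + 3 * t^2 * s^2)"
    by (simp add: power2_eq_square power3_eq_cube power4_eq_xxxx algebra_simps)
  moreover have "t^4 + 2*t^3 * s + 3 * t^2 * s^2 \<ge> 0" using st by simp
  ultimately have "8 * (t^2 + t * s + s^2)^2 \<ge> 4 * s + 8 * t" using s3 by simp
  hence "t + 2 * s \<le> 8 * (t^2 + t * s + s^2)^2" using st by linarith
  hence "(t-s)^2 * (t + 2 * s) \<le> (t-s)^2 * (8 * (t^2 + t * s + s^2)^2)"
    by (intro mult_left_mono) auto
  thus ?thesis using sq den_factor[OF assms(1)] by (simp add: s_def t_def)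
qed

text \<open>The tangent of the cube root at \<open>1\<close> gives \<open>z powr (1/3) \<le> (z + 2) / 3\<close>, and
  \<open>lambda_LSW \<le> 19/10\<close> is just good enough for a positive slope.\<close>
lemma den_ge_linear:
  assumes "z \<ge> 1" "\<delta> \<ge> 0"
  shows "den \<delta> z \<ge> z / 10"
proof -
  define t where "t = z powr (1/3)"
  have t3: "t ^ 3 = z" unfolding t_def by (rule cbrt_cubed) (use assms in simp)
  have t0: "t \<ge> 0" by (simp add: t_def)
  have "(t - 1)^2 * (t + 2) \<ge> 0" using t0 by simp
  hence "t \<le> (z + 2) / 3" unfolding t3[symmetric] by (simp add: power2_eq_square power3_eq_cube algebra_simps)
  hence "lambda_LSW * t \<le> 19/10 * ((z + 2)/3)"
    using lambda_le lambda_pos t0 by (intro mult_mono) auto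
  moreover have "\<delta> * t \<ge> 0" using assms t0 by simp
  ultimately have "z / 10 \<le> 1 + z - lambda_LSW * t + \<delta> * t" using assms by (simp add: field_simps)
  thus ?thesis by (simp add: den_def t_def)
qed

text \<open>Where the cube root is at least \<open>1/2\<close> the term with \<open>\<delta>\<close> suffices; otherwise the
  remaining terms are at least \<open>1/20\<close>, because \<open>lambda_LSW \<le> 19/10\<close>.\<close>
lemma den_ge_delta:
  assumes "0 \<le> z" "z \<le> 1" "0 < \<delta>" "\<delta> \<le> 1/10"
  shows "den \<delta> z \<ge> \<delta> / 2"
proof (cases "z powr (1/3) \<le> 1/2")
  case True
  hence "lambda_LSW * z powr (1/3) \<le> 19/10 * (1/2)"
    using lambda_le lambda_pos by (intro mult_mono) auto
  moreover have "\<delta> * z powr (1/3) \<ge> 0" using assms by simp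
  ultimately show ?thesis using assms unfolding den_def by linarith
next
  case False
  hence "\<delta> * z powr (1/3) \<ge> \<delta> * (1/2)" using assms by (intro mult_left_mono) auto
  thus ?thesis using den0_nonneg[OF assms(1)] den_split[of \<delta> z] by simp
qed

lemma den_0 [simp]: "den \<delta> 0 = 1"
  by (simp add: den_def)

lemma continuous_on_den: "continuous_on {0..} (den \<delta>)"
  unfolding den_def
  by (intro continuous_intros continuous_on_powr') auto

lemma continuous_on_a_fun:
  assumes "A \<subseteq> {0..}" "\<And>z. z \<in> A \<Longrightarrow> den \<delta> z > 0"
  shows "continuous_on A (a_fun \<delta>)"
  unfolding a_fun_den
  by (intro continuous_intros continuous_on_subset[OF continuous_on_den assms(1)])
     (use assms(2) in fastforce)

lemma den_deriv:
  assumes "z > 0"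
  shows "(den \<delta> has_real_derivative 1 - 1/3 * (lambda_LSW - \<delta>) * z powr (-2/3)) (at z)"
proof -
  have "((\<lambda>z. z powr (1/3)) has_real_derivative (1/3) * z powr (1/3 - 1)) (at z)"
    using assms by (intro has_real_derivative_powr) auto
  hence p: "((\<lambda>z. z powr (1/3)) has_real_derivative (1/3) * z powr (-2/3)) (at z)" by simp
  show ?thesis unfolding den_def
    by (rule DERIV_cong,
        rule DERIV_add[OF DERIV_diff[OF DERIV_add[OF DERIV_const DERIV_ident] DERIV_cmult[OF p]] DERIV_cmult[OF p]])
       (simp add: field_simps)
qed

text \<open>The first summand is the logarithmic derivative of the denominator, see \<open>den_deriv\<close>.
  This identity is the reason why all exponentials of primitives of \<open>a b\<close> reduce to the primitive
  of \<open>a\<close>.\<close>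
lemma ab_eq:
  assumes "den \<delta> z > 0"
  shows "a_fun \<delta> z * b_fun \<delta> z = (1 - 1/3 * (lambda_LSW - \<delta>) * z powr (-2/3)) / den \<delta> z + a_fun \<delta> z"
  using assms by (simp add: a_fun_den b_fun_def field_simps)

section \<open>Primitives of the coefficient\<close>

definition prim_a :: "real \<Rightarrow> real \<Rightarrow> real" where
  "prim_a \<delta> z = integral {0..z} (a_fun \<delta>)"

definition prim_xa :: "real \<Rightarrow> real \<Rightarrow> real" where
  "prim_xa \<delta> z = integral {0..z} (\<lambda>y. y * a_fun \<delta> y)"

text \<open>Up to normalisation this is the solution of the equation for \<open>psi\<close> with both parameters
  equal to zero, that is, the exponential of minus the primitive of \<open>a b\<close>. For \<open>\<delta> = 0\<close> it is the
  LSW profile on \<open>[0, 1/2)\<close>.\<close>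
definition phi :: "real \<Rightarrow> real \<Rightarrow> real" where
  "phi \<delta> z = a_fun \<delta> z * exp (- prim_a \<delta> z)"

lemma primitive_deriv:
  fixes f :: "real \<Rightarrow> real"
  assumes c: "continuous_on {0..w} f" and z: "0 < z" "z < w"
  shows "((\<lambda>x. integral {0..x} f) has_real_derivative f z) (at z)"
proof -
  have "((\<lambda>x. integral {0..x} f) has_real_derivative f z) (at z within {0..w})"
    using c z by (intro integral_has_real_derivative) auto
  thus ?thesis using z at_within_interior[of z "{0..w}"] by simp
qed

lemma a_fun_pos: "den \<delta> z > 0 \<Longrightarrow> a_fun \<delta> z > 0"
  by (simp add: a_fun_den)

lemma cont_a: "\<delta> > 0 \<Longrightarrow> continuous_on {0..w} (a_fun \<delta>)"
  by (rule continuous_on_a_fun) (auto intro: den_pos)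

lemma cont_xa: "\<delta> > 0 \<Longrightarrow> continuous_on {0..w} (\<lambda>y. y * a_fun \<delta> y)"
  by (intro continuous_intros cont_a)

lemma prim_a_deriv: "\<delta> > 0 \<Longrightarrow> z > 0 \<Longrightarrow> (prim_a \<delta> has_real_derivative a_fun \<delta> z) (at z)"
  unfolding prim_a_def[abs_def] by (rule primitive_deriv[of "z+1"]) (auto intro: cont_a)

lemma prim_xa_deriv: "\<delta> > 0 \<Longrightarrow> z > 0 \<Longrightarrow> (prim_xa \<delta> has_real_derivative z * a_fun \<delta> z) (at z)"
  unfolding prim_xa_def[abs_def] by (rule primitive_deriv[of "z+1"]) (auto intro: cont_xa)

lemma continuous_on_halfline:
  fixes f :: "real \<Rightarrow> real"
  assumes "\<And>w. continuous_on {0..w} f"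
  shows "continuous_on {0..} f"
  unfolding continuous_on_eq_continuous_within
proof
  fix s :: real assume s: "s \<in> {0..}"
  have "continuous (at s within {0..s+1}) f"
    using assms[of "s+1"] s by (auto simp: continuous_on_eq_continuous_within)
  moreover have "at s within {0..s+1} = at s within {0..}"
    by (rule at_within_nhd[of _ "{..<s+1}"]) auto
  ultimately show "continuous (at s within {0..}) f" by simp
qed

lemma prim_a_cont: "\<delta> > 0 \<Longrightarrow> continuous_on {0..} (prim_a \<delta>)"
  unfolding prim_a_def[abs_def]
  by (intro continuous_on_halfline indefinite_integral_continuous_1 integrable_continuous_real cont_a)

lemma prim_xa_cont: "\<delta> > 0 \<Longrightarrow> continuous_on {0..} (prim_xa \<delta>)"
  unfolding prim_xa_def[abs_def]
  by (intro continuous_on_halfline indefinite_integral_continuous_1 integrable_continuous_real cont_xa)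

lemma prim_a_0 [simp]: "prim_a \<delta> 0 = 0" and prim_xa_0 [simp]: "prim_xa \<delta> 0 = 0"
  by (auto simp: prim_a_def prim_xa_def)

lemma prim_a_diff:
  assumes "\<delta> > 0" "0 \<le> x" "x \<le> y"
  shows "prim_a \<delta> y - prim_a \<delta> x = integral {x..y} (a_fun \<delta>)"
  using Henstock_Kurzweil_Integration.integral_combine[of 0 x y "a_fun \<delta>"] assms
  by (simp add: prim_a_def integrable_continuous_real cont_a)

lemma prim_xa_diff:
  assumes "\<delta> > 0" "0 \<le> x" "x \<le> y"
  shows "prim_xa \<delta> y - prim_xa \<delta> x = integral {x..y} (\<lambda>y. y * a_fun \<delta> y)"
  using Henstock_Kurzweil_Integration.integral_combine[of 0 x y "\<lambda>y. y * a_fun \<delta> y"] assms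
  by (simp add: prim_xa_def integrable_continuous_real cont_xa)

lemma a_integrable: "\<delta> > 0 \<Longrightarrow> 0 \<le> x \<Longrightarrow> a_fun \<delta> integrable_on {x..y}"
  by (rule integrable_continuous_real, rule continuous_on_subset[OF cont_a[of _ y]]) auto

lemma xa_integrable: "\<delta> > 0 \<Longrightarrow> 0 \<le> x \<Longrightarrow> (\<lambda>y. y * a_fun \<delta> y) integrable_on {x..y}"
  by (rule integrable_continuous_real, rule continuous_on_subset[OF cont_xa[of _ y]]) auto

lemma a_nonneg: "\<delta> > 0 \<Longrightarrow> z \<ge> 0 \<Longrightarrow> a_fun \<delta> z \<ge> 0"
  using den_pos[of \<delta> z] by (simp add: a_fun_den)

lemma prim_a_mono: "\<delta> > 0 \<Longrightarrow> 0 \<le> x \<Longrightarrow> x \<le> y \<Longrightarrow> prim_a \<delta> x \<le> prim_a \<delta> y"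
  using prim_a_diff[of \<delta> x y] integral_nonneg[OF a_integrable, of \<delta> x y] by (auto simp: a_nonneg)

lemma prim_xa_mono: "\<delta> > 0 \<Longrightarrow> 0 \<le> x \<Longrightarrow> x \<le> y \<Longrightarrow> prim_xa \<delta> x \<le> prim_xa \<delta> y"
  using prim_xa_diff[of \<delta> x y] integral_nonneg[OF xa_integrable, of \<delta> x y] by (auto simp: a_nonneg)

lemma a_le_tail: "\<delta> \<ge> 0 \<Longrightarrow> z \<ge> 1 \<Longrightarrow> a_fun \<delta> z \<le> 10 / z"
  using den_ge_linear[of z \<delta>] le_imp_inverse_le[of "z/10" "den \<delta> z"] by (simp add: a_fun_den inverse_eq_divide)

lemma a_le_inner: "0 < \<delta> \<Longrightarrow> \<delta> \<le> 1/10 \<Longrightarrow> 0 \<le> z \<Longrightarrow> z \<le> 1 \<Longrightarrow> a_fun \<delta> z \<le> 2 / \<delta>"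
  using den_ge_delta[of z \<delta>] le_imp_inverse_le[of "\<delta>/2" "den \<delta> z"] by (simp add: a_fun_den inverse_eq_divide)

lemma prim_a_growth:
  assumes "\<delta> > 0" "1 \<le> x" "x \<le> y"
  shows "prim_a \<delta> y - prim_a \<delta> x \<le> 10 * ln (y / x)"
proof -
  have "((\<lambda>z. 10 / z) has_integral (10 * ln y - 10 * ln x)) {x..y}"
    using assms
    by (intro fundamental_theorem_of_calculus)
       (auto intro!: derivative_eq_intros simp: has_real_derivative_iff_has_vector_derivative[symmetric])
  moreover have "integral {x..y} (a_fun \<delta>) \<le> integral {x..y} (\<lambda>z. 10 / z)"
    using assms calculation by (intro integral_le a_integrable) (auto intro: a_le_tail)
  ultimately show ?thesis
    using assms by (simp add: prim_a_diff integral_unique ln_div algebra_simps)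
qed

lemma prim_xa_growth:
  assumes "\<delta> > 0" "1 \<le> x" "x \<le> y"
  shows "prim_xa \<delta> y - prim_xa \<delta> x \<le> 10 * (y - x)"
proof -
  have "integral {x..y} (\<lambda>y. y * a_fun \<delta> y) \<le> integral {x..y} (\<lambda>z. 10)"
  proof (intro integral_le xa_integrable)
    fix z assume "z \<in> {x..y}"
    thus "z * a_fun \<delta> z \<le> 10" using a_le_tail[of \<delta> z] assms by (simp add: field_simps)
  qed (use assms in auto)
  thus ?thesis using assms by (simp add: prim_xa_diff)
qed

lemma prim_a_1_upper:
  assumes "0 < \<delta>" "\<delta> \<le> 1/10"
  shows "prim_a \<delta> 1 \<le> 2 / \<delta>"
proof -
  have "integral {0..1} (a_fun \<delta>) \<le> integral {0..1} (\<lambda>z::real. 2 / \<delta>)"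
    using assms by (intro integral_le a_integrable) (auto intro: a_le_inner)
  thus ?thesis by (simp add: prim_a_def)
qed

lemma prim_xa_le_prim_a: "\<delta> > 0 \<Longrightarrow> 0 \<le> x \<Longrightarrow> x \<le> y \<Longrightarrow> y \<le> 1 \<Longrightarrow> prim_xa \<delta> y - prim_xa \<delta> x \<le> prim_a \<delta> y - prim_a \<delta> x"
  by (subst prim_a_diff, simp, simp, simp, subst prim_xa_diff, simp, simp, simp, intro integral_le a_integrable xa_integrable)
     (auto intro!: mult_left_le_one_le a_nonneg)

text \<open>Near the singular point the denominator is at most \<open>8 (z - 1/2)\<^sup>2 + \<delta>\<close>, hence of
  size \<open>\<delta>\<close> on an interval of length \<open>sqrt \<delta>\<close>.\<close>
lemma prim_a_1_lower:
  assumes "0 < \<delta>" "\<delta> \<le> 1/10"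
  shows "prim_a \<delta> 1 \<ge> 1 / (9 * sqrt \<delta>)"
proof -
  define w where "w = sqrt \<delta>"
  have w: "w > 0" "w^2 = \<delta>" using assms by (auto simp: w_def)
  have "w \<le> 1/2"
  proof (rule power2_le_imp_le)
    show "w\<^sup>2 \<le> (1/2)\<^sup>2" using w assms by (simp add: power2_eq_square)
  qed simp
  have "integral {1/2..1/2+w} (\<lambda>z::real. 1 / (9 * \<delta>)) \<le> integral {1/2..1/2+w} (a_fun \<delta>)"
  proof (intro integral_le a_integrable)
    fix z assume z: "z \<in> {1/2..1/2+w}"
    have "z powr (1/3) \<le> 1" using z \<open>w \<le> 1/2\<close> by (intro powr_le1) auto
    hence "\<delta> * z powr (1/3) \<le> \<delta> * 1" using assms by (intro mult_left_mono) auto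
    moreover have "(z-1/2)^2 \<le> w^2" using z w by (intro power_mono) auto
    hence "den 0 z \<le> 8 * \<delta>" using den0_le_square[of z] z w \<open>w \<le> 1/2\<close> by auto
    ultimately have "den \<delta> z \<le> 9 * \<delta>" using den_split[of \<delta> z] by simp
    moreover have "den \<delta> z > 0" using den_pos[of \<delta> z] assms z by auto
    ultimately show "1 / (9 * \<delta>) \<le> a_fun \<delta> z" unfolding a_fun_den
      by (intro divide_left_mono) (use assms in auto)
  qed (use assms w in auto)
  also have "\<dots> = prim_a \<delta> (1/2+w) - prim_a \<delta> (1/2)"
    using assms w by (subst prim_a_diff) auto
  also have "\<dots> \<le> prim_a \<delta> 1"
    using prim_a_mono[of \<delta> "1/2+w" 1] prim_a_mono[of \<delta> 0 "1/2"] assms w \<open>w \<le> 1/2\<close> by auto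
  finally have "w * (1 / (9 * \<delta>)) \<le> prim_a \<delta> 1" using w by simp
  moreover have "w * (1 / (9 * \<delta>)) = 1 / (9 * w)" using w by (simp add: w(2)[symmetric] power2_eq_square)
  ultimately show ?thesis by (simp add: w_def)
qed

text \<open>Relative to its value at \<open>max z 1\<close>, the exponential of the primitive grows at most
  polynomially in the distance from \<open>z\<close>, because \<open>a \<le> 10 / z\<close> beyond \<open>1\<close>. Bounds in terms of the
  distance are needed, as powers of \<open>x\<close> itself would spoil the decay rate of the weighted norm.\<close>
lemma prim_a_growth_general:
  assumes "\<delta> > 0" "0 \<le> z" "z \<le> x"
  shows "exp (prim_a \<delta> x) \<le> exp (prim_a \<delta> (max z 1)) * (1 + (x - z)) ^ 10"
proof (cases "x \<le> max z 1")
  case True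
  have "exp (prim_a \<delta> x) * 1 \<le> exp (prim_a \<delta> (max z 1)) * (1 + (x - z)) ^ 10"
    using True assms by (intro mult_mono) (auto intro!: prim_a_mono one_le_power)
  thus ?thesis by simp
next
  case False
  define m where "m = max z 1"
  have m: "m \<ge> 1" "m \<le> x" "z \<le> m" using False by (auto simp: m_def)
  have "exp (prim_a \<delta> x) = exp (prim_a \<delta> m) * exp (prim_a \<delta> x - prim_a \<delta> m)" by (simp flip: exp_add)
  also have "\<dots> \<le> exp (prim_a \<delta> m) * exp (10 * ln (x/m))"
    using prim_a_growth[of \<delta> m x] assms m by simp
  also have "exp (10 * ln (x/m)) = (x/m)^10"
    using m exp_of_nat_mult[of 10 "ln (x/m)"] by simp
  also have "x / m \<le> 1 + (x - z)"
  proof (cases "z \<le> 1")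
    case True thus ?thesis by (simp add: m_def)
  next
    case False
    hence "(x - z) * 1 \<le> (x - z) * z" using assms by (intro mult_left_mono) auto
    thus ?thesis using False assms by (simp add: m_def max_def field_simps)
  qed
  hence "(x/m)^10 \<le> (1 + (x - z))^10" using m by (intro power_mono) auto
  finally show ?thesis by (simp add: m_def)
qed

text \<open>The interval \<open>[0, 1]\<close> contributes at most twice the large number \<open>prim_a \<delta> 1\<close>, and
  beyond \<open>1\<close> both integrands are bounded by \<open>10\<close>.\<close>
lemma prim_sum_growth:
  assumes "\<delta> > 0" "0 \<le> z" "z \<le> x"
  shows "(prim_a \<delta> x - prim_a \<delta> z) + (prim_xa \<delta> x - prim_xa \<delta> z) \<le> 2 * prim_a \<delta> 1 + 20 * (x - z)"
proof -
  have tail: "(prim_a \<delta> x - prim_a \<delta> u) + (prim_xa \<delta> x - prim_xa \<delta> u) \<le> 20 * (x - u)" if "1 \<le> u" "u \<le> x" for u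
  proof -
    have "ln (x/u) \<le> x/u - 1" using that by (intro ln_le_minus_one) auto
    also have "\<dots> = (x - u) / u" using that by (simp add: field_simps)
    also have "\<dots> \<le> (x - u) / 1" using that by (intro divide_left_mono) auto
    finally show ?thesis using prim_a_growth[of \<delta> u x] prim_xa_growth[of \<delta> u x] assms that by simp
  qed
  have inner: "(prim_a \<delta> u - prim_a \<delta> z) + (prim_xa \<delta> u - prim_xa \<delta> z) \<le> 2 * prim_a \<delta> 1" if "z \<le> u" "u \<le> 1" for u
    using prim_xa_le_prim_a[of \<delta> z u] prim_a_mono[of \<delta> u 1] prim_a_mono[of \<delta> 0 z] assms that by auto
  have L: "prim_a \<delta> 1 \<ge> 0" using prim_a_mono[of \<delta> 0 1] assms by simp
  consider "x \<le> 1" | "1 \<le> z" | "z \<le> 1" "1 \<le> x" by linarith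
  thus ?thesis
  proof cases
    case 1 thus ?thesis using inner[of x] assms by auto
  next
    case 2 thus ?thesis using tail[of z] assms L by auto
  next
    case 3 thus ?thesis using inner[of 1] tail[of 1] assms by auto
  qed
qed

section \<open>Set integrals\<close>

text \<open>A non-integrable \<open>f\<close> has integral \<open>0\<close>, so the bound covers this case as well.\<close>
lemma set_LINT_abs_bound:
  fixes f g :: "real \<Rightarrow> real"
  assumes g: "set_integrable lebesgue S g" and le: "\<And>x. x \<in> S \<Longrightarrow> \<bar>f x\<bar> \<le> g x"
  shows "\<bar>LINT x:S|lebesgue. f x\<bar> \<le> (LINT x:S|lebesgue. g x)"
proof -
  have "\<bar>LINT x:S|lebesgue. f x\<bar> \<le> (LINT x|lebesgue. \<bar>indicator S x *\<^sub>R f x\<bar>)"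
    unfolding set_lebesgue_integral_def by (rule integral_abs_bound)
  also have "\<dots> \<le> (LINT x:S|lebesgue. g x)"
    unfolding set_lebesgue_integral_def
    using g le by (intro integral_mono') (force simp: set_integrable_def indicator_def abs_mult split: if_splits)+
  finally show ?thesis .
qed

lemma set_LINT_pos:
  fixes f :: "real \<Rightarrow> real"
  assumes f: "set_integrable lebesgue S f" and ge: "\<And>x. x \<in> S \<Longrightarrow> 0 \<le> f x"
    and cd: "c < d" "{c<..<d} \<subseteq> S" "\<And>x. x \<in> {c<..<d} \<Longrightarrow> 0 < f x"
  shows "0 < (LINT x:S|lebesgue. f x)"
proof -
  let ?g = "\<lambda>x. indicator S x *\<^sub>R f x"
  have g: "integrable lebesgue ?g" "\<And>x. 0 \<le> ?g x"
    using f ge by (auto simp: set_integrable_def indicator_def)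
  have "(LINT x|lebesgue. ?g x) \<noteq> 0"
  proof
    assume "(LINT x|lebesgue. ?g x) = 0"
    hence "AE x in lebesgue. ?g x = 0"
      using integral_nonneg_eq_0_iff_AE[OF g(1)] g(2) by simp
    hence "AE x in lebesgue. x \<notin> {c<..<d}"
      by eventually_elim (use cd in \<open>force simp: indicator_def split: if_splits\<close>)
    hence "{c<..<d} \<in> null_sets lebesgue"
      by (subst AE_iff_null_sets) auto
    hence "emeasure lebesgue {c<..<d} = 0" by blast
    thus False using cd by simp
  qed
  moreover have "(LINT x|lebesgue. ?g x) \<ge> 0" using g(2) by simp
  ultimately show ?thesis by (simp add: set_lebesgue_integral_def)
qed

section \<open>The limit profile\<close>

lemma lambda_ge_1: "lambda_LSW \<ge> 1"
proof -
  have "(1/2) powr (1::real) \<le> (1/2) powr (2/3::real)" by (intro powr_mono') auto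
  thus ?thesis by (simp add: lambda_LSW_def)
qed

text \<open>Since \<open>a b = (ln den)' + a\<close>, the exponential of the primitive of \<open>a b\<close> is explicit up to
  the primitive of \<open>a\<close>. The product \<open>a b\<close> is unbounded below at \<open>0\<close>, so its absolute integrability is
  derived from the integrability in the sense of Henstock and Kurzweil together with the upper
  bound \<open>2 a\<close>.\<close>
lemma integral_ab:
  assumes "0 \<le> x" "x \<le> y" "\<And>w. w \<in> {x..y} \<Longrightarrow> den \<delta> w > 0" "\<delta> \<le> 1"
  shows "exp (- (LINT w:{x..y}|lebesgue. a_fun \<delta> w * b_fun \<delta> w))
         = den \<delta> x / den \<delta> y * exp (- integral {x..y} (a_fun \<delta>))"
proof -
  let ?F = "\<lambda>w. ln (den \<delta> w) + integral {x..w} (a_fun \<delta>)"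
  have ca: "continuous_on {x..y} (a_fun \<delta>)"
    using assms by (intro continuous_on_a_fun) auto
  have I: "((\<lambda>w. a_fun \<delta> w * b_fun \<delta> w) has_integral ?F y - ?F x) {x..y}"
  proof (intro fundamental_theorem_of_calculus_interior assms)
    show "continuous_on {x..y} ?F"
      using assms ca
      by (intro continuous_intros continuous_on_subset[OF continuous_on_den]
            indefinite_integral_continuous_1 integrable_continuous_real) fastforce+
  next
    fix w assume w: "w \<in> {x<..<y}"
    have d: "den \<delta> w > 0" using assms w by auto
    have "((\<lambda>w. integral {x..w} (a_fun \<delta>)) has_real_derivative a_fun \<delta> w) (at w within {x..y})"
      using ca w by (intro integral_has_real_derivative) auto
    hence "((\<lambda>w. integral {x..w} (a_fun \<delta>)) has_real_derivative a_fun \<delta> w) (at w)"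
      using w at_within_interior[of w "{x..y}"] by simp
    moreover have "((\<lambda>w. ln (den \<delta> w)) has_real_derivative
        1 / den \<delta> w * (1 - 1/3 * (lambda_LSW - \<delta>) * w powr (-2/3))) (at w)"
      using w assms d by (intro DERIV_chain2[OF DERIV_ln_divide den_deriv]) auto
    ultimately have "(?F has_real_derivative 
        1 / den \<delta> w * (1 - 1/3 * (lambda_LSW - \<delta>) * w powr (-2/3)) + a_fun \<delta> w) (at w)"
      by (intro DERIV_add)
    thus "(?F has_vector_derivative a_fun \<delta> w * b_fun \<delta> w) (at w)"
      unfolding has_real_derivative_iff_has_vector_derivative[symmetric] ab_eq[OF d] by simp
  qed
  have "(\<lambda>w. a_fun \<delta> w * b_fun \<delta> w) absolutely_integrable_on {x..y}"
  proof (rule absolutely_integrable_absolutely_integrable_ubound)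
    show "(\<lambda>w. a_fun \<delta> w * b_fun \<delta> w) integrable_on {x..y}" using I by blast
    show "(\<lambda>w. a_fun \<delta> w * 2) absolutely_integrable_on {x..y}"
      by (intro absolutely_integrable_continuous_real continuous_intros ca)
    fix w assume w: "w \<in> {x..y}"
    have "0 \<le> (lambda_LSW - \<delta>) * w powr (-2/3)"
      using lambda_ge_1 assms by simp
    hence "b_fun \<delta> w \<le> 2" by (simp add: b_fun_def algebra_simps)
    thus "a_fun \<delta> w * b_fun \<delta> w \<le> a_fun \<delta> w * 2"
      using assms(3)[OF w] a_fun_pos[of \<delta> w] by (intro mult_left_mono) auto
  qed
  hence "(LINT w:{x..y}|lebesgue. a_fun \<delta> w * b_fun \<delta> w) = ?F y - ?F x"
    using I by (simp add: set_lebesgue_integral_eq_integral integral_unique)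
  hence "exp (- (LINT w:{x..y}|lebesgue. a_fun \<delta> w * b_fun \<delta> w))
      = exp (ln (den \<delta> x)) * exp (- integral {x..y} (a_fun \<delta>)) / exp (ln (den \<delta> y))"
    by (simp flip: exp_add exp_diff)
  thus ?thesis using assms(3)[of x] assms(3)[of y] assms(1,2) by simp
qed

lemma LSW_profile_phi: "0 \<le> z \<Longrightarrow> z < 1/2 \<Longrightarrow> LSW_profile z = phi 0 z"
  using integral_ab[of 0 z 0] den0_pos
  by (simp add: LSW_profile_def phi_def prim_a_def a_fun_den[of 0 z])

lemma LSW_profile_zero: "z \<ge> 1/2 \<Longrightarrow> LSW_profile z = 0"
  by (simp add: LSW_profile_def)

lemma den_pos_general: "0 \<le> \<delta> \<Longrightarrow> \<delta> > 0 \<or> z < 1/2 \<Longrightarrow> z \<ge> 0 \<Longrightarrow> den \<delta> z > 0"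
  using den_pos[of \<delta> z] den0_pos[of z] by (cases "\<delta> = 0") auto

lemma phi_deriv:
  assumes "0 \<le> \<delta>" "\<delta> > 0 \<or> z < 1/2" "z > 0"
  shows "(phi \<delta> has_real_derivative - (a_fun \<delta> z * b_fun \<delta> z) * phi \<delta> z) (at z)"
proof -
  have d: "den \<delta> z > 0" using assms by (intro den_pos_general) auto
  define w where "w = (if \<delta> > 0 then z + 1 else (z + 1/2)/2)"
  have w: "z < w" "\<delta> > 0 \<or> w < 1/2" using assms by (auto simp: w_def)
  have "(prim_a \<delta> has_real_derivative a_fun \<delta> z) (at z)"
    unfolding prim_a_def[abs_def]
    by (rule primitive_deriv[of w], rule continuous_on_a_fun)
       (use assms w in \<open>auto intro!: den_pos_general\<close>)
  hence "((\<lambda>z. exp (- prim_a \<delta> z) / den \<delta> z) has_real_derivative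
      ((exp (- prim_a \<delta> z) * - a_fun \<delta> z) * den \<delta> z
        - exp (- prim_a \<delta> z) * (1 - 1/3 * (lambda_LSW - \<delta>) * z powr (-2/3))) / (den \<delta> z * den \<delta> z)) (at z)"
    using d assms by (intro DERIV_divide den_deriv) (auto intro!: derivative_eq_intros)
  moreover have "(\<lambda>z. exp (- prim_a \<delta> z) / den \<delta> z) = phi \<delta>"
    by (auto simp: phi_def a_fun_den)
  moreover have "((exp (- prim_a \<delta> z) * - a_fun \<delta> z) * den \<delta> z
        - exp (- prim_a \<delta> z) * (1 - 1/3 * (lambda_LSW - \<delta>) * z powr (-2/3))) / (den \<delta> z * den \<delta> z)
      = - (a_fun \<delta> z * b_fun \<delta> z) * phi \<delta> z"
    unfolding ab_eq[OF d] unfolding phi_def a_fun_den using d by (simp add: field_simps)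
  ultimately show ?thesis by simp
qed

text \<open>At \<open>z = 1/4\<close> and \<open>\<delta> = 0\<close> the value is \<open>2 - 2 powr (2/3)\<close>; positivity of \<open>b\<close> makes
  \<open>phi\<close> decreasing, from \<open>1/4\<close> on and hence across the singular point.\<close>
lemma b_lower:
  assumes "0 \<le> \<delta>" "1/4 \<le> z"
  shows "b_fun \<delta> z \<ge> 2/5"
proof -
  have "z powr (-2/3) \<le> (1/4) powr (-2/3)"
    using assms powr_mono2'[of "-2/3" "1/4" z] by simp
  moreover have "(1/4) powr (-2/3) = (4::real) powr (2/3)"
    by (simp add: powr_minus powr_divide field_simps)
  ultimately have "(1/2) powr (2/3) * z powr (-2/3) \<le> (1/2) powr (2/3) * 4 powr (2/3)"
    by (intro mult_left_mono) auto
  also have "\<dots> = (2::real) powr (2/3)" by (simp flip: powr_mult)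
  also have "\<dots> \<le> 8/5"
  proof -
    have "((2::real) powr (2/3)) ^ 3 = 2 ^ 2" by (simp add: powr_power)
    also have "\<dots> \<le> (8/5) ^ 3" by (simp add: power_divide)
    finally show ?thesis by (subst (asm) power_mono_iff) auto
  qed
  finally have "(1/2) powr (2/3) * z powr (-2/3) \<le> 8/5" .
  moreover have "0 \<le> \<delta> * z powr (-2/3)" using assms by simp
  ultimately show ?thesis by (simp add: b_fun_def lambda_LSW_def)
qed

lemma phi_nonneg: "0 \<le> \<delta> \<Longrightarrow> z \<ge> 0 \<Longrightarrow> phi \<delta> z \<ge> 0"
  unfolding phi_def a_fun_den using den_mono[of 0 \<delta> z] den0_nonneg[of z]
  by (intro mult_nonneg_nonneg divide_nonneg_nonneg) auto

lemma phi_pos: "0 \<le> \<delta> \<Longrightarrow> \<delta> > 0 \<or> z < 1/2 \<Longrightarrow> z \<ge> 0 \<Longrightarrow> phi \<delta> z > 0"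
  unfolding phi_def by (intro mult_pos_pos a_fun_pos den_pos_general) auto

lemma phi_antimono:
  assumes "0 \<le> \<delta>" "1/4 \<le> x" "x \<le> y" "\<delta> > 0 \<or> y < 1/2"
  shows "phi \<delta> y \<le> phi \<delta> x"
proof (rule DERIV_nonpos_imp_nonincreasing[OF assms(3)])
  fix z assume z: "x \<le> z" "z \<le> y"
  have "(phi \<delta> has_real_derivative - (a_fun \<delta> z * b_fun \<delta> z) * phi \<delta> z) (at z)"
    using z assms by (intro phi_deriv) auto
  moreover have "a_fun \<delta> z > 0" using z assms by (intro a_fun_pos den_pos_general) auto
  moreover have "b_fun \<delta> z > 0" using b_lower[of \<delta> z] z assms by auto
  moreover have "phi \<delta> z \<ge> 0" using z assms by (intro phi_nonneg) auto
  ultimately show "\<exists>m. (phi \<delta> has_real_derivative m) (at z) \<and> m \<le> 0"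
    by (intro exI[of _ "- (a_fun \<delta> z * b_fun \<delta> z) * phi \<delta> z"]) auto
qed

text \<open>Close to \<open>1/2\<close> one has \<open>a b \<ge> 1 / (1/2 - z)\<close>, so \<open>phi 0 z / (1/2 - z)\<close> decreases. The
  number \<open>9/20\<close> is where the quadratic bound on the denominator starts to imply this.\<close>
lemma phi0_linear_bound:
  assumes "9/20 \<le> z" "z < 1/2"
  shows "phi 0 z \<le> 20 * phi 0 (9/20) * (1/2 - z)"
proof -
  let ?g = "\<lambda>z. phi 0 z / (1/2 - z)"
  have "?g z \<le> ?g (9/20)"
  proof (rule DERIV_nonpos_imp_nonincreasing[OF assms(1)])
    fix w assume w: "9/20 \<le> w" "w \<le> z"
    define x where "x = 1/2 - w"
    have x: "0 < x" "x \<le> 1/20" using w assms by (auto simp: x_def)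
    have d: "den 0 w > 0" "den 0 w \<le> 8 * x^2"
      using den0_pos[of w] den0_le_square[of w] w assms by (auto simp: x_def power2_commute)
    have "1 / x \<le> (2/5) / (8 * x^2)"
      using x by (simp add: field_simps power2_eq_square)
    also have "\<dots> \<le> b_fun 0 w / den 0 w"
      using d w x b_lower[of 0 w] by (intro frac_le) auto
    finally have ab: "1 / x \<le> a_fun 0 w * b_fun 0 w" by (simp add: a_fun_den)
    have "(?g has_real_derivative
        (- (a_fun 0 w * b_fun 0 w) * phi 0 w * (1/2 - w) - phi 0 w * (0 - 1)) / ((1/2 - w) * (1/2 - w))) (at w)"
      using w assms by (intro DERIV_divide phi_deriv DERIV_diff DERIV_const DERIV_ident) auto
    moreover have "(- (a_fun 0 w * b_fun 0 w) * phi 0 w * (1/2 - w) - phi 0 w * (0 - 1)) / ((1/2 - w) * (1/2 - w)) \<le> 0"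
    proof (rule divide_nonpos_nonneg)
      have "1 \<le> a_fun 0 w * b_fun 0 w * x" using ab x by (simp add: field_simps)
      hence "phi 0 w * 1 \<le> phi 0 w * (a_fun 0 w * b_fun 0 w * x)"
        using phi_nonneg[of 0 w] w by (intro mult_left_mono) auto
      thus "- (a_fun 0 w * b_fun 0 w) * phi 0 w * (1/2 - w) - phi 0 w * (0 - 1) \<le> 0"
        by (simp add: x_def algebra_simps)
    qed auto
    ultimately show "\<exists>m. (?g has_real_derivative m) (at w) \<and> m \<le> 0" by blast
  qed
  thus ?thesis using assms by (simp add: field_simps)
qed

text \<open>Left of \<open>z0\<close> the coefficient \<open>a_fun 0\<close> is bounded by some \<open>A\<close>, and
  \<open>a_fun 0 - a_fun \<delta>\<close> is at most \<open>\<delta> A\<^sup>2\<close>, which then also bounds the difference of the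
  primitives.\<close>
lemma phi_convergence_inner:
  assumes z0: "0 \<le> z0" "z0 < 1/2" and e: "e > 0"
  shows "\<exists>\<delta>0>0. \<forall>\<delta>. 0 < \<delta> \<and> \<delta> \<le> \<delta>0 \<longrightarrow> (\<forall>z\<in>{0..z0}. \<bar>phi \<delta> z - phi 0 z\<bar> \<le> e)"
proof -
  have c0: "continuous_on {0..z0} (a_fun 0)"
    using z0 by (intro continuous_on_a_fun) (auto intro!: den0_pos)
  obtain A where A: "\<And>z. z \<in> {0..z0} \<Longrightarrow> a_fun 0 z \<le> A" and A1: "A \<ge> 1"
  proof -
    have "bounded (a_fun 0 ` {0..z0})"
      by (intro compact_imp_bounded compact_continuous_image c0) auto
    then obtain A where A: "\<And>z. z \<in> {0..z0} \<Longrightarrow> \<bar>a_fun 0 z\<bar> \<le> A"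
      unfolding bounded_iff real_norm_def ball_simps by blast
    have "a_fun 0 z \<le> max A 1" if "z \<in> {0..z0}" for z using A[OF that] by auto
    thus ?thesis using that[of "max A 1"] by auto
  qed
  define K where "K = A^2 + A * A^2"
  have K: "K > 0" using A1 by (simp add: K_def add_pos_pos)
  have "\<bar>phi \<delta> z - phi 0 z\<bar> \<le> e" if d: "0 < \<delta>" "\<delta> \<le> e / K" and z: "z \<in> {0..z0}" for \<delta> z
  proof -
    have a: "0 < a_fun \<delta> y" "a_fun \<delta> y \<le> a_fun 0 y" "a_fun 0 y - a_fun \<delta> y \<le> \<delta> * A^2"
      if y: "y \<in> {0..z0}" for y
    proof -
      have dd: "0 < den 0 y" "0 < den \<delta> y" "den 0 y \<le> den \<delta> y"
        using y z0 d den0_pos[of y] den_pos[of \<delta> y] den_mono[of 0 \<delta> y] by auto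
      show "0 < a_fun \<delta> y" "a_fun \<delta> y \<le> a_fun 0 y"
        using dd by (auto simp: a_fun_den frac_le)
      have "y powr (1/3) \<le> 1" using y z0 by (intro powr_le1) auto
      hence "\<delta> * y powr (1/3) \<le> \<delta> * 1" using d by (intro mult_left_mono) auto
      have "a_fun 0 y - a_fun \<delta> y = \<delta> * y powr (1/3) * (a_fun 0 y * a_fun \<delta> y)"
        using dd den_split[of \<delta> y] by (simp add: a_fun_den field_simps)
      also have "\<dots> \<le> \<delta> * 1 * (A * A)"
        using \<open>\<delta> * y powr (1/3) \<le> \<delta> * 1\<close> A[OF y] \<open>0 < a_fun \<delta> y\<close> \<open>a_fun \<delta> y \<le> a_fun 0 y\<close> d A1
        by (intro mult_mono) auto
      finally show "a_fun 0 y - a_fun \<delta> y \<le> \<delta> * A^2" by (simp add: power2_eq_square)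
    qed
    have i0: "a_fun 0 integrable_on {0..z}"
      using z by (intro integrable_continuous_real continuous_on_subset[OF c0]) auto
    have id: "a_fun \<delta> integrable_on {0..z}" using d by (intro a_integrable) auto
    have B1: "prim_a \<delta> z \<le> prim_a 0 z" unfolding prim_a_def
      using z by (intro integral_le i0 id a(2)) auto
    have B2: "0 \<le> prim_a \<delta> z" using prim_a_mono[of \<delta> 0 z] d z by simp
    have "prim_a 0 z - prim_a \<delta> z = integral {0..z} (\<lambda>y. a_fun 0 y - a_fun \<delta> y)"
      unfolding prim_a_def by (rule Henstock_Kurzweil_Integration.integral_diff[symmetric]) (fact i0 id)+
    also have "\<dots> \<le> integral {0..z} (\<lambda>y. \<delta> * A^2)"
      using z by (intro integral_le Henstock_Kurzweil_Integration.integrable_diff i0 id a(3)) auto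
    also have "\<dots> \<le> \<delta> * A^2"
      using z z0 d A1 by (auto intro!: mult_left_le_one_le)
    finally have B3: "prim_a 0 z - prim_a \<delta> z \<le> \<delta> * A^2" .
    have "1 - exp (- (prim_a 0 z - prim_a \<delta> z)) \<le> \<delta> * A^2"
      using B3 exp_ge_add_one_self[of "- (prim_a 0 z - prim_a \<delta> z)"] by linarith
    have "exp (- prim_a \<delta> z) - exp (- prim_a 0 z) = exp (- prim_a \<delta> z) * (1 - exp (- (prim_a 0 z - prim_a \<delta> z)))"
      by (simp add: algebra_simps flip: exp_add)
    also have "\<dots> \<le> 1 * (\<delta> * A^2)"
      using B1 B2 \<open>1 - exp (- (prim_a 0 z - prim_a \<delta> z)) \<le> \<delta> * A^2\<close>
      by (intro mult_mono) auto
    finally have E: "exp (- prim_a \<delta> z) - exp (- prim_a 0 z) \<le> \<delta> * A^2" by simp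
    have E': "exp (- prim_a 0 z) \<le> exp (- prim_a \<delta> z)" "exp (- prim_a \<delta> z) \<le> 1" using B1 B2 by auto
    have "phi \<delta> z - phi 0 z = (a_fun \<delta> z - a_fun 0 z) * exp (- prim_a \<delta> z)
        + a_fun 0 z * (exp (- prim_a \<delta> z) - exp (- prim_a 0 z))"
      by (simp add: phi_def algebra_simps)
    hence "\<bar>phi \<delta> z - phi 0 z\<bar> \<le> \<bar>a_fun \<delta> z - a_fun 0 z\<bar> * exp (- prim_a \<delta> z)
        + \<bar>a_fun 0 z\<bar> * \<bar>exp (- prim_a \<delta> z) - exp (- prim_a 0 z)\<bar>"
      using abs_triangle_ineq[of "(a_fun \<delta> z - a_fun 0 z) * exp (- prim_a \<delta> z)"
          "a_fun 0 z * (exp (- prim_a \<delta> z) - exp (- prim_a 0 z))"]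
      by (simp add: abs_mult)
    also have "\<dots> \<le> (\<delta> * A^2) * 1 + A * (\<delta> * A^2)"
      using E E' a[OF z] A[OF z] A1 d
      by (intro add_mono mult_mono) auto
    also have "\<dots> = \<delta> * K" by (simp add: K_def algebra_simps)
    also have "\<dots> \<le> e" using d K by (simp add: field_simps)
    finally show ?thesis .
  qed
  thus ?thesis using e K by (intro exI[of _ "e / K"]) auto
qed

text \<open>Away from \<open>1/2\<close> the convergence is the one of the coefficients. Beyond a point \<open>z0\<close> near
  \<open>1/2\<close>, monotonicity of \<open>phi \<delta>\<close> transports the smallness at \<open>z0\<close> to the right, across the
  singular point.\<close>
lemma phi_convergence:
  assumes "e > 0"
  shows "\<exists>\<delta>0>0. \<forall>\<delta>. 0 < \<delta> \<and> \<delta> \<le> \<delta>0 \<longrightarrow> (\<forall>z\<in>{0..1}. \<bar>phi \<delta> z - LSW_profile z\<bar> \<le> e)"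
proof -
  define P where "P = 20 * phi 0 (9/20)"
  have P: "P > 0" using phi_pos[of 0 "9/20"] by (simp add: P_def)
  define z0 where "z0 = max (9/20) (1/2 - e / (2 * P))"
  have "e / (2 * P) > 0" using assms P by simp
  hence z0: "9/20 \<le> z0" "z0 < 1/2" by (simp_all only: z0_def max_less_iff_conj) simp_all
  have "phi 0 z0 \<le> P * (1/2 - z0)"
    using phi0_linear_bound[OF z0] by (simp add: P_def)
  also have "\<dots> \<le> P * (e / (2 * P))" using P by (intro mult_left_mono) (auto simp: z0_def)
  finally have small: "phi 0 z0 \<le> e / 2" using P by simp
  obtain \<delta>0 where d0: "\<delta>0 > 0" and
    conv: "\<And>\<delta> z. 0 < \<delta> \<Longrightarrow> \<delta> \<le> \<delta>0 \<Longrightarrow> z \<in> {0..z0} \<Longrightarrow> \<bar>phi \<delta> z - phi 0 z\<bar> \<le> e / 2"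
    using phi_convergence_inner[of z0 "e/2"] z0 assms by auto
  have "\<bar>phi \<delta> z - LSW_profile z\<bar> \<le> e" if d: "0 < \<delta>" "\<delta> \<le> \<delta>0" and z: "z \<in> {0..1}" for \<delta> z
  proof (cases "z \<le> z0")
    case True
    thus ?thesis using conv[OF d, of z] z z0 LSW_profile_phi[of z] assms by auto
  next
    case False
    have "phi \<delta> z \<le> phi \<delta> z0" using False d z0 by (intro phi_antimono) auto
    moreover have "phi \<delta> z0 - phi 0 z0 \<le> e / 2"
      using z0 by (intro order_trans[OF abs_ge_self conv[OF d]]) auto
    hence "phi \<delta> z0 \<le> e" using small by simp
    moreover have "phi \<delta> z \<ge> 0" using d z by (intro phi_nonneg) auto
    moreover have "0 \<le> LSW_profile z \<and> LSW_profile z \<le> e"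
    proof (cases "z < 1/2")
      case True
      have "phi 0 z \<le> phi 0 z0" using False True z0 by (intro phi_antimono) auto
      thus ?thesis using small LSW_profile_phi[of z] phi_nonneg[of 0 z] True z assms by auto
    next
      case False thus ?thesis using LSW_profile_zero[of z] assms by simp
    qed
    ultimately show ?thesis by auto
  qed
  thus ?thesis using d0 by blast
qed

lemma LSW_profile_nonneg: "LSW_profile z \<ge> 0"
  by (simp add: LSW_profile_def)

lemma LSW_profile_pos: "0 \<le> z \<Longrightarrow> z < 1/2 \<Longrightarrow> LSW_profile z > 0"
  by (simp add: LSW_profile_def)

lemma continuous_LSW_inner: "continuous_on {0..<1/2} LSW_profile"
proof -
  have "continuous_on {0..z} (phi 0)" if "z < 1/2" for z
  proof -
    have c: "continuous_on {0..z} (a_fun 0)"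
      using that by (intro continuous_on_a_fun den0_pos) auto
    show ?thesis unfolding phi_def prim_a_def
      by (intro continuous_intros c indefinite_integral_continuous_1 integrable_continuous_real)
  qed
  hence c: "continuous_on {0..z} LSW_profile" if "z < 1/2" for z
    using that by (subst continuous_on_cong[OF refl LSW_profile_phi]) auto
  show ?thesis unfolding continuous_on_eq_continuous_within
  proof
    fix z :: real assume z: "z \<in> {0..<1/2}"
    have "continuous (at z within {0..(z+1/2)/2}) LSW_profile"
      using c[of "(z+1/2)/2"] z by (auto simp: continuous_on_eq_continuous_within)
    moreover have "at z within {0..(z+1/2)/2} = at z within {0..<1/2}"
      using z by (intro at_within_nhd[of _ "{..<(z+1/2)/2}"]) auto
    ultimately show "continuous (at z within {0..<1/2}) LSW_profile" by simp
  qed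
qed

lemma LSW_measurable [measurable]: "LSW_profile \<in> borel_measurable borel"
proof -
  have "(\<lambda>z. if z \<in> {0..<1/2} then LSW_profile z else 0) \<in> borel_measurable borel"
    by (intro borel_measurable_continuous_on_if continuous_LSW_inner) auto
  moreover have "(\<lambda>z. if z \<in> {0..<1/2} then LSW_profile z else 0) = LSW_profile"
    by (auto simp: LSW_profile_def)
  ultimately show ?thesis by simp
qed

lemma LSW_bounded: "\<exists>P\<ge>1. \<forall>z. LSW_profile z \<le> P"
proof -
  have "continuous_on {0..1/4} LSW_profile"
    by (rule continuous_on_subset[OF continuous_LSW_inner]) auto
  hence "bounded (LSW_profile ` {0..1/4})"
    by (intro compact_imp_bounded compact_continuous_image) auto
  then obtain P where P: "\<And>z. z \<in> {0..1/4} \<Longrightarrow> \<bar>LSW_profile z\<bar> \<le> P"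
    unfolding bounded_iff real_norm_def ball_simps by blast
  have "LSW_profile z \<le> max P 1" for z
  proof (cases "0 \<le> z \<and> z < 1/2")
    case False thus ?thesis by (auto simp: LSW_profile_def)
  next
    case T: True
    show ?thesis
    proof (cases "z \<le> 1/4")
      case True thus ?thesis using P[of z] T by auto
    next
      case False
      hence "phi 0 z \<le> phi 0 (1/4)" using T by (intro phi_antimono) auto
      thus ?thesis using P[of "1/4"] T LSW_profile_phi[of z] LSW_profile_phi[of "1/4"] by auto
    qed
  qed
  thus ?thesis by (intro exI[of _ "max P 1"]) auto
qed

section \<open>The weighted space\<close>

locale weight =
  fixes \<beta>1 \<beta>2 :: real
  assumes b1: "\<beta>1 > 0" and b2: "\<beta>2 > 1"
begin

text \<open>This weight defines a norm that is equivalent to the one of \<open>Z_space\<close>. In contrast to the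
  latter it is given by one continuous expression, so that a bound by a multiple of \<open>wt\<close> covers both
  parts of the norm.\<close>
definition wt :: "real \<Rightarrow> real" where
  "wt z = exp (- \<beta>1 * z) * (1 + z) powr (- \<beta>2)"

lemma wt_pos: "z \<ge> 0 \<Longrightarrow> wt z > 0"
  by (simp add: wt_def)

lemma wt_shift:
  assumes "0 \<le> z" "z \<le> y"
  shows "wt y \<le> exp (- \<beta>1 * (y - z)) * wt z"
proof -
  have "(1 + y) powr (- \<beta>2) \<le> (1 + z) powr (- \<beta>2)"
    using assms b2 by (intro powr_mono2') auto
  moreover have "exp (- \<beta>1 * y) = exp (- \<beta>1 * (y - z)) * exp (- \<beta>1 * z)"
    by (simp add: algebra_simps flip: exp_add)
  ultimately show ?thesis by (simp add: wt_def)
qed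

lemma wt_antimono: "0 \<le> z \<Longrightarrow> z \<le> y \<Longrightarrow> wt y \<le> wt z"
proof -
  assume a: "0 \<le> z" "z \<le> y"
  have "exp (- \<beta>1 * (y - z)) * wt z \<le> 1 * wt z"
    using a b1 wt_pos[of z] by (intro mult_right_mono) auto
  thus ?thesis using wt_shift[OF a] by simp
qed

lemma wt_le_1: "z \<ge> 0 \<Longrightarrow> wt z \<le> 1"
  using wt_antimono[of 0 z] by (simp add: wt_def)

lemma wt_cont: "continuous_on {0..} wt"
  unfolding wt_def by (intro continuous_intros continuous_on_powr') auto

text \<open>The constant by which the norm of \<open>Z_space\<close> controls multiples of \<open>wt\<close>, see \<open>le_Z_dist\<close>.\<close>
definition wt_const :: real where "wt_const = exp \<beta>1 * 2 powr \<beta>2"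

lemma wt_const_pos: "wt_const > 0" by (simp add: wt_const_def)

lemma wt_const_inner: "0 \<le> z \<Longrightarrow> z \<le> 1 \<Longrightarrow> 1 \<le> wt_const * wt z"
  using wt_antimono[of z 1] wt_const_pos mult_left_mono[of "wt 1" "wt z" wt_const]
  by (simp add: wt_const_def wt_def powr_minus exp_minus field_simps)

lemma wt_const_outer:
  assumes "z \<ge> 1"
  shows "exp (- \<beta>1 * z) * z powr (- \<beta>2) \<le> wt_const * wt z"
proof -
  have "((1 + z) / 2) powr \<beta>2 \<le> z powr \<beta>2" using assms b2 by (intro powr_mono2) auto
  hence "z powr (- \<beta>2) \<le> 2 powr \<beta>2 * (1 + z) powr (- \<beta>2)"
    using assms by (simp add: powr_minus powr_divide field_simps)
  hence "exp (- \<beta>1 * z) * z powr (- \<beta>2) \<le> exp (- \<beta>1 * z) * (2 powr \<beta>2 * (1 + z) powr (- \<beta>2))"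
    by (intro mult_left_mono) auto
  also have "\<dots> = 2 powr \<beta>2 * wt z" by (simp add: wt_def)
  also have "\<dots> \<le> wt_const * wt z"
    using b1 wt_pos[of z] assms by (intro mult_right_mono) (auto simp: wt_const_def)
  finally show ?thesis .
qed

lemma outer_le_wt:
  assumes "z \<ge> 1" "\<bar>x\<bar> \<le> c * wt z"
  shows "\<bar>x * exp (\<beta>1 * z) * z powr \<beta>2\<bar> \<le> c"
proof -
  have c: "c \<ge> 0" using assms wt_pos[of z] by (meson abs_ge_zero order_trans zero_le_mult_iff not_less less_le_trans zero_less_one less_imp_le)
  have "\<bar>x * exp (\<beta>1 * z) * z powr \<beta>2\<bar> \<le> c * wt z * (exp (\<beta>1 * z) * z powr \<beta>2)"
    using assms by (simp add: abs_mult mult_right_mono mult.assoc)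
  also have "\<dots> = c * ((1 + z) powr (- \<beta>2) * z powr \<beta>2)"
    by (simp add: wt_def exp_minus)
  also have "\<dots> \<le> c * ((1 + z) powr (- \<beta>2) * (1 + z) powr \<beta>2)"
    using assms b2 c by (intro mult_left_mono powr_mono2) auto
  also have "\<dots> = c" using assms by (simp flip: powr_add)
  finally show ?thesis .
qed

lemma Z_dist_le:
  assumes "\<And>z. z \<ge> 0 \<Longrightarrow> \<bar>\<Phi> z - \<Psi> z\<bar> \<le> c * wt z"
  shows "Z_dist \<beta>1 \<beta>2 \<Phi> \<Psi> \<le> 2 * c"
proof -
  have c: "c \<ge> 0" using assms[of 0] abs_ge_zero[of "\<Phi> 0 - \<Psi> 0"] by (simp add: wt_def)
  have "(SUP z\<in>{0..1}. \<bar>\<Phi> z - \<Psi> z\<bar>) \<le> c"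
  proof (rule cSUP_least)
    fix z :: real assume z: "z \<in> {0..1}"
    have "\<bar>\<Phi> z - \<Psi> z\<bar> \<le> c * wt z" using z by (intro assms) auto
    also have "\<dots> \<le> c * 1" using z c by (intro mult_left_mono wt_le_1) auto
    finally show "\<bar>\<Phi> z - \<Psi> z\<bar> \<le> c" by simp
  qed auto
  moreover have "(SUP z\<in>{1..}. \<bar>(\<Phi> z - \<Psi> z) * exp (\<beta>1 * z) * z powr \<beta>2\<bar>) \<le> c"
    by (rule cSUP_least) (auto intro!: outer_le_wt assms)
  ultimately show ?thesis by (simp add: Z_dist_def Z_norm_def)
qed

lemma Z_space_I:
  assumes "\<Phi> \<in> borel_measurable (lebesgue_on {0..})" "\<And>z. z \<ge> 0 \<Longrightarrow> \<bar>\<Phi> z\<bar> \<le> c * wt z"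
  shows "\<Phi> \<in> Z_space \<beta>1 \<beta>2"
proof -
  have c: "c \<ge> 0" using assms(2)[of 0] abs_ge_zero[of "\<Phi> 0"] by (simp add: wt_def)
  have "\<bar>\<Phi> z\<bar> \<le> c" if "z \<in> {0..1}" for z
    using assms(2)[of z] wt_le_1[of z] mult_left_mono[of "wt z" 1 c] c that by auto
  hence "bdd_above ((\<lambda>z. \<bar>\<Phi> z\<bar>) ` {0..1})" by (rule bdd_aboveI2)
  moreover have "bdd_above ((\<lambda>z. \<bar>\<Phi> z * exp (\<beta>1 * z) * z powr \<beta>2\<bar>) ` {1..})"
    by (rule bdd_aboveI2[of _ _ c]) (auto intro!: outer_le_wt assms)
  ultimately show ?thesis using assms(1) by (simp add: Z_space_def)
qed

lemma le_Z_dist: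
  assumes "\<Phi> \<in> Z_space \<beta>1 \<beta>2" "\<Psi> \<in> Z_space \<beta>1 \<beta>2" "z \<ge> 0"
  shows "\<bar>\<Phi> z - \<Psi> z\<bar> \<le> wt_const * Z_dist \<beta>1 \<beta>2 \<Phi> \<Psi> * wt z"
proof -
  let ?i = "\<lambda>z. \<bar>\<Phi> z - \<Psi> z\<bar>" and ?o = "\<lambda>z. \<bar>(\<Phi> z - \<Psi> z) * exp (\<beta>1 * z) * z powr \<beta>2\<bar>"
  obtain i1 i2 o1 o2 where
    i: "\<And>z. z \<in> {0..1} \<Longrightarrow> \<bar>\<Phi> z\<bar> \<le> i1" "\<And>z. z \<in> {0..1} \<Longrightarrow> \<bar>\<Psi> z\<bar> \<le> i2" and
    o: "\<And>z. z \<in> {1..} \<Longrightarrow> \<bar>\<Phi> z * exp (\<beta>1 * z) * z powr \<beta>2\<bar> \<le> o1"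
       "\<And>z. z \<in> {1..} \<Longrightarrow> \<bar>\<Psi> z * exp (\<beta>1 * z) * z powr \<beta>2\<bar> \<le> o2"
    using assms unfolding Z_space_def bdd_above_def ball_simps mem_Collect_eq by blast
  have bi: "bdd_above (?i ` {0..1})"
    by (rule bdd_aboveI2[of _ _ "i1 + i2"]) (use i in \<open>force intro: order_trans[OF abs_triangle_ineq4] add_mono\<close>)
  have bo: "bdd_above (?o ` {1..})"
  proof (rule bdd_aboveI2[of _ _ "o1 + o2"])
    fix z :: real assume z: "z \<in> {1..}"
    have "(\<Phi> z - \<Psi> z) * exp (\<beta>1 * z) * z powr \<beta>2
       = \<Phi> z * exp (\<beta>1 * z) * z powr \<beta>2 - \<Psi> z * exp (\<beta>1 * z) * z powr \<beta>2"
      by (simp add: algebra_simps)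
    thus "?o z \<le> o1 + o2" using o[OF z] abs_triangle_ineq4[of "\<Phi> z * exp (\<beta>1 * z) * z powr \<beta>2" "\<Psi> z * exp (\<beta>1 * z) * z powr \<beta>2"]
      by linarith
  qed
  have "?i 0 \<le> (SUP z\<in>{0..1}. ?i z)" by (rule cSUP_upper[OF _ bi]) auto
  hence si: "(SUP z\<in>{0..1}. ?i z) \<ge> 0" by linarith
  have "?o 1 \<le> (SUP z\<in>{1..}. ?o z)" by (rule cSUP_upper[OF _ bo]) auto
  hence so: "(SUP z\<in>{1..}. ?o z) \<ge> 0" by (meson abs_ge_zero order_trans)
  have N: "Z_dist \<beta>1 \<beta>2 \<Phi> \<Psi> = (SUP z\<in>{0..1}. ?i z) + (SUP z\<in>{1..}. ?o z)"
    by (simp add: Z_dist_def Z_norm_def)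
  hence N0: "Z_dist \<beta>1 \<beta>2 \<Phi> \<Psi> \<ge> 0" using si so by simp
  show ?thesis
  proof (cases "z \<le> 1")
    case True
    have "?i z \<le> (SUP z\<in>{0..1}. ?i z)" using True assms(3) by (intro cSUP_upper[OF _ bi]) auto
    hence "?i z \<le> Z_dist \<beta>1 \<beta>2 \<Phi> \<Psi> * 1" using N so by simp
    also have "\<dots> \<le> Z_dist \<beta>1 \<beta>2 \<Phi> \<Psi> * (wt_const * wt z)"
      using True assms(3) N0 by (intro mult_left_mono wt_const_inner) auto
    finally show ?thesis by (simp add: mult_ac)
  next
    case False
    have "?o z \<le> (SUP z\<in>{1..}. ?o z)" using False by (intro cSUP_upper[OF _ bo]) auto
    hence "?o z \<le> Z_dist \<beta>1 \<beta>2 \<Phi> \<Psi>" using N si by simp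
    moreover have "?i z = ?o z * (exp (- \<beta>1 * z) * z powr (- \<beta>2))"
    proof -
      have "?o z = ?i z * (exp (\<beta>1 * z) * z powr \<beta>2)" by (simp add: abs_mult)
      moreover have "(exp (\<beta>1 * z) * z powr \<beta>2) * (exp (- \<beta>1 * z) * z powr (- \<beta>2)) = 1"
        using False by (simp add: exp_minus powr_minus divide_simps)
      ultimately show ?thesis by (metis mult.assoc mult.right_neutral)
    qed
    ultimately have "?i z \<le> Z_dist \<beta>1 \<beta>2 \<Phi> \<Psi> * (exp (- \<beta>1 * z) * z powr (- \<beta>2))"
      by (simp add: mult_right_mono)
    also have "\<dots> \<le> Z_dist \<beta>1 \<beta>2 \<Phi> \<Psi> * (wt_const * wt z)"
      using False N0 by (intro mult_left_mono wt_const_outer) auto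
    finally show ?thesis by (simp add: mult_ac)
  qed
qed

section \<open>Convolution\<close>

definition conv_const :: real where "conv_const = 2 powr \<beta>2 / (\<beta>2 - 1)"

text \<open>One of the two arguments is at least \<open>z / 2\<close>, which gives the decay of \<open>wt z\<close>; the other
  factor is left for integration in \<open>y\<close>.\<close>
lemma wt_product:
  assumes "0 \<le> y" "y \<le> z"
  shows "wt (z - y) * wt y \<le> 2 powr \<beta>2 * wt z * ((1 + y) powr (- \<beta>2) + (1 + z - y) powr (- \<beta>2))"
proof -
  have half: "p powr (- \<beta>2) \<le> 2 powr \<beta>2 * (1 + z) powr (- \<beta>2)" if "p \<ge> (1 + z) / 2" for p
  proof -
    have "((1 + z) / 2) powr \<beta>2 \<le> p powr \<beta>2" using assms that b2 by (intro powr_mono2) auto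
    thus ?thesis using assms that by (simp add: powr_minus powr_divide field_simps)
  qed
  have E: "wt (z - y) * wt y = exp (- \<beta>1 * z) * ((1 + z - y) powr (- \<beta>2) * (1 + y) powr (- \<beta>2))"
    by (simp add: wt_def algebra_simps flip: exp_add)
  have "(1 + z - y) powr (- \<beta>2) * (1 + y) powr (- \<beta>2)
     \<le> 2 powr \<beta>2 * (1 + z) powr (- \<beta>2) * ((1 + y) powr (- \<beta>2) + (1 + z - y) powr (- \<beta>2))"
  proof (cases "y \<ge> z / 2")
    case True
    hence "(1 + z - y) powr (- \<beta>2) * (1 + y) powr (- \<beta>2)
        \<le> (1 + z - y) powr (- \<beta>2) * (2 powr \<beta>2 * (1 + z) powr (- \<beta>2))"
      by (intro mult_left_mono half) auto
    thus ?thesis by (simp add: algebra_simps add_increasing)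
  next
    case False
    hence "(1 + z - y) powr (- \<beta>2) * (1 + y) powr (- \<beta>2)
        \<le> (2 powr \<beta>2 * (1 + z) powr (- \<beta>2)) * (1 + y) powr (- \<beta>2)"
      by (intro mult_right_mono half) auto
    thus ?thesis by (simp add: algebra_simps add_increasing2)
  qed
  from mult_left_mono[OF this, of "exp (- \<beta>1 * z)"] show ?thesis
    unfolding E by (simp add: wt_def mult_ac)
qed

text \<open>Here \<open>\<beta>2 > 1\<close> is used: the power is integrable, so the convolution decays exactly
  as fast as its factors.\<close>
lemma conv_bound:
  assumes M: "\<And>z. z \<ge> 0 \<Longrightarrow> \<bar>\<Phi> z\<bar> \<le> M * wt z" and N: "\<And>z. z \<ge> 0 \<Longrightarrow> \<bar>\<Psi> z\<bar> \<le> N * wt z" and z: "z \<ge> 0"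
  shows "\<bar>conv \<Phi> \<Psi> z\<bar> \<le> M * N * conv_const * wt z"
proof -
  have M0: "M \<ge> 0" using M[of 0] abs_ge_zero[of "\<Phi> 0"] by (simp add: wt_def)
  have N0: "N \<ge> 0" using N[of 0] abs_ge_zero[of "\<Psi> 0"] by (simp add: wt_def)
  define g where "g y = M * N * (2 powr \<beta>2 * wt z * ((1 + y) powr (- \<beta>2) + (1 + z - y) powr (- \<beta>2)))" for y
  have bb: "\<beta>2 - 1 \<noteq> 0" using b2 by auto
  have I1: "((\<lambda>y. (1 + y) powr (- \<beta>2)) has_integral
     (- ((1 + z) powr (1 - \<beta>2)) / (\<beta>2 - 1) - (- ((1 + 0) powr (1 - \<beta>2)) / (\<beta>2 - 1)))) {0..z}"
    using z bb by (intro fundamental_theorem_of_calculus)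
      (auto intro!: derivative_eq_intros simp: has_real_derivative_iff_has_vector_derivative[symmetric] divide_simps, simp add: algebra_simps)
  have I2: "((\<lambda>y. (1 + z - y) powr (- \<beta>2)) has_integral
     ((1 + z - z) powr (1 - \<beta>2) / (\<beta>2 - 1) - ((1 + z - 0) powr (1 - \<beta>2) / (\<beta>2 - 1)))) {0..z}"
    using z bb by (intro fundamental_theorem_of_calculus)
      (auto intro!: derivative_eq_intros simp: has_real_derivative_iff_has_vector_derivative[symmetric] divide_simps, simp add: algebra_simps)
  have I: "(g has_integral M * N * (2 powr \<beta>2 * wt z *
      ((1 - (1 + z) powr (1 - \<beta>2)) / (\<beta>2 - 1) + (1 - (1 + z) powr (1 - \<beta>2)) / (\<beta>2 - 1)))) {0..z}"
    unfolding g_def using has_integral_add[OF I1 I2]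
    by (intro has_integral_mult_right) (simp add: diff_divide_distrib)
  have gi: "set_integrable lebesgue {0..z} g"
    unfolding g_def using z by (intro absolutely_integrable_continuous_real continuous_intros) auto
  have "\<bar>LINT y:{0..z}|lebesgue. \<Phi> (z - y) * \<Psi> y\<bar> \<le> (LINT y:{0..z}|lebesgue. g y)"
  proof (rule set_LINT_abs_bound[OF gi])
    fix y assume y: "y \<in> {0..z}"
    have "\<bar>\<Phi> (z - y) * \<Psi> y\<bar> \<le> (M * wt (z - y)) * (N * wt y)"
      unfolding abs_mult using y M0 wt_pos[of "z-y"] by (intro mult_mono M N) auto
    also have "\<dots> = M * N * (wt (z - y) * wt y)" by simp
    also have "\<dots> \<le> g y" unfolding g_def
      using y M0 N0 by (intro mult_left_mono wt_product) auto
    finally show "\<bar>\<Phi> (z - y) * \<Psi> y\<bar> \<le> g y" .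
  qed
  also have "\<dots> = M * N * (2 powr \<beta>2 * wt z *
      (2 * (1 - (1 + z) powr (1 - \<beta>2)) / (\<beta>2 - 1)))"
    using I gi by (simp add: set_lebesgue_integral_eq_integral integral_unique)
  also have "\<dots> \<le> M * N * (2 powr \<beta>2 * wt z * (2 / (\<beta>2 - 1)))"
    using M0 N0 wt_pos[OF z] b2 by (intro mult_left_mono divide_right_mono) auto
  also have "\<dots> = 2 * (M * N * conv_const * wt z)" by (simp add: conv_const_def)
  finally show ?thesis by (simp add: conv_def abs_mult)
qed

end

lemma measurable_reflect:
  fixes f :: "real \<Rightarrow> real"
  assumes "f \<in> borel_measurable lebesgue"
  shows "(\<lambda>y. f (z - y)) \<in> borel_measurable lebesgue"
proof -
  have "(\<lambda>x::real. z + (-1) * x) \<in> lebesgue \<rightarrow>\<^sub>M lebesgue"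
    using lebesgue_affine_measurable[where c = "\<lambda>x::real. -1" and t = z] by simp
  hence "(\<lambda>x::real. z - x) \<in> lebesgue \<rightarrow>\<^sub>M lebesgue" by simp
  from measurable_compose[OF this assms] show ?thesis .
qed

definition zero_ext :: "(real \<Rightarrow> real) \<Rightarrow> real \<Rightarrow> real" where
  "zero_ext \<Phi> z = (if z \<in> {0..} then \<Phi> z else 0)"

lemma zero_ext_measurable:
  "\<Phi> \<in> borel_measurable (lebesgue_on {0..}) \<Longrightarrow> zero_ext \<Phi> \<in> borel_measurable lebesgue"
  unfolding zero_ext_def[abs_def] by (subst borel_measurable_if) auto

lemma conv_zero_ext: "conv \<Phi> \<Psi> z = 1/2 * (LINT y|lebesgue. zero_ext \<Phi> (z - y) * zero_ext \<Psi> y)"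
  unfolding conv_def set_lebesgue_integral_def
  by (intro arg_cong[where f = "\<lambda>x. 1/2 * x"] Bochner_Integration.integral_cong)
     (auto simp: zero_ext_def indicator_def)

text \<open>A function that is only Lebesgue measurable is replaced by a Borel function that is equal to
  it almost everywhere, which does not affect any value of the convolution.\<close>
lemma conv_measurable:
  assumes "\<Phi> \<in> borel_measurable (lebesgue_on {0..})"
  shows "conv \<Phi> \<Phi> \<in> borel_measurable borel"
proof -
  obtain F where F: "F \<in> borel_measurable lborel" "AE x in lborel. zero_ext \<Phi> x = F x"
    using completion_ex_borel_measurable_real[OF zero_ext_measurable[OF assms]] by auto
  have [measurable]: "F \<in> borel_measurable borel" using F(1) by simp
  obtain N where N: "N \<in> null_sets lborel" "\<And>x. x \<notin> N \<Longrightarrow> zero_ext \<Phi> x = F x"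
    using F(2) unfolding eventually_ae_filter by auto
  have N': "AE x in lborel. x \<notin> N" using N(1) by (rule AE_not_in)
  have Nb [measurable]: "N \<in> sets borel" using N(1) by auto
  have "conv \<Phi> \<Phi> z = 1/2 * (LINT y|lborel. F (z - y) * F y)" for z
  proof -
    have "AE x in lborel. z + (-1) * x \<notin> N"
      by (rule AE_borel_affine[of "-1" "\<lambda>x. x \<notin> N"]) (use N' in measurable)
    hence "AE x in lborel. zero_ext \<Phi> (z - x) * zero_ext \<Phi> x = F (z - x) * F x"
      using N' by eventually_elim (simp add: N(2))
    hence ae: "AE x in lebesgue. zero_ext \<Phi> (z - x) * zero_ext \<Phi> x = F (z - x) * F x"
      by (rule AE_completion)
    have "(LINT y|lebesgue. zero_ext \<Phi> (z - y) * zero_ext \<Phi> y) = (LINT y|lebesgue. F (z - y) * F y)"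
    proof (rule integral_cong_AE[OF _ _ ae])
      show "(\<lambda>y. zero_ext \<Phi> (z - y) * zero_ext \<Phi> y) \<in> borel_measurable lebesgue"
        by (intro borel_measurable_times measurable_reflect zero_ext_measurable assms)
      show "(\<lambda>y. F (z - y) * F y) \<in> borel_measurable lebesgue"
        by (rule measurable_completion) measurable
    qed
    also have "\<dots> = (LINT y|lborel. F (z - y) * F y)"
      by (rule integral_completion) measurable
    finally show ?thesis by (simp add: conv_zero_ext)
  qed
  hence "conv \<Phi> \<Phi> = (\<lambda>z. 1/2 * (LINT y|lborel. F (z - y) * F y))" by auto
  thus ?thesis by simp
qed

lemma conv_integrable:
  fixes \<Phi> \<Psi> :: "real \<Rightarrow> real"
  assumes m: "\<Phi> \<in> borel_measurable (lebesgue_on {0..})" "\<Psi> \<in> borel_measurable (lebesgue_on {0..})"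
    and b: "\<And>y. y \<ge> 0 \<Longrightarrow> \<bar>\<Phi> y\<bar> \<le> M" "\<And>y. y \<ge> 0 \<Longrightarrow> \<bar>\<Psi> y\<bar> \<le> N"
  shows "set_integrable lebesgue {0..z} (\<lambda>y. \<Phi> (z - y) * \<Psi> y)"
proof (rule measurable_bounded_by_integrable_imp_absolutely_integrable)
  have "(\<lambda>y. zero_ext \<Phi> (z - y) * zero_ext \<Psi> y) \<in> borel_measurable (lebesgue_on {0..z})"
    by (intro measurable_restrict_space1 borel_measurable_times measurable_reflect zero_ext_measurable m)
  also have "?this \<longleftrightarrow> (\<lambda>y. \<Phi> (z - y) * \<Psi> y) \<in> borel_measurable (lebesgue_on {0..z})"
    by (intro measurable_cong) (auto simp: zero_ext_def)
  finally show "(\<lambda>y. \<Phi> (z - y) * \<Psi> y) \<in> borel_measurable (lebesgue_on {0..z})" .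
  show "(\<lambda>y. M * N) integrable_on {0..z}" by auto
  fix y assume y: "y \<in> {0..z}"
  have "M \<ge> 0" using b(1)[of 0] by linarith
  thus "norm (\<Phi> (z - y) * \<Psi> y) \<le> M * N"
    unfolding real_norm_def abs_mult using y by (intro mult_mono b) auto
qed auto

context weight
begin

lemma bound_by_wt: "\<bar>x\<bar> \<le> M * wt z \<Longrightarrow> z \<ge> 0 \<Longrightarrow> \<bar>x\<bar> \<le> M"
proof -
  assume a: "\<bar>x\<bar> \<le> M * wt z" "z \<ge> 0"
  hence "M \<ge> 0" using wt_pos[of z] by (meson abs_ge_zero order_trans zero_le_mult_iff not_less)
  thus ?thesis using a wt_le_1[of z] mult_left_mono[of "wt z" 1 M] by simp
qed

lemma conv_diff_bound:
  assumes m: "\<Phi> \<in> borel_measurable (lebesgue_on {0..})" "\<Psi> \<in> borel_measurable (lebesgue_on {0..})"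
    and b: "\<And>z. z \<ge> 0 \<Longrightarrow> \<bar>\<Phi> z\<bar> \<le> M * wt z" "\<And>z. z \<ge> 0 \<Longrightarrow> \<bar>\<Psi> z\<bar> \<le> M * wt z"
    and d: "\<And>z. z \<ge> 0 \<Longrightarrow> \<bar>\<Phi> z - \<Psi> z\<bar> \<le> d * wt z" and z: "z \<ge> 0"
  shows "\<bar>conv \<Phi> \<Phi> z - conv \<Psi> \<Psi> z\<bar> \<le> 2 * M * conv_const * d * wt z"
proof -
  let ?D = "\<lambda>z. \<Phi> z - \<Psi> z"
  have mD: "?D \<in> borel_measurable (lebesgue_on {0..})" by (intro borel_measurable_diff m)
  note c = bound_by_wt[OF b(1)] bound_by_wt[OF b(2)] bound_by_wt[OF d]
  have i1: "set_integrable lebesgue {0..z} (\<lambda>y. \<Phi> (z - y) * ?D y)"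
    by (rule conv_integrable[OF m(1) mD]) (rule c; assumption)+
  have i2: "set_integrable lebesgue {0..z} (\<lambda>y. ?D (z - y) * \<Psi> y)"
    by (rule conv_integrable[OF mD m(2)]) (rule c; assumption)+
  have i3: "set_integrable lebesgue {0..z} (\<lambda>y. \<Phi> (z - y) * \<Phi> y)"
    by (rule conv_integrable[OF m(1) m(1)]) (rule c; assumption)+
  have i4: "set_integrable lebesgue {0..z} (\<lambda>y. \<Psi> (z - y) * \<Psi> y)"
    by (rule conv_integrable[OF m(2) m(2)]) (rule c; assumption)+
  have "conv \<Phi> \<Phi> z - conv \<Psi> \<Psi> z = 1/2 * (LINT y:{0..z}|lebesgue. \<Phi> (z - y) * \<Phi> y - \<Psi> (z - y) * \<Psi> y)"
    by (subst set_integral_diff(2)[OF i3 i4]) (simp add: conv_def)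
  also have "(\<lambda>y. \<Phi> (z - y) * \<Phi> y - \<Psi> (z - y) * \<Psi> y) = (\<lambda>y. \<Phi> (z - y) * ?D y + ?D (z - y) * \<Psi> y)"
    by (auto simp: algebra_simps)
  also have "1/2 * (LINT y:{0..z}|lebesgue. \<Phi> (z - y) * ?D y + ?D (z - y) * \<Psi> y) = conv \<Phi> ?D z + conv ?D \<Psi> z"
    by (subst set_integral_add(2)[OF i1 i2]) (simp add: conv_def)
  finally have "\<bar>conv \<Phi> \<Phi> z - conv \<Psi> \<Psi> z\<bar> \<le> \<bar>conv \<Phi> ?D z\<bar> + \<bar>conv ?D \<Psi> z\<bar>" by simp
  also have "\<dots> \<le> M * d * conv_const * wt z + d * M * conv_const * wt z"
    by (intro add_mono conv_bound b d z)
  finally show ?thesis by (simp add: algebra_simps)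
qed

section \<open>Tail integrals\<close>

definition tail_const :: real where "tail_const = (max 1 (24 / \<beta>1)) ^ 12 * (2 / \<beta>1)"

lemma tail_const_pos: "tail_const > 0" using b1 by (simp add: tail_const_def)

text \<open>Half of the exponential decay absorbs the twelfth power: \<open>1 + u \<le> k exp (u / k)\<close> with
  \<open>k \<ge> 24 / \<beta>1\<close>.\<close>
lemma tail_integral:
  fixes F :: "real \<Rightarrow> real"
  assumes m: "F \<in> borel_measurable (lebesgue_on {z..})" and K: "K \<ge> 0"
    and le: "\<And>x. x \<ge> z \<Longrightarrow> \<bar>F x\<bar> \<le> K * ((1 + (x - z)) ^ 12 * exp (- \<beta>1 * (x - z)))"
  shows "set_integrable lebesgue {z..} F" and "\<bar>LINT x:{z..}|lebesgue. F x\<bar> \<le> K * tail_const"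
proof -
  define k where "k = max 1 (24 / \<beta>1)"
  have k: "k \<ge> 1" "k \<ge> 24 / \<beta>1" by (auto simp: k_def)
  define g where "g x = (K * k ^ 12 * exp (\<beta>1 / 2 * z)) * exp (- (\<beta>1 / 2) * x)" for x
  have le2: "\<bar>F x\<bar> \<le> g x" if x: "x \<ge> z" for x
  proof -
    define u where "u = x - z"
    have u: "u \<ge> 0" using x by (simp add: u_def)
    have "1 + u \<le> k * (1 + u / k)" using k u by (simp add: field_simps)
    also have "\<dots> \<le> k * exp (u / k)" using k exp_ge_add_one_self[of "u / k"] by (intro mult_left_mono) auto
    finally have "(1 + u) ^ 12 \<le> (k * exp (u / k)) ^ 12" using u by (intro power_mono) auto
    also have "\<dots> = k ^ 12 * exp (12 * (u / k))"
      by (simp add: power_mult_distrib exp_of_nat_mult[symmetric])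
    also have "\<dots> \<le> k ^ 12 * exp (\<beta>1 / 2 * u)"
    proof -
      have "24 \<le> k * \<beta>1" using k b1 by (simp add: field_simps)
      hence "24 * u \<le> k * \<beta>1 * u" using u by (intro mult_right_mono) auto
      hence "12 * (u / k) \<le> \<beta>1 / 2 * u" using k by (simp add: field_simps)
      thus ?thesis using k by simp
    qed
    finally have "(1 + u) ^ 12 * exp (- \<beta>1 * u) \<le> k ^ 12 * exp (\<beta>1 / 2 * u) * exp (- \<beta>1 * u)"
      by (intro mult_right_mono) auto
    also have "\<dots> = k ^ 12 * exp (- (\<beta>1 / 2) * u)" by (simp add: algebra_simps flip: exp_add)
    finally have "K * ((1 + u) ^ 12 * exp (- \<beta>1 * u)) \<le> K * (k ^ 12 * exp (- (\<beta>1 / 2) * u))"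
      using K by (intro mult_left_mono)
    also have "exp (- (\<beta>1 / 2) * u) = exp (\<beta>1 / 2 * z) * exp (- (\<beta>1 / 2) * x)"
      unfolding exp_add[symmetric] by (simp add: u_def field_simps)
    also have "K * (k ^ 12 * \<dots>) = g x" by (simp add: g_def)
    finally show ?thesis using le[OF x] by (simp add: u_def)
  qed
  have gI: "(g has_integral (K * k ^ 12 * exp (\<beta>1 / 2 * z)) * (exp (- (\<beta>1 / 2) * z) / (\<beta>1 / 2))) {z..}"
    unfolding g_def using b1 by (intro has_integral_mult_right has_integral_exp_minus_to_infinity) auto
  have val: "(K * k ^ 12 * exp (\<beta>1 / 2 * z)) * (exp (- (\<beta>1 / 2) * z) / (\<beta>1 / 2)) = K * tail_const"
    unfolding tail_const_def k_def[symmetric] using b1 by (simp add: field_simps flip: exp_add)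
  have gi: "set_integrable lebesgue {z..} g"
    using gI K k by (intro nonnegative_absolutely_integrable_1) (auto simp: g_def has_integral_integrable)
  show "set_integrable lebesgue {z..} F"
    by (rule measurable_bounded_by_integrable_imp_absolutely_integrable[OF m _ has_integral_integrable[OF gI]])
       (use le2 in auto)
  have "\<bar>LINT x:{z..}|lebesgue. F x\<bar> \<le> (LINT x:{z..}|lebesgue. g x)"
    by (rule set_LINT_abs_bound[OF gi]) (use le2 in auto)
  also have "\<dots> = K * tail_const"
    using gI val gi by (simp add: set_lebesgue_integral_eq_integral integral_unique)
  finally show "\<bar>LINT x:{z..}|lebesgue. F x\<bar> \<le> K * tail_const" .
qed

end

section \<open>The integral operator in explicit form\<close>

lemma psi_is_psi: "\<delta> > 0 \<Longrightarrow> is_psi \<epsilon> \<epsilon>t \<delta> (psi \<epsilon> \<epsilon>t \<delta>)"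
  unfolding psi_def by (rule theI'[OF psi_ex1])

text \<open>The quotient of \<open>psi\<close> and the explicit expression has derivative zero; the constant does
  not vanish because \<open>psi\<close> has first moment \<open>1\<close> over \<open>[0, 1]\<close>.\<close>
lemma psi_explicit:
  assumes d: "\<delta> > 0"
  shows "\<exists>c. c \<noteq> 0 \<and> (\<forall>z\<ge>0. psi \<epsilon> \<epsilon>t \<delta> z
            = c * a_fun \<delta> z * exp (\<epsilon> * prim_a \<delta> z + \<epsilon>t * prim_xa \<delta> z - prim_a \<delta> z))"
proof -
  let ?p = "psi \<epsilon> \<epsilon>t \<delta>" and ?E = "\<lambda>z. prim_a \<delta> z - \<epsilon> * prim_a \<delta> z - \<epsilon>t * prim_xa \<delta> z"
  note p = psi_is_psi[OF d, of \<epsilon> \<epsilon>t, unfolded is_psi_def]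
  define F where "F z = ?p z * (den \<delta> z * exp (?E z))" for z
  have Fc: "continuous_on {0..} F"
    unfolding F_def using p d
    by (intro continuous_intros continuous_on_den prim_a_cont prim_xa_cont) auto
  have F': "(F has_real_derivative 0) (at z)" if z: "z > 0" for z
  proof -
    have dp: "den \<delta> z > 0" using d z by (intro den_pos) auto
    have 1: "(?p has_real_derivative - a_fun \<delta> z * (b_fun \<delta> z - \<epsilon>t * z - \<epsilon>) * ?p z) (at z)"
      using p z by auto
    have 2: "((\<lambda>z. exp (?E z)) has_real_derivative
       exp (?E z) * (a_fun \<delta> z - \<epsilon> * a_fun \<delta> z - \<epsilon>t * (z * a_fun \<delta> z))) (at z)"
      by (intro DERIV_fun_exp DERIV_diff DERIV_cmult prim_a_deriv prim_xa_deriv d z)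
    let ?k = "1 - 1/3 * (lambda_LSW - \<delta>) * z powr (-2/3)"
    have k: "?k = den \<delta> z * (a_fun \<delta> z * b_fun \<delta> z - a_fun \<delta> z)"
      unfolding ab_eq[OF dp] using dp by simp
    have a: "den \<delta> z * a_fun \<delta> z = 1" using dp by (simp add: a_fun_den)
    have "(F has_real_derivative
        (- a_fun \<delta> z * (b_fun \<delta> z - \<epsilon>t * z - \<epsilon>) * ?p z) * (den \<delta> z * exp (?E z))
        + (?k * exp (?E z) + (exp (?E z) * (a_fun \<delta> z - \<epsilon> * a_fun \<delta> z - \<epsilon>t * (z * a_fun \<delta> z))) * den \<delta> z) * ?p z) (at z)"
      unfolding F_def by (intro DERIV_mult 1 2 den_deriv z)
    also have "(- a_fun \<delta> z * (b_fun \<delta> z - \<epsilon>t * z - \<epsilon>) * ?p z) * (den \<delta> z * exp (?E z))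
        + (?k * exp (?E z) + (exp (?E z) * (a_fun \<delta> z - \<epsilon> * a_fun \<delta> z - \<epsilon>t * (z * a_fun \<delta> z))) * den \<delta> z) * ?p z = 0"
      unfolding k by (simp add: algebra_simps)
    finally show ?thesis .
  qed
  have F0: "F z = F 0" if "z \<ge> 0" for z
  proof (cases "z = 0")
    case False
    thus ?thesis using that F'
      by (intro DERIV_isconst_end continuous_on_subset[OF Fc]) auto
  qed simp
  have eq: "?p z = F 0 * a_fun \<delta> z * exp (\<epsilon> * prim_a \<delta> z + \<epsilon>t * prim_xa \<delta> z - prim_a \<delta> z)" if "z \<ge> 0" for z
  proof -
    have "den \<delta> z > 0" using d that by (rule den_pos)
    hence "F z * a_fun \<delta> z * exp (- ?E z) = ?p z"
      unfolding F_def exp_minus by (simp add: a_fun_den)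
    thus ?thesis using F0[OF that] by (simp add: diff_diff_eq2 add.commute add.left_commute)
  qed
  have "F 0 \<noteq> 0"
  proof
    assume "F 0 = 0"
    have "(LINT z:{0..1}|lebesgue. z * ?p z) = (LINT z:{0..1}|lebesgue. (0::real))"
      using eq \<open>F 0 = 0\<close> by (subst set_lebesgue_integral_cong[where g = "\<lambda>z. 0"]) auto
    thus False using p by simp
  qed
  thus ?thesis using eq by blast
qed

lemma psi_ratio:
  assumes "\<delta> > 0" "z \<ge> 0" "x \<ge> 0"
  shows "psi \<epsilon> \<epsilon>t \<delta> z / psi \<epsilon> \<epsilon>t \<delta> x = a_fun \<delta> z / a_fun \<delta> x
     * exp (prim_a \<delta> x - prim_a \<delta> z - (\<epsilon> * (prim_a \<delta> x - prim_a \<delta> z) + \<epsilon>t * (prim_xa \<delta> x - prim_xa \<delta> z)))"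
proof -
  obtain c where c: "c \<noteq> 0" "\<And>z. z \<ge> 0 \<Longrightarrow> psi \<epsilon> \<epsilon>t \<delta> z
       = c * a_fun \<delta> z * exp (\<epsilon> * prim_a \<delta> z + \<epsilon>t * prim_xa \<delta> z - prim_a \<delta> z)"
    using psi_explicit[OF assms(1), of \<epsilon> \<epsilon>t] by blast
  have "psi \<epsilon> \<epsilon>t \<delta> z / psi \<epsilon> \<epsilon>t \<delta> x = a_fun \<delta> z / a_fun \<delta> x *
     (exp (\<epsilon> * prim_a \<delta> z + \<epsilon>t * prim_xa \<delta> z - prim_a \<delta> z) / exp (\<epsilon> * prim_a \<delta> x + \<epsilon>t * prim_xa \<delta> x - prim_a \<delta> x))"
    using c(1) by (simp add: c(2)[OF assms(2)] c(2)[OF assms(3)])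
  thus ?thesis by (simp add: algebra_simps flip: exp_diff)
qed

text \<open>The contribution of the two parameters to the exponent of the quotient of two values of
  \<open>psi\<close>.\<close>
definition damping :: "real \<Rightarrow> real \<Rightarrow> real \<Rightarrow> real \<Rightarrow> real \<Rightarrow> real" where
  "damping \<delta> \<epsilon> \<epsilon>t z x = \<epsilon> * (prim_a \<delta> x - prim_a \<delta> z) + \<epsilon>t * (prim_xa \<delta> x - prim_xa \<delta> z)"

text \<open>The factor \<open>a_fun \<delta> x\<close> of the integrand cancels against the quotient of the values of \<open>psi\<close>,
  so the kernel is no longer singular at \<open>1/2\<close>.\<close>
lemma I_h_explicit:
  assumes "\<delta> > 0" "z \<ge> 0"
  shows "I_h h \<epsilon> \<epsilon>t \<delta> z
    = phi \<delta> z * (LINT x:{z..}|lebesgue. \<epsilon> * (x * exp (prim_a \<delta> x)) * exp (- damping \<delta> \<epsilon> \<epsilon>t z x) * h x)"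
proof -
  have "(LINT x:{z..}|lebesgue. x * a_fun \<delta> x * (psi \<epsilon> \<epsilon>t \<delta> z / psi \<epsilon> \<epsilon>t \<delta> x) * h x)
    = (LINT x:{z..}|lebesgue. phi \<delta> z * (x * exp (prim_a \<delta> x) * exp (- damping \<delta> \<epsilon> \<epsilon>t z x) * h x))"
  proof (intro set_lebesgue_integral_cong allI impI)
    fix x assume x: "x \<in> {z..}"
    have a: "a_fun \<delta> x > 0" using x assms by (intro a_fun_pos den_pos) auto
    have "exp (prim_a \<delta> x - prim_a \<delta> z - damping \<delta> \<epsilon> \<epsilon>t z x)
       = exp (prim_a \<delta> x) * exp (- prim_a \<delta> z) * exp (- damping \<delta> \<epsilon> \<epsilon>t z x)"
      by (simp flip: exp_add)
    thus "x * a_fun \<delta> x * (psi \<epsilon> \<epsilon>t \<delta> z / psi \<epsilon> \<epsilon>t \<delta> x) * h x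
       = phi \<delta> z * (x * exp (prim_a \<delta> x) * exp (- damping \<delta> \<epsilon> \<epsilon>t z x) * h x)"
      using a x assms by (subst psi_ratio) (auto simp: damping_def phi_def)
  qed auto
  hence "I_h h \<epsilon> \<epsilon>t \<delta> z = phi \<delta> z * (\<epsilon> * (LINT x:{z..}|lebesgue. x * exp (prim_a \<delta> x) * exp (- damping \<delta> \<epsilon> \<epsilon>t z x) * h x))"
    unfolding I_h_def by simp
  also have "\<epsilon> * (LINT x:{z..}|lebesgue. x * exp (prim_a \<delta> x) * exp (- damping \<delta> \<epsilon> \<epsilon>t z x) * h x)
    = (LINT x:{z..}|lebesgue. \<epsilon> * (x * exp (prim_a \<delta> x) * exp (- damping \<delta> \<epsilon> \<epsilon>t z x) * h x))"
    by simp
  finally show ?thesis by (simp add: mult.assoc)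
qed

section \<open>Differences of two values of the operator\<close>

lemma continuous_imp_meas:
  fixes f :: "real \<Rightarrow> real"
  assumes "continuous_on {0..} f" "A \<subseteq> {0..}" "A \<in> sets lebesgue"
  shows "f \<in> borel_measurable (lebesgue_on A)"
  by (rule continuous_imp_measurable_on_sets_lebesgue[OF continuous_on_subset[OF assms(1,2)] assms(3)])

lemma borel_imp_meas:
  fixes f :: "real \<Rightarrow> real"
  assumes "f \<in> borel_measurable borel"
  shows "f \<in> borel_measurable (lebesgue_on A)"
  by (intro measurable_restrict_space1 measurable_completion) (use assms in simp)

text \<open>The order of all error terms. It is exponentially small because \<open>prim_a \<delta> 1\<close> is at
  least of order \<open>1 / sqrt \<delta>\<close>.\<close>
definition smallness :: "real \<Rightarrow> real" where
  "smallness \<delta> = exp (- prim_a \<delta> 1) * (1 + prim_a \<delta> 1) / \<delta>"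

lemma smallness_nonneg: "\<delta> > 0 \<Longrightarrow> smallness \<delta> \<ge> 0"
  using prim_a_mono[of \<delta> 0 1] by (simp add: smallness_def)

lemma smallness_tendsto:
  "((\<lambda>\<delta>::real. exp (- 1 / (9 * sqrt \<delta>)) * (1 + 2 / \<delta>) / \<delta>) \<longlongrightarrow> 0) (at_right 0)"
  by real_asymp

lemma smallness_le:
  assumes "e > 0"
  shows "\<exists>\<delta>0>0. \<forall>\<delta>. 0 < \<delta> \<and> \<delta> \<le> \<delta>0 \<longrightarrow>
     smallness \<delta> \<le> e"
proof -
  have "\<forall>\<^sub>F \<delta> in at_right 0. exp (- 1 / (9 * sqrt \<delta>)) * (1 + 2 / \<delta>) / \<delta> < e"
    using order_tendstoD(2)[OF smallness_tendsto assms] .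
  then obtain b where b: "b > 0" "\<And>\<delta>. 0 < \<delta> \<Longrightarrow> \<delta> < b \<Longrightarrow> exp (- 1 / (9 * sqrt \<delta>)) * (1 + 2 / \<delta>) / \<delta> < e"
    unfolding eventually_at_right_field by auto
  show ?thesis
  proof (intro exI[of _ "min (1/10) (b/2)"] conjI allI impI)
    fix \<delta> :: real assume d: "0 < \<delta> \<and> \<delta> \<le> min (1/10) (b/2)"
    have "smallness \<delta> \<le> exp (- 1 / (9 * sqrt \<delta>)) * (1 + 2 / \<delta>) / \<delta>"
      unfolding smallness_def using d prim_a_1_lower[of \<delta>] prim_a_1_upper[of \<delta>] prim_a_mono[of \<delta> 0 1]
      by (intro divide_right_mono mult_mono) auto
    also have "\<dots> < e" using d b by auto
    finally show "smallness \<delta> \<le> e" by simp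
  qed (use b in auto)
qed

context weight
begin

text \<open>The factor in front of \<open>wt z\<close> when \<open>phi \<delta> z\<close> is multiplied by a tail integral from \<open>z\<close>,
  see \<open>weighted_tail\<close>. Above \<open>1\<close> it equals \<open>z * a_fun \<delta> z\<close>; on \<open>[0, 1]\<close> it is of size up to
  \<open>exp (prim_a \<delta> 1) / \<delta>\<close>.\<close>
definition amplitude :: "real \<Rightarrow> real \<Rightarrow> real" where
  "amplitude \<delta> z = phi \<delta> z * (exp (prim_a \<delta> (max z 1)) * max 1 z)"

text \<open>The tail integral from \<open>0\<close> without damping. Multiplied by \<open>\<epsilon>\<close> it is the number \<open>q\<close> such
  that the operator is close to \<open>q * phi \<delta>\<close> on \<open>[0, 1]\<close>.\<close>
definition total_source :: "real \<Rightarrow> (real \<Rightarrow> real) \<Rightarrow> real" where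
  "total_source \<delta> h = (LINT x:{0..}|lebesgue. x * exp (prim_a \<delta> x) * h x)"

text \<open>The factor \<open>max 1 z\<close> is compensated in \<open>amplitude\<close> by the decay \<open>a_fun \<delta> z \<le> 10 / z\<close>.\<close>
lemma kernel_bound:
  assumes "\<delta> > 0" "0 \<le> z" "z \<le> x"
  shows "x * exp (prim_a \<delta> x) * wt x
    \<le> exp (prim_a \<delta> (max z 1)) * max 1 z * wt z * ((1 + (x - z)) ^ 11 * exp (- \<beta>1 * (x - z)))"
proof -
  have 1: "x \<le> max 1 z * (1 + (x - z))"
  proof (cases "z \<le> 1")
    case False
    hence "1 * (x - z) \<le> z * (x - z)" using assms by (intro mult_right_mono) auto
    thus ?thesis using False by (simp add: max_def algebra_simps)
  qed (use assms in \<open>auto simp: max_def\<close>)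
  have "x * exp (prim_a \<delta> x) * wt x \<le> (max 1 z * (1 + (x - z))) * (exp (prim_a \<delta> (max z 1)) * (1 + (x - z)) ^ 10)
      * (exp (- \<beta>1 * (x - z)) * wt z)"
    using assms wt_pos[of x]
    by (intro mult_mono 1 prim_a_growth_general wt_shift mult_nonneg_nonneg) auto
  also have "\<dots> = exp (prim_a \<delta> (max z 1)) * max 1 z * wt z * ((1 + (x - z)) ^ 11 * exp (- \<beta>1 * (x - z)))"
    using power_Suc[of "1 + (x - z)" 10] by (simp add: mult_ac)
  finally show ?thesis .
qed

lemma amplitude_inner:
  assumes "0 < \<delta>" "\<delta> \<le> 1/10" "0 \<le> z" "z \<le> 1"
  shows "amplitude \<delta> z \<le> 2 / \<delta> * exp (prim_a \<delta> 1)"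
proof -
  have "phi \<delta> z \<le> a_fun \<delta> z * 1" unfolding phi_def
    using assms prim_a_mono[of \<delta> 0 z] a_nonneg[of \<delta> z] by (intro mult_left_mono) auto
  hence "phi \<delta> z \<le> 2 / \<delta>" using a_le_inner[of \<delta> z] assms by simp
  hence "phi \<delta> z * exp (prim_a \<delta> 1) \<le> 2 / \<delta> * exp (prim_a \<delta> 1)" by (intro mult_right_mono) auto
  thus ?thesis using assms by (simp add: amplitude_def max.absorb1 max.absorb2)
qed

lemma amplitude_outer:
  assumes "0 < \<delta>" "1 \<le> z"
  shows "amplitude \<delta> z \<le> 10"
proof -
  have "amplitude \<delta> z = z * a_fun \<delta> z" using assms by (simp add: amplitude_def max_def phi_def exp_minus)
  thus ?thesis using a_le_tail[of \<delta> z] assms by (simp add: field_simps)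
qed

lemma amplitude_le:
  assumes "0 < \<delta>" "\<delta> \<le> 1/10" "0 \<le> z"
  shows "amplitude \<delta> z \<le> 2 / \<delta> * exp (prim_a \<delta> 1)"
proof (cases "z \<le> 1")
  case False
  have "10 * 1 \<le> 2 / \<delta> * exp (prim_a \<delta> 1)"
    using assms prim_a_mono[of \<delta> 0 1] by (intro mult_mono) (auto simp: field_simps)
  thus ?thesis using amplitude_outer[of \<delta> z] assms False by simp
qed (use amplitude_inner assms in auto)

text \<open>The source may exceed the weight by a linear factor in the distance from \<open>z\<close>. This room is
  needed for the damping, which grows linearly.\<close>
lemma weighted_tail:
  assumes "\<delta> > 0" "0 \<le> z" and h: "h \<in> borel_measurable (lebesgue_on {z..})"
    "\<And>x. x \<ge> z \<Longrightarrow> \<bar>h x\<bar> \<le> H * (1 + (x - z)) * wt x"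
  shows "set_integrable lebesgue {z..} (\<lambda>x. x * exp (prim_a \<delta> x) * h x)"
    and "phi \<delta> z * \<bar>LINT x:{z..}|lebesgue. x * exp (prim_a \<delta> x) * h x\<bar> \<le> H * tail_const * amplitude \<delta> z * wt z"
proof -
  have "0 \<le> H * wt z" using h(2)[of z] abs_ge_zero[of "h z"] by simp
  hence H: "H \<ge> 0" using wt_pos[OF assms(2)] by (simp add: zero_le_mult_iff)
  let ?K = "exp (prim_a \<delta> (max z 1)) * max 1 z * wt z * H"
  have sub: "{z..} \<subseteq> {0..}" using assms by auto
  have m: "(\<lambda>x. x * exp (prim_a \<delta> x) * h x) \<in> borel_measurable (lebesgue_on {z..})"
    by (intro borel_measurable_times h(1) continuous_imp_meas[OF _ sub] continuous_intros prim_a_cont assms) auto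
  have K: "?K \<ge> 0" using H assms wt_pos[of z] by simp
  have le: "\<bar>x * exp (prim_a \<delta> x) * h x\<bar> \<le> ?K * ((1 + (x - z)) ^ 12 * exp (- \<beta>1 * (x - z)))" if "x \<ge> z" for x
  proof -
    have "\<bar>x * exp (prim_a \<delta> x) * h x\<bar> \<le> x * exp (prim_a \<delta> x) * (H * (1 + (x - z)) * wt x)"
      unfolding abs_mult using that assms(1,2) by (intro mult_mono h) auto
    also have "\<dots> = H * (1 + (x - z)) * (x * exp (prim_a \<delta> x) * wt x)" by simp
    also have "\<dots> \<le> H * (1 + (x - z)) * (exp (prim_a \<delta> (max z 1)) * max 1 z * wt z * ((1 + (x - z)) ^ 11 * exp (- \<beta>1 * (x - z))))"
      using H assms(1,2) that by (intro mult_left_mono kernel_bound) auto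
    also have "\<dots> = ?K * ((1 + (x - z)) ^ 12 * exp (- \<beta>1 * (x - z)))"
      using power_Suc[of "1 + (x - z)" 11] by (simp add: mult_ac)
    finally show ?thesis .
  qed
  note t = tail_integral[OF m K le]
  show "set_integrable lebesgue {z..} (\<lambda>x. x * exp (prim_a \<delta> x) * h x)" by (rule t(1))
  have "phi \<delta> z * \<bar>LINT x:{z..}|lebesgue. x * exp (prim_a \<delta> x) * h x\<bar> \<le> phi \<delta> z * (?K * tail_const)"
    using t(2) assms by (intro mult_left_mono phi_nonneg) auto
  thus "phi \<delta> z * \<bar>LINT x:{z..}|lebesgue. x * exp (prim_a \<delta> x) * h x\<bar> \<le> H * tail_const * amplitude \<delta> z * wt z"
    by (simp add: amplitude_def mult_ac)
qed

lemma le_with_growth: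
  assumes "\<bar>y\<bar> \<le> H * wt x" "0 \<le> z" "z \<le> x"
  shows "\<bar>y\<bar> \<le> H * (1 + (x - z)) * wt x"
proof -
  have "0 \<le> H * wt x" using assms(1) by linarith
  hence "0 \<le> (H * wt x) * (x - z)" using assms(3) by (intro mult_nonneg_nonneg[of "H * wt x"]) auto
  thus ?thesis using assms by (simp add: algebra_simps)
qed

lemma total_source_bound:
  assumes "0 < \<delta>" and h: "h \<in> borel_measurable (lebesgue_on {0..})" "\<And>x. x \<ge> 0 \<Longrightarrow> \<bar>h x\<bar> \<le> H * wt x"
  shows "\<bar>total_source \<delta> h\<bar> \<le> H * tail_const * exp (prim_a \<delta> 1)"
proof -
  have "phi \<delta> 0 * \<bar>LINT x:{0..}|lebesgue. x * exp (prim_a \<delta> x) * h x\<bar> \<le> H * tail_const * amplitude \<delta> 0 * wt 0"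
    by (rule weighted_tail(2)[OF assms(1) order.refl h(1)]) (auto intro!: le_with_growth[OF h(2), of _ 0, simplified])
  thus ?thesis by (simp add: total_source_def phi_def amplitude_def a_fun_den wt_def)
qed

lemma damping_bounds:
  assumes "\<delta> > 0" "0 \<le> z" "z \<le> x" and e: "0 \<le> \<epsilon>" "\<epsilon> \<le> S" "0 \<le> \<epsilon>t" "\<epsilon>t \<le> S"
  defines "\<beta> \<equiv> (2 * prim_a \<delta> 1 + 20) * (1 + (x - z))"
  shows "0 \<le> damping \<delta> \<epsilon> \<epsilon>t z x" "damping \<delta> \<epsilon> \<epsilon>t z x \<le> S * \<beta>"
proof -
  have B: "0 \<le> prim_a \<delta> x - prim_a \<delta> z" "0 \<le> prim_xa \<delta> x - prim_xa \<delta> z"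
    using prim_a_mono[OF assms(1-3)] prim_xa_mono[OF assms(1-3)] by simp_all
  have L: "prim_a \<delta> 1 \<ge> 0" using prim_a_mono[of \<delta> 0 1] assms(1) by simp
  show "0 \<le> damping \<delta> \<epsilon> \<epsilon>t z x" using B e by (simp add: damping_def)
  have "damping \<delta> \<epsilon> \<epsilon>t z x \<le> S * (prim_a \<delta> x - prim_a \<delta> z) + S * (prim_xa \<delta> x - prim_xa \<delta> z)"
    unfolding damping_def using B e by (intro add_mono mult_right_mono) auto
  also have "\<dots> = S * ((prim_a \<delta> x - prim_a \<delta> z) + (prim_xa \<delta> x - prim_xa \<delta> z))" by (simp add: algebra_simps)
  also have "\<dots> \<le> S * (2 * prim_a \<delta> 1 + 20 * (x - z))"
    using e assms(1-3) by (intro mult_left_mono prim_sum_growth) auto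
  also have "\<dots> \<le> S * \<beta>"
  proof (rule mult_left_mono)
    have "0 \<le> prim_a \<delta> 1 * (x - z)" using L assms(1-3) by simp
    thus "2 * prim_a \<delta> 1 + 20 * (x - z) \<le> \<beta>" using L assms(1-3) by (simp add: \<beta>_def algebra_simps)
  qed (use e in auto)
  finally show "damping \<delta> \<epsilon> \<epsilon>t z x \<le> S * \<beta>" .
qed

lemma damping_diff_bound:
  assumes "\<delta> > 0" "0 \<le> z" "z \<le> x" and e: "\<bar>\<epsilon> - \<epsilon>'\<bar> \<le> S" "\<bar>\<epsilon>t - \<epsilon>t'\<bar> \<le> S"
  shows "\<bar>damping \<delta> \<epsilon> \<epsilon>t z x - damping \<delta> \<epsilon>' \<epsilon>t' z x\<bar> \<le> S * ((2 * prim_a \<delta> 1 + 20) * (1 + (x - z)))"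
proof -
  have B: "0 \<le> prim_a \<delta> x - prim_a \<delta> z" "0 \<le> prim_xa \<delta> x - prim_xa \<delta> z"
    using prim_a_mono[OF assms(1-3)] prim_xa_mono[OF assms(1-3)] by simp_all
  have "\<bar>damping \<delta> \<epsilon> \<epsilon>t z x - damping \<delta> \<epsilon>' \<epsilon>t' z x\<bar>
    = \<bar>(\<epsilon> - \<epsilon>') * (prim_a \<delta> x - prim_a \<delta> z) + (\<epsilon>t - \<epsilon>t') * (prim_xa \<delta> x - prim_xa \<delta> z)\<bar>"
    by (simp add: damping_def algebra_simps)
  also have "\<dots> \<le> \<bar>\<epsilon> - \<epsilon>'\<bar> * (prim_a \<delta> x - prim_a \<delta> z) + \<bar>\<epsilon>t - \<epsilon>t'\<bar> * (prim_xa \<delta> x - prim_xa \<delta> z)"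
    using B by (intro order_trans[OF abs_triangle_ineq]) (simp add: abs_mult)
  also have "\<dots> = damping \<delta> \<bar>\<epsilon> - \<epsilon>'\<bar> \<bar>\<epsilon>t - \<epsilon>t'\<bar> z x" by (simp add: damping_def)
  also have "\<dots> \<le> S * ((2 * prim_a \<delta> 1 + 20) * (1 + (x - z)))"
    by (rule damping_bounds) (use assms in auto)
  finally show ?thesis .
qed

lemma exp_minus_lipschitz:
  fixes x y :: real
  assumes "x \<ge> 0" "y \<ge> 0"
  shows "\<bar>exp (- x) - exp (- y)\<bar> \<le> \<bar>x - y\<bar>"
proof -
  have *: "exp (- x) - exp (- y) \<le> y - x" if "0 \<le> x" "x \<le> y" for x y :: real
  proof -
    have "exp (- x) - exp (- y) = exp (- x) * (1 - exp (- (y - x)))" by (simp add: algebra_simps flip: exp_add)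
    also have "\<dots> \<le> 1 * (y - x)"
    proof (rule mult_mono)
      show "1 - exp (- (y - x)) \<le> y - x" using exp_ge_add_one_self[of "- (y - x)"] by linarith
    qed (use that in auto)
    finally show ?thesis by simp
  qed
  show ?thesis
  proof (cases "x \<le> y")
    case True thus ?thesis using *[of x y] assms by (simp add: abs_if)
  next
    case False thus ?thesis using *[of y x] assms by (simp add: abs_if)
  qed
qed

text \<open>The error made by replacing the damping factor by \<open>1\<close>, as a difference of two data. It
  contains \<open>S\<close> twice, once from the parameter in front and once from the damping; in the
  application \<open>S = exp (- prim_a \<delta> 1)\<close>.\<close>
lemma remainder_bound:
  assumes "\<delta> > 0" "0 \<le> z" "z \<le> x" "R \<ge> 1"
    and e1: "0 \<le> \<epsilon>1" "\<epsilon>1 \<le> S * R" "0 \<le> \<epsilon>t1" "\<epsilon>t1 \<le> S * R"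
    and e2: "0 \<le> \<epsilon>2" "\<epsilon>2 \<le> S * R" "0 \<le> \<epsilon>t2" "\<epsilon>t2 \<le> S * R"
    and de: "\<bar>\<epsilon>1 - \<epsilon>2\<bar> \<le> S * \<pi>" "\<bar>\<epsilon>t1 - \<epsilon>t2\<bar> \<le> S * \<pi>"
    and h: "\<bar>h1\<bar> \<le> R * w" "\<bar>h2\<bar> \<le> R * w" "\<bar>h1 - h2\<bar> \<le> d * w"
  defines "\<beta> \<equiv> (2 * prim_a \<delta> 1 + 20) * (1 + (x - z))"
  shows "\<bar>\<epsilon>1 * (1 - exp (- damping \<delta> \<epsilon>1 \<epsilon>t1 z x)) * h1 - \<epsilon>2 * (1 - exp (- damping \<delta> \<epsilon>2 \<epsilon>t2 z x)) * h2\<bar>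
     \<le> 2 * R^2 * S^2 * (\<pi> + d) * \<beta> * w"
proof -
  define x1 x2 where "x1 = damping \<delta> \<epsilon>1 \<epsilon>t1 z x" and "x2 = damping \<delta> \<epsilon>2 \<epsilon>t2 z x"
  have x1: "0 \<le> x1" "x1 \<le> S * R * \<beta>" unfolding x1_def \<beta>_def by (rule damping_bounds; fact)+
  have x2: "0 \<le> x2" "x2 \<le> S * R * \<beta>" unfolding x2_def \<beta>_def by (rule damping_bounds; fact)+
  have x12: "\<bar>x2 - x1\<bar> \<le> S * \<pi> * \<beta>" unfolding x1_def x2_def \<beta>_def
    using de by (intro damping_diff_bound assms(1-3)) (simp_all add: abs_minus_commute)
  have SR: "0 \<le> S * R" "0 \<le> S * \<pi>" using e1 de by linarith+
  have \<beta>: "\<beta> \<ge> 0" using prim_a_mono[of \<delta> 0 1] assms(1-3) by (simp add: \<beta>_def)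
  have rw: "0 \<le> R * w" "0 \<le> d * w" using h by linarith+
  have e: "\<bar>1 - exp (- y)\<bar> \<le> S * R * \<beta>" if "0 \<le> y" "y \<le> S * R * \<beta>" for y
    using exp_minus_lipschitz[of 0 y] that by simp
  have e12: "\<bar>exp (- x2) - exp (- x1)\<bar> \<le> S * \<pi> * \<beta>"
    using exp_minus_lipschitz[of x2 x1] x1 x2 x12 by simp
  have "\<epsilon>1 * (1 - exp (- x1)) * h1 - \<epsilon>2 * (1 - exp (- x2)) * h2
     = (\<epsilon>1 - \<epsilon>2) * (1 - exp (- x1)) * h1 + \<epsilon>2 * (exp (- x2) - exp (- x1)) * h1
       + \<epsilon>2 * (1 - exp (- x2)) * (h1 - h2)"
    by (simp add: algebra_simps)
  also have "\<bar>\<dots>\<bar> \<le> \<bar>(\<epsilon>1 - \<epsilon>2) * (1 - exp (- x1)) * h1\<bar> + \<bar>\<epsilon>2 * (exp (- x2) - exp (- x1)) * h1\<bar>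
       + \<bar>\<epsilon>2 * (1 - exp (- x2)) * (h1 - h2)\<bar>" by linarith
  also have "\<dots> \<le> (S * \<pi>) * (S * R * \<beta>) * (R * w) + (S * R) * (S * \<pi> * \<beta>) * (R * w)
       + (S * R) * (S * R * \<beta>) * (d * w)"
  proof (intro add_mono)
    have nn: "0 \<le> S * R * \<beta>" "0 \<le> S * \<pi> * \<beta>" using SR \<beta> by simp_all
    show "\<bar>(\<epsilon>1 - \<epsilon>2) * (1 - exp (- x1)) * h1\<bar> \<le> (S * \<pi>) * (S * R * \<beta>) * (R * w)"
      unfolding abs_mult
      by (rule mult_mono[OF mult_mono[OF de(1) e[OF x1] SR(2)] h(1)]) (use SR nn in auto)
    show "\<bar>\<epsilon>2 * (exp (- x2) - exp (- x1)) * h1\<bar> \<le> (S * R) * (S * \<pi> * \<beta>) * (R * w)"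
      unfolding abs_mult
      by (rule mult_mono[OF mult_mono[OF _ e12 SR(1)] h(1)]) (use e2 SR nn in auto)
    show "\<bar>\<epsilon>2 * (1 - exp (- x2)) * (h1 - h2)\<bar> \<le> (S * R) * (S * R * \<beta>) * (d * w)"
      unfolding abs_mult
      by (rule mult_mono[OF mult_mono[OF _ e[OF x2] SR(1)] h(3)]) (use e2 SR nn in auto)
  qed
  also have "\<dots> = R^2 * S^2 * (2 * \<pi> * w + d * w) * \<beta>" by (simp add: power2_eq_square algebra_simps)
  also have "\<dots> \<le> R^2 * S^2 * (2 * \<pi> * w + 2 * (d * w)) * \<beta>"
    using \<beta> rw by (intro mult_right_mono mult_left_mono add_left_mono) auto
  finally show ?thesis by (simp add: x1_def x2_def algebra_simps)
qed

text \<open>With \<open>L = prim_a \<delta> 1\<close>, removing the damping costs \<open>4 * tail_const * (2 * L + 20)\<close> and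
  completing the tail integral costs \<open>tail_const + 2 * wt_const\<close>; the sum is at most
  \<open>diff_const * (1 + L)\<close>.\<close>
definition diff_const :: real where "diff_const = 81 * tail_const + 2 * wt_const"

lemma diff_const_pos: "diff_const > 0" using tail_const_pos wt_const_pos by (simp add: diff_const_def)

text \<open>The central estimate: up to small errors, the difference of two values of the operator is
  a multiple of \<open>phi \<delta>\<close> on \<open>[0, 1]\<close> and vanishes beyond. Stated for differences, it yields the
  Lipschitz bound; with zero as the second datum it yields the bound for a single datum.\<close>
lemma I_h_difference:
  assumes \<delta>: "0 < \<delta>" "\<delta> \<le> 1/10" and R: "R \<ge> 1" and z: "0 \<le> z"
    and e1: "0 \<le> \<epsilon>1" "\<epsilon>1 \<le> exp (- prim_a \<delta> 1) * R" "0 \<le> \<epsilon>t1" "\<epsilon>t1 \<le> exp (- prim_a \<delta> 1) * R"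
    and e2: "0 \<le> \<epsilon>2" "\<epsilon>2 \<le> exp (- prim_a \<delta> 1) * R" "0 \<le> \<epsilon>t2" "\<epsilon>t2 \<le> exp (- prim_a \<delta> 1) * R"
    and de: "\<bar>\<epsilon>1 - \<epsilon>2\<bar> \<le> exp (- prim_a \<delta> 1) * \<pi>" "\<bar>\<epsilon>t1 - \<epsilon>t2\<bar> \<le> exp (- prim_a \<delta> 1) * \<pi>"
    and m: "h1 \<in> borel_measurable (lebesgue_on {0..})" "h2 \<in> borel_measurable (lebesgue_on {0..})"
    and h: "\<And>x. x \<ge> 0 \<Longrightarrow> \<bar>h1 x\<bar> \<le> R * wt x" "\<And>x. x \<ge> 0 \<Longrightarrow> \<bar>h2 x\<bar> \<le> R * wt x"
      "\<And>x. x \<ge> 0 \<Longrightarrow> \<bar>h1 x - h2 x\<bar> \<le> d * wt x"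
  shows "\<bar>I_h h1 \<epsilon>1 \<epsilon>t1 \<delta> z - I_h h2 \<epsilon>2 \<epsilon>t2 \<delta> z
           - (if z \<le> 1 then (\<epsilon>1 * total_source \<delta> h1 - \<epsilon>2 * total_source \<delta> h2) * phi \<delta> z else 0)\<bar>
         \<le> diff_const * R^2 * smallness \<delta> * (\<pi> + d) * wt z"
proof -
  define L where "L = prim_a \<delta> 1"
  define S where "S = exp (- L)"
  have L: "L \<ge> 0" using prim_a_mono[of \<delta> 0 1] \<delta> by (simp add: L_def)
  note e1' = e1[folded L_def, folded S_def] and e2' = e2[folded L_def, folded S_def]
    and de' = de[folded L_def, folded S_def]
  have S: "S > 0" by (simp add: S_def)
  have d0: "0 \<le> d" using h(3)[of 0] abs_ge_zero[of "h1 0 - h2 0"] by (simp add: wt_def)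
  have "0 \<le> S * \<pi>" using de' by linarith
  hence p0: "0 \<le> \<pi>" using S by (simp add: zero_le_mult_iff)
  have vz: "wt z > 0" using z by (rule wt_pos)
  have sub: "{z..} \<subseteq> {0..}" using z by auto
  have mz: "h1 \<in> borel_measurable (lebesgue_on {z..})" "h2 \<in> borel_measurable (lebesgue_on {z..})"
    by (rule measurable_restrict_mono[OF m(1) sub], rule measurable_restrict_mono[OF m(2) sub])
  have me: "(\<lambda>x. exp (- damping \<delta> \<epsilon> \<epsilon>t z x)) \<in> borel_measurable (lebesgue_on {z..})" for \<epsilon> \<epsilon>t
    unfolding damping_def by (rule continuous_imp_meas[OF _ sub]) (intro continuous_intros prim_a_cont prim_xa_cont \<delta> | simp)+
  define hm where "hm x = \<epsilon>1 * h1 x - \<epsilon>2 * h2 x" for x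
  define hr where "hr x = \<epsilon>1 * (1 - exp (- damping \<delta> \<epsilon>1 \<epsilon>t1 z x)) * h1 x
      - \<epsilon>2 * (1 - exp (- damping \<delta> \<epsilon>2 \<epsilon>t2 z x)) * h2 x" for x
  define N where "N x = x * exp (prim_a \<delta> x)" for x
  have hm: "\<bar>hm x\<bar> \<le> S * R * (\<pi> + d) * wt x" if "x \<ge> 0" for x
  proof -
    have "hm x = (\<epsilon>1 - \<epsilon>2) * h1 x + \<epsilon>2 * (h1 x - h2 x)" by (simp add: hm_def algebra_simps)
    hence "\<bar>hm x\<bar> \<le> \<bar>\<epsilon>1 - \<epsilon>2\<bar> * \<bar>h1 x\<bar> + \<bar>\<epsilon>2\<bar> * \<bar>h1 x - h2 x\<bar>"
      by (metis abs_mult abs_triangle_ineq)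
    also have "\<dots> \<le> (S * \<pi>) * (R * wt x) + (S * R) * (d * wt x)"
      using S R p0 e2' that by (intro add_mono mult_mono de' h) auto
    finally show ?thesis by (simp add: algebra_simps)
  qed
  have mm: "hm \<in> borel_measurable (lebesgue_on {0..})"
    unfolding hm_def by (intro borel_measurable_diff borel_measurable_times m borel_measurable_const)
  have mmz: "hm \<in> borel_measurable (lebesgue_on {z..})" by (rule measurable_restrict_mono[OF mm sub])
  note M = weighted_tail[OF \<delta>(1) z mmz, of "S * R * (\<pi> + d)", folded N_def]
  have M1: "set_integrable lebesgue {z..} (\<lambda>x. N x * hm x)"
    by (rule M(1)) (use z in \<open>auto intro!: le_with_growth hm\<close>)
  have M2: "phi \<delta> z * \<bar>LINT x:{z..}|lebesgue. N x * hm x\<bar> \<le> S * R * (\<pi> + d) * tail_const * amplitude \<delta> z * wt z"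
    by (rule M(2)) (use z in \<open>auto intro!: le_with_growth hm\<close>)
  have hr: "\<bar>hr x\<bar> \<le> 2 * R^2 * S^2 * (\<pi> + d) * (2 * L + 20) * (1 + (x - z)) * wt x" if x: "x \<ge> z" for x
  proof -
    have "\<bar>hr x\<bar> \<le> 2 * R^2 * S^2 * (\<pi> + d) * ((2 * L + 20) * (1 + (x - z))) * wt x"
      unfolding hr_def L_def
      by (rule remainder_bound[OF \<delta>(1) z x R]) (use e1' e2' de' h x z in auto)
    thus ?thesis by (simp add: mult.assoc)
  qed
  have mr: "hr \<in> borel_measurable (lebesgue_on {z..})"
    unfolding hr_def by (intro borel_measurable_diff borel_measurable_times mz me borel_measurable_const)
  note Rr = weighted_tail[OF \<delta>(1) z mr hr, folded N_def]
  have f: "set_integrable lebesgue {z..} (\<lambda>x. \<epsilon> * N x * exp (- damping \<delta> \<epsilon> \<epsilon>t z x) * h x)"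
    if "0 \<le> \<epsilon>" "0 \<le> \<epsilon>t" "h \<in> borel_measurable (lebesgue_on {z..})" "\<And>x. x \<ge> 0 \<Longrightarrow> \<bar>h x\<bar> \<le> R * wt x" for h \<epsilon> \<epsilon>t
  proof -
    have "set_integrable lebesgue {z..} (\<lambda>x. x * exp (prim_a \<delta> x) * (\<epsilon> * exp (- damping \<delta> \<epsilon> \<epsilon>t z x) * h x))"
    proof (rule weighted_tail[OF \<delta>(1) z])
      show "(\<lambda>x. \<epsilon> * exp (- damping \<delta> \<epsilon> \<epsilon>t z x) * h x) \<in> borel_measurable (lebesgue_on {z..})"
        by (intro borel_measurable_times me that borel_measurable_const)
      fix x assume x: "z \<le> x"
      have "0 \<le> damping \<delta> \<epsilon> \<epsilon>t z x"
        using prim_a_mono[OF \<delta>(1) z x] prim_xa_mono[OF \<delta>(1) z x] that by (simp add: damping_def)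
      hence "\<bar>\<epsilon> * exp (- damping \<delta> \<epsilon> \<epsilon>t z x) * h x\<bar> \<le> \<epsilon> * 1 * (R * wt x)"
        unfolding abs_mult using that x z by (intro mult_mono) auto
      thus "\<bar>\<epsilon> * exp (- damping \<delta> \<epsilon> \<epsilon>t z x) * h x\<bar> \<le> (\<epsilon> * R) * (1 + (x - z)) * wt x"
        using x z by (intro le_with_growth) auto
    qed
    thus ?thesis by (simp add: N_def mult_ac)
  qed
  note f1 = f[OF e1(1,3) mz(1) h(1)] and f2 = f[OF e2(1,3) mz(2) h(2)]
  have "I_h h1 \<epsilon>1 \<epsilon>t1 \<delta> z - I_h h2 \<epsilon>2 \<epsilon>t2 \<delta> z
      = phi \<delta> z * (LINT x:{z..}|lebesgue. \<epsilon>1 * N x * exp (- damping \<delta> \<epsilon>1 \<epsilon>t1 z x) * h1 x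
          - \<epsilon>2 * N x * exp (- damping \<delta> \<epsilon>2 \<epsilon>t2 z x) * h2 x)"
  proof -
    have J: "I_h h \<epsilon> \<epsilon>t \<delta> z = phi \<delta> z * (LINT x:{z..}|lebesgue. \<epsilon> * N x * exp (- damping \<delta> \<epsilon> \<epsilon>t z x) * h x)" for h \<epsilon> \<epsilon>t
      unfolding I_h_explicit[OF \<delta>(1) z] N_def ..
    have "x = p * a \<Longrightarrow> y = p * b \<Longrightarrow> c = a - b \<Longrightarrow> x - y = p * c" for x y p a b c :: real
      by (simp add: right_diff_distrib)
    from this[OF J J set_integral_diff(2)[OF f1 f2]] show ?thesis .
  qed
  also have "(\<lambda>x. \<epsilon>1 * N x * exp (- damping \<delta> \<epsilon>1 \<epsilon>t1 z x) * h1 x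
          - \<epsilon>2 * N x * exp (- damping \<delta> \<epsilon>2 \<epsilon>t2 z x) * h2 x) = (\<lambda>x. N x * hm x - N x * hr x)"
    by (auto simp: hm_def hr_def algebra_simps)
  also have "(LINT x:{z..}|lebesgue. N x * hm x - N x * hr x)
      = (LINT x:{z..}|lebesgue. N x * hm x) - (LINT x:{z..}|lebesgue. N x * hr x)"
    by (rule set_integral_diff(2)[OF M1 Rr(1)])
  finally have split: "I_h h1 \<epsilon>1 \<epsilon>t1 \<delta> z - I_h h2 \<epsilon>2 \<epsilon>t2 \<delta> z
     = phi \<delta> z * (LINT x:{z..}|lebesgue. N x * hm x) - phi \<delta> z * (LINT x:{z..}|lebesgue. N x * hr x)"
    by (simp add: right_diff_distrib)
  have ph: "phi \<delta> z \<ge> 0" using \<delta> z by (intro phi_nonneg) auto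
  \<comment> \<open>One factor \<open>S\<close> cancels the exponential in the amplitude, the other one remains.\<close>
  have SP: "S * amplitude \<delta> z \<le> 2 / \<delta>"
  proof -
    have "S * amplitude \<delta> z \<le> S * (2 / \<delta> * exp L)"
      unfolding L_def using S amplitude_le[OF \<delta> z] by (intro mult_left_mono) auto
    also have "\<dots> = 2 / \<delta>" by (simp add: S_def exp_minus)
    finally show ?thesis .
  qed
  have "\<bar>phi \<delta> z * (LINT x:{z..}|lebesgue. N x * hr x)\<bar> \<le> 2 * R^2 * S^2 * (\<pi> + d) * (2 * L + 20) * tail_const * amplitude \<delta> z * wt z"
    using Rr(2) ph by (simp add: abs_mult)
  also have "\<dots> = (2 * R^2 * S * (\<pi> + d) * (2 * L + 20) * tail_const * wt z) * (S * amplitude \<delta> z)"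
    by (simp add: power2_eq_square)
  also have "\<dots> \<le> (2 * R^2 * S * (\<pi> + d) * (2 * L + 20) * tail_const * wt z) * (2 / \<delta>)"
    using S p0 d0 L tail_const_pos vz by (intro mult_left_mono SP) auto
  also have "\<dots> = (R^2 * S * (\<pi> + d) * wt z / \<delta>) * (4 * tail_const * (2 * L + 20))" by simp
  finally have rem: "\<bar>phi \<delta> z * (LINT x:{z..}|lebesgue. N x * hr x)\<bar>
     \<le> (R^2 * S * (\<pi> + d) * wt z / \<delta>) * (4 * tail_const * (2 * L + 20))" .
  \<comment> \<open>For \<open>z \<le> 1\<close> the tail integral is the total one minus the integral over \<open>[0, z)\<close>, and the
     latter is small since \<open>phi * exp (prim_a) = a\<close>; beyond \<open>1\<close> the amplitude is bounded.\<close>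
  have RR: "R * 1 \<le> R * R" using R by (intro mult_left_mono) auto
  have "\<bar>phi \<delta> z * (LINT x:{z..}|lebesgue. N x * hm x)
      - (if z \<le> 1 then (\<epsilon>1 * total_source \<delta> h1 - \<epsilon>2 * total_source \<delta> h2) * phi \<delta> z else 0)\<bar>
      \<le> (R * S * (\<pi> + d) * wt z / \<delta>) * (tail_const + 2 * wt_const)"
  proof (cases "z \<le> 1")
    case False
    have "\<bar>phi \<delta> z * (LINT x:{z..}|lebesgue. N x * hm x)\<bar> \<le> S * R * (\<pi> + d) * tail_const * amplitude \<delta> z * wt z"
      using M2 ph by (simp add: abs_mult)
    also have "\<dots> = (S * R * (\<pi> + d) * tail_const * wt z) * amplitude \<delta> z" by simp
    also have "\<dots> \<le> (S * R * (\<pi> + d) * tail_const * wt z) * (1 / \<delta>)"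
    proof (rule mult_left_mono)
      have "amplitude \<delta> z \<le> 10" using False \<delta> by (intro amplitude_outer) auto
      also have "\<dots> \<le> 1 / \<delta>" using \<delta> by (simp add: field_simps)
      finally show "amplitude \<delta> z \<le> 1 / \<delta>" .
    qed (use S R p0 d0 tail_const_pos vz in auto)
    also have "\<dots> = (R * S * (\<pi> + d) * wt z / \<delta>) * tail_const" by simp
    also have "\<dots> \<le> (R * S * (\<pi> + d) * wt z / \<delta>) * (tail_const + 2 * wt_const)"
      using S R p0 d0 wt_const_pos vz \<delta> by (intro mult_left_mono) auto
    finally show ?thesis using False by simp
  next
    case True
    have g: "set_integrable lebesgue {0..} (\<lambda>x. N x * h x)"
      if "h \<in> borel_measurable (lebesgue_on {0..})" "\<And>x. x \<ge> 0 \<Longrightarrow> \<bar>h x\<bar> \<le> H * wt x" for h H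
      unfolding N_def using that \<delta> by (intro weighted_tail(1)[of \<delta> 0 h H] le_with_growth) auto
    have I0: "set_integrable lebesgue {0..} (\<lambda>x. N x * hm x)" by (rule g[OF mm hm])
    have "\<epsilon>1 * total_source \<delta> h1 - \<epsilon>2 * total_source \<delta> h2
       = (LINT x:{0..}|lebesgue. \<epsilon>1 * (N x * h1 x)) - (LINT x:{0..}|lebesgue. \<epsilon>2 * (N x * h2 x))"
      unfolding total_source_def N_def by simp
    also have "\<dots> = (LINT x:{0..}|lebesgue. \<epsilon>1 * (N x * h1 x) - \<epsilon>2 * (N x * h2 x))"
      using set_integrable_mult_right[OF g[OF m(1) h(1)], of \<epsilon>1] set_integrable_mult_right[OF g[OF m(2) h(2)], of \<epsilon>2]
      by (rule set_integral_diff(2)[symmetric])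
    also have "\<dots> = (LINT x:{0..}|lebesgue. N x * hm x)"
      by (simp add: hm_def algebra_simps)
    also have "{0..} = {0..<z} \<union> {z..}" using z by auto
    also have "(LINT x:{0..<z} \<union> {z..}|lebesgue. N x * hm x)
       = (LINT x:{0..<z}|lebesgue. N x * hm x) + (LINT x:{z..}|lebesgue. N x * hm x)"
      by (rule set_integral_Un[OF _ set_integrable_subset[OF I0] M1]) (use z in auto)
    finally have G: "\<epsilon>1 * total_source \<delta> h1 - \<epsilon>2 * total_source \<delta> h2
       = (LINT x:{0..<z}|lebesgue. N x * hm x) + (LINT x:{z..}|lebesgue. N x * hm x)" .
    have "\<bar>LINT x:{0..<z}|lebesgue. N x * hm x\<bar> \<le> (LINT x:{0..<z}|lebesgue. exp (prim_a \<delta> z) * (S * R * (\<pi> + d)))"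
    proof (rule set_LINT_abs_bound)
      show "set_integrable lebesgue {0..<z} (\<lambda>x. exp (prim_a \<delta> z) * (S * R * (\<pi> + d)))"
        by (rule set_integrable_subset[of _ "{0..z}"])
           (auto intro!: absolutely_integrable_continuous_real continuous_on_const)
      fix x assume x: "x \<in> {0..<z}"
      have "\<bar>N x\<bar> \<le> 1 * exp (prim_a \<delta> z)"
        unfolding N_def abs_mult using x True \<delta> by (intro mult_mono) (auto intro: prim_a_mono)
      moreover have "\<bar>hm x\<bar> \<le> S * R * (\<pi> + d)"
        using x by (intro bound_by_wt[OF hm]) auto
      ultimately show "\<bar>N x * hm x\<bar> \<le> exp (prim_a \<delta> z) * (S * R * (\<pi> + d))"
        unfolding abs_mult by (intro mult_mono) auto
    qed
    also have "\<dots> = z * (exp (prim_a \<delta> z) * (S * R * (\<pi> + d)))"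
      using z by (simp add: set_integral_const)
    also have "\<dots> \<le> 1 * (exp (prim_a \<delta> z) * (S * R * (\<pi> + d)))"
      using True S R p0 d0 by (intro mult_right_mono) auto
    finally have "phi \<delta> z * \<bar>LINT x:{0..<z}|lebesgue. N x * hm x\<bar> \<le> phi \<delta> z * (exp (prim_a \<delta> z) * (S * R * (\<pi> + d)))"
      using ph by (intro mult_left_mono) auto
    also have "\<dots> = a_fun \<delta> z * (S * R * (\<pi> + d))" by (simp add: phi_def exp_minus)
    also have "\<dots> \<le> (2 / \<delta>) * (S * R * (\<pi> + d))"
      using \<delta> z True S R p0 d0 by (intro mult_right_mono a_le_inner) auto
    also have "\<dots> \<le> (2 / \<delta>) * (S * R * (\<pi> + d)) * (wt_const * wt z)"
      using \<delta> S R p0 d0 wt_const_inner[OF z True] mult_left_mono[of 1 "wt_const * wt z" "(2 / \<delta>) * (S * R * (\<pi> + d))"] by simp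
    also have "\<dots> = (R * S * (\<pi> + d) * wt z / \<delta>) * (2 * wt_const)" by simp
    also have "\<dots> \<le> (R * S * (\<pi> + d) * wt z / \<delta>) * (tail_const + 2 * wt_const)"
      using S R p0 d0 tail_const_pos vz \<delta> by (intro mult_left_mono) auto
    finally have "phi \<delta> z * \<bar>LINT x:{0..<z}|lebesgue. N x * hm x\<bar> \<le> (R * S * (\<pi> + d) * wt z / \<delta>) * (tail_const + 2 * wt_const)" .
    moreover have "phi \<delta> z * (LINT x:{z..}|lebesgue. N x * hm x) - (\<epsilon>1 * total_source \<delta> h1 - \<epsilon>2 * total_source \<delta> h2) * phi \<delta> z
        = - (phi \<delta> z * (LINT x:{0..<z}|lebesgue. N x * hm x))"
      unfolding G by (simp add: algebra_simps)
    ultimately show ?thesis using True ph by (simp add: abs_mult)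
  qed
  also have "(R * S * (\<pi> + d) * wt z / \<delta>) * (tail_const + 2 * wt_const) = R * (S * (\<pi> + d) * wt z / \<delta> * (tail_const + 2 * wt_const))" by simp
  also have "\<dots> \<le> (R * R) * (S * (\<pi> + d) * wt z / \<delta> * (tail_const + 2 * wt_const))"
    using RR S p0 d0 tail_const_pos wt_const_pos vz \<delta> by (intro mult_right_mono) auto
  also have "\<dots> = (R^2 * S * (\<pi> + d) * wt z / \<delta>) * (tail_const + 2 * wt_const)" by (simp add: power2_eq_square)
  finally have "\<bar>I_h h1 \<epsilon>1 \<epsilon>t1 \<delta> z - I_h h2 \<epsilon>2 \<epsilon>t2 \<delta> z
           - (if z \<le> 1 then (\<epsilon>1 * total_source \<delta> h1 - \<epsilon>2 * total_source \<delta> h2) * phi \<delta> z else 0)\<bar>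
     \<le> (R^2 * S * (\<pi> + d) * wt z / \<delta>) * (tail_const + 2 * wt_const) + (R^2 * S * (\<pi> + d) * wt z / \<delta>) * (4 * tail_const * (2 * L + 20))"
    unfolding split using rem by linarith
  also have "\<dots> = (R^2 * S * (\<pi> + d) * wt z / \<delta>) * ((tail_const + 2 * wt_const) + 4 * tail_const * (2 * L + 20))"
    by (simp only: distrib_left)
  also have "\<dots> \<le> (R^2 * S * (\<pi> + d) * wt z / \<delta>) * (diff_const * (1 + L))"
  proof (rule mult_left_mono)
    have "0 \<le> L * tail_const" "0 \<le> L * wt_const" using L tail_const_pos wt_const_pos by auto
    thus "(tail_const + 2 * wt_const) + 4 * tail_const * (2 * L + 20) \<le> diff_const * (1 + L)" by (simp add: diff_const_def algebra_simps)
  qed (use S p0 d0 vz \<delta> in auto)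
  also have "\<dots> = diff_const * R^2 * smallness \<delta> * (\<pi> + d) * wt z" by (simp add: smallness_def S_def L_def)
  finally show ?thesis .
qed

text \<open>The damping splits into a part depending on \<open>z\<close> and one depending on \<open>x\<close>, which leaves a
  tail integral of a fixed integrable function.\<close>
lemma I_h_cont:
  assumes \<delta>: "0 < \<delta>" and e: "0 \<le> \<epsilon>" "0 \<le> \<epsilon>t"
    and h: "h \<in> borel_measurable (lebesgue_on {0..})" "\<And>x. x \<ge> 0 \<Longrightarrow> \<bar>h x\<bar> \<le> H * wt x"
  shows "continuous_on {0..} (I_h h \<epsilon> \<epsilon>t \<delta>)"
proof -
  define f where "f x = x * exp (prim_a \<delta> x) * (exp (- (\<epsilon> * prim_a \<delta> x + \<epsilon>t * prim_xa \<delta> x)) * h x)" for x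
  have f0: "set_integrable lebesgue {0..} f" unfolding f_def
  proof (rule weighted_tail(1)[OF \<delta>])
    show "(\<lambda>x. exp (- (\<epsilon> * prim_a \<delta> x + \<epsilon>t * prim_xa \<delta> x)) * h x) \<in> borel_measurable (lebesgue_on {0..})"
      by (intro borel_measurable_times h continuous_imp_meas continuous_intros prim_a_cont prim_xa_cont \<delta>) auto
    fix x :: real assume x: "0 \<le> x"
    have "0 \<le> \<epsilon> * prim_a \<delta> x + \<epsilon>t * prim_xa \<delta> x"
      using prim_a_mono[OF \<delta> order.refl x] prim_xa_mono[OF \<delta> order.refl x] e by simp
    hence "\<bar>exp (- (\<epsilon> * prim_a \<delta> x + \<epsilon>t * prim_xa \<delta> x)) * h x\<bar> \<le> 1 * (H * wt x)"
      unfolding abs_mult using x by (intro mult_mono h) auto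
    thus "\<bar>exp (- (\<epsilon> * prim_a \<delta> x + \<epsilon>t * prim_xa \<delta> x)) * h x\<bar> \<le> H * (1 + (x - 0)) * wt x"
      using x by (intro le_with_growth) auto
  qed simp
  have E: "I_h h \<epsilon> \<epsilon>t \<delta> z = \<epsilon> * phi \<delta> z * exp (\<epsilon> * prim_a \<delta> z + \<epsilon>t * prim_xa \<delta> z) * (integral {0..} f - integral {0..z} f)"
    if z: "z \<ge> 0" for z
  proof -
    have eq: "\<epsilon> * (x * exp (prim_a \<delta> x)) * exp (- damping \<delta> \<epsilon> \<epsilon>t z x) * h x
      = \<epsilon> * exp (\<epsilon> * prim_a \<delta> z + \<epsilon>t * prim_xa \<delta> z) * f x" for x
    proof -
      have "exp (- damping \<delta> \<epsilon> \<epsilon>t z x) = exp (\<epsilon> * prim_a \<delta> z + \<epsilon>t * prim_xa \<delta> z) * exp (- (\<epsilon> * prim_a \<delta> x + \<epsilon>t * prim_xa \<delta> x))"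
        by (simp add: damping_def algebra_simps flip: exp_add)
      thus ?thesis by (simp add: f_def)
    qed
    have 1: "I_h h \<epsilon> \<epsilon>t \<delta> z = phi \<delta> z * (\<epsilon> * exp (\<epsilon> * prim_a \<delta> z + \<epsilon>t * prim_xa \<delta> z) * (LINT x:{z..}|lebesgue. f x))"
      unfolding I_h_explicit[OF \<delta> z] eq set_integral_mult_right ..
    have fz: "set_integrable lebesgue {z..} f" "set_integrable lebesgue {0..z} f"
      "set_integrable lebesgue {0..<z} f"
      by (rule set_integrable_subset[OF f0]; use z in auto)+
    have "{0..} = {0..<z} \<union> {z..}" using z by auto
    hence "(LINT x:{0..}|lebesgue. f x) = (LINT x:{0..<z}|lebesgue. f x) + (LINT x:{z..}|lebesgue. f x)"
      using set_integral_Un[OF _ fz(3) fz(1)] by (simp add: ivl_disj_int)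
    moreover have "(LINT x:{0..<z}|lebesgue. f x) = integral {0..<z} f"
      by (rule set_lebesgue_integral_eq_integral[OF fz(3)])
    moreover have "integral {0..<z} f = integral {0..z} f"
      by (rule integral_subset_negligible) (auto intro: negligible_subset[of "{z}"])
    moreover have "(LINT x:{0..}|lebesgue. f x) = integral {0..} f"
      by (rule set_lebesgue_integral_eq_integral[OF f0])
    ultimately show ?thesis using 1 by simp
  qed
  have "f integrable_on {0..w}" for w
    using set_integrable_subset[OF f0, of "{0..w}"] set_lebesgue_integral_eq_integral(1) by auto
  hence c: "continuous_on {0..} (\<lambda>z. integral {0..z} f)"
    by (intro continuous_on_halfline indefinite_integral_continuous_1)
  have "continuous_on {0..} (\<lambda>z. \<epsilon> * phi \<delta> z * exp (\<epsilon> * prim_a \<delta> z + \<epsilon>t * prim_xa \<delta> z) * (integral {0..} f - integral {0..z} f))"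
    unfolding phi_def
    by (intro continuous_intros c prim_a_cont prim_xa_cont \<delta> continuous_on_a_fun) (auto intro: den_pos \<delta>)
  thus ?thesis by (subst continuous_on_cong[OF refl E]) auto
qed

lemma I_h_nonneg:
  assumes "\<delta> > 0" "z \<ge> 0" "\<epsilon> \<ge> 0" "\<And>x. x \<ge> 0 \<Longrightarrow> h x \<ge> 0"
  shows "I_h h \<epsilon> \<epsilon>t \<delta> z \<ge> 0"
  unfolding I_h_explicit[OF assms(1,2)]
  using assms unfolding set_lebesgue_integral_def
  by (intro mult_nonneg_nonneg phi_nonneg integral_nonneg_AE AE_I2) (auto simp: indicator_def)

end

section \<open>Normalisation constants\<close>

definition profile_max :: real where "profile_max = (SUP z. LSW_profile z)"

lemma LSW_le_max: "LSW_profile z \<le> profile_max"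
  unfolding profile_max_def using LSW_bounded by (intro cSUP_upper) auto

lemma profile_max_ge_1: "profile_max \<ge> 1"
  using LSW_le_max[of 0] LSW_profile_phi[of 0] by (simp add: phi_def a_fun_den)

definition LSW_moment :: real where "LSW_moment = (LINT z:{0..1}|lebesgue. z * LSW_profile z)"

definition phi_moment :: "(real \<Rightarrow> real) \<Rightarrow> real \<Rightarrow> real" where
  "phi_moment \<gamma> \<delta> = (LINT z:{0..1}|lebesgue. \<gamma> z * phi \<delta> z)"

lemma C_LSW_eq: "C_LSW = 1 / LSW_moment"
proof -
  have "(LINT z:{0..}|lebesgue. z * LSW_profile z) = LSW_moment"
    unfolding LSW_moment_def set_lebesgue_integral_def
    by (intro Bochner_Integration.integral_cong) (auto simp: indicator_def LSW_profile_def)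
  thus ?thesis by (simp add: C_LSW_def)
qed

lemma LSW_integrable: "set_integrable lebesgue {0..1} (\<lambda>z. z * LSW_profile z)"
proof (rule measurable_bounded_by_integrable_imp_absolutely_integrable)
  show "(\<lambda>z. z * LSW_profile z) \<in> borel_measurable (lebesgue_on {0..1})"
    by (rule borel_imp_meas) measurable
  show "(\<lambda>z. profile_max) integrable_on {0..1::real}" by auto
  fix z :: real assume "z \<in> {0..1}"
  thus "norm (z * LSW_profile z) \<le> profile_max"
    using mult_mono[of z 1 "LSW_profile z" profile_max] LSW_le_max[of z] LSW_profile_nonneg[of z] by simp
qed auto

lemma LSW_moment_pos: "LSW_moment > 0"
  unfolding LSW_moment_def
  by (rule set_LINT_pos[OF LSW_integrable, of 0 "1/2"]) (auto simp: LSW_profile_pos LSW_profile_nonneg)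

lemma C_LSW_pos: "C_LSW > 0"
  using LSW_moment_pos by (simp add: C_LSW_eq)

lemma phi_continuous: "\<delta> > 0 \<Longrightarrow> continuous_on {0..} (phi \<delta>)"
  unfolding phi_def by (intro continuous_intros prim_a_cont continuous_on_a_fun) (auto intro: den_pos)

lemma phi_integrable: "\<delta> > 0 \<Longrightarrow> continuous_on {0..} \<gamma> \<Longrightarrow> set_integrable lebesgue {0..1} (\<lambda>z. \<gamma> z * phi \<delta> z)"
  by (intro absolutely_integrable_continuous_real continuous_on_mult)
     (auto intro: continuous_on_subset phi_continuous)

lemma LINT_unit_const: "(LINT z:{0..1::real}|lebesgue. (c::real)) = c"
  by (simp add: set_integral_const)

lemma unit_const_integrable: "set_integrable lebesgue {0..1::real} (\<lambda>z. c::real)"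
  by (intro absolutely_integrable_continuous_real continuous_on_const)

lemma first_moment_close:
  assumes "\<delta> > 0" "\<And>z. z \<in> {0..1} \<Longrightarrow> \<bar>phi \<delta> z - LSW_profile z\<bar> \<le> \<eta>"
  shows "\<bar>phi_moment (\<lambda>z. z) \<delta> - LSW_moment\<bar> \<le> \<eta>"
proof -
  have "phi_moment (\<lambda>z. z) \<delta> - LSW_moment = (LINT z:{0..1}|lebesgue. z * phi \<delta> z - z * LSW_profile z)"
    unfolding phi_moment_def LSW_moment_def
    using set_integral_diff(2)[OF phi_integrable[OF assms(1) continuous_on_id] LSW_integrable] by simp
  also have "\<bar>\<dots>\<bar> \<le> (LINT z:{0..1::real}|lebesgue. \<eta>)"
  proof (rule set_LINT_abs_bound[OF unit_const_integrable])
    fix z :: real assume z: "z \<in> {0..1}"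
    have "\<bar>z * phi \<delta> z - z * LSW_profile z\<bar> = z * \<bar>phi \<delta> z - LSW_profile z\<bar>"
      using z by (simp add: abs_mult flip: right_diff_distrib)
    also have "\<dots> \<le> 1 * \<eta>" using z by (intro mult_mono assms(2)) auto
    finally show "\<bar>z * phi \<delta> z - z * LSW_profile z\<bar> \<le> \<eta>" by simp
  qed
  finally show ?thesis by (simp add: LINT_unit_const)
qed

lemma zeroth_moment_bounds:
  assumes "\<delta> > 0" "\<And>z. z \<in> {0..1} \<Longrightarrow> phi \<delta> z \<le> Q"
  shows "0 \<le> phi_moment (\<lambda>z. 1) \<delta>" "phi_moment (\<lambda>z. 1) \<delta> \<le> Q"
proof -
  show "0 \<le> phi_moment (\<lambda>z. 1) \<delta>"
    unfolding phi_moment_def set_lebesgue_integral_def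
    using assms(1) by (intro integral_nonneg_AE AE_I2) (auto simp: indicator_def intro: phi_nonneg)
  have "\<bar>phi_moment (\<lambda>z. 1) \<delta>\<bar> \<le> (LINT z:{0..1::real}|lebesgue. Q)"
    unfolding phi_moment_def
  proof (rule set_LINT_abs_bound[OF unit_const_integrable])
    fix z :: real assume "z \<in> {0..1}"
    thus "\<bar>1 * phi \<delta> z\<bar> \<le> Q" using assms phi_nonneg[of \<delta> z] by auto
  qed
  thus "phi_moment (\<lambda>z. 1) \<delta> \<le> Q" by (simp add: LINT_unit_const)
qed

text \<open>This determines the size of \<open>K_const\<close>: the exponential of \<open>prim_a \<delta> 1\<close>, times a factor that
  converges as \<open>\<delta>\<close> tends to \<open>0\<close>.\<close>
lemma K_const_eq:
  assumes "0 < \<delta>" "\<delta> \<le> 1"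
  shows "K_const \<gamma> \<delta> = den \<delta> 1 * exp (prim_a \<delta> 1) * phi_moment \<gamma> \<delta>"
proof -
  have "exp (LINT y:{z..1}|lebesgue. a_fun \<delta> y * b_fun \<delta> y) = den \<delta> 1 * exp (prim_a \<delta> 1) * phi \<delta> z"
    if z: "z \<in> {0..1}" for z
  proof -
    have d: "den \<delta> z > 0" "den \<delta> 1 > 0" using assms z by (auto intro: den_pos)
    have "exp (- (LINT y:{z..1}|lebesgue. a_fun \<delta> y * b_fun \<delta> y))
        = den \<delta> z / den \<delta> 1 * exp (- (prim_a \<delta> 1 - prim_a \<delta> z))"
      using z assms by (subst integral_ab) (auto simp: prim_a_diff intro: den_pos)
    hence "exp (LINT y:{z..1}|lebesgue. a_fun \<delta> y * b_fun \<delta> y)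
        = inverse (den \<delta> z / den \<delta> 1 * exp (- (prim_a \<delta> 1 - prim_a \<delta> z)))"
      by (metis exp_minus inverse_inverse_eq)
    also have "\<dots> = den \<delta> 1 * (exp (prim_a \<delta> 1 - prim_a \<delta> z)) / den \<delta> z"
      by (simp only: exp_minus inverse_mult_distrib inverse_inverse_eq inverse_divide) simp
    also have "\<dots> = den \<delta> 1 * exp (prim_a \<delta> 1) * phi \<delta> z"
      by (simp add: phi_def a_fun_den exp_diff exp_minus field_simps)
    finally show ?thesis .
  qed
  hence "K_const \<gamma> \<delta> = (LINT z:{0..1}|lebesgue. (den \<delta> 1 * exp (prim_a \<delta> 1)) * (\<gamma> z * phi \<delta> z))"
    unfolding K_const_def by (intro set_lebesgue_integral_cong) auto
  thus ?thesis unfolding phi_moment_def by simp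
qed

lemma Phi_LSW_nonneg: "Phi_LSW z \<ge> 0"
  using C_LSW_pos LSW_profile_nonneg[of z] by (simp add: Phi_LSW_def)

lemma Phi_LSW_meas: "Phi_LSW \<in> borel_measurable (lebesgue_on {0..})"
  unfolding Phi_LSW_def[abs_def] by (rule borel_imp_meas) measurable

context weight
begin

lemma Phi_LSW_bound:
  assumes "z \<ge> 0"
  shows "\<bar>Phi_LSW z\<bar> \<le> C_LSW * profile_max * wt_const * wt z"
proof (cases "z < 1/2")
  case True
  have "\<bar>Phi_LSW z\<bar> \<le> C_LSW * profile_max * 1"
    using C_LSW_pos LSW_le_max[of z] LSW_profile_nonneg[of z]
    by (simp add: Phi_LSW_def abs_mult)
  also have "\<dots> \<le> C_LSW * profile_max * (wt_const * wt z)"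
    using True assms C_LSW_pos profile_max_ge_1 by (intro mult_left_mono wt_const_inner) auto
  finally show ?thesis by (simp add: mult_ac)
next
  case False
  thus ?thesis using C_LSW_pos profile_max_ge_1 wt_const_pos wt_pos[OF assms]
    by (simp add: Phi_LSW_def LSW_profile_zero)
qed

lemma Phi_LSW_Z: "Phi_LSW \<in> Z_space \<beta>1 \<beta>2"
  by (rule Z_space_I[OF Phi_LSW_meas Phi_LSW_bound])

end

text \<open>For \<open>y\<close> strictly between \<open>z - 1/2\<close> and \<open>1/2\<close> both factors of the integrand are evaluated
  inside \<open>[0, 1/2)\<close>, where the profile is positive.\<close>
lemma conv_LSW_pos:
  assumes "1/2 < z" "z < 1"
  shows "conv Phi_LSW Phi_LSW z > 0"
proof -
  have b: "\<bar>Phi_LSW y\<bar> \<le> C_LSW * profile_max" for y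
    using C_LSW_pos LSW_le_max[of y] LSW_profile_nonneg[of y] by (simp add: Phi_LSW_def abs_mult)
  have i: "set_integrable lebesgue {0..z} (\<lambda>y. Phi_LSW (z - y) * Phi_LSW y)"
    by (rule conv_integrable[OF Phi_LSW_meas Phi_LSW_meas b b])
  have "0 < (LINT y:{0..z}|lebesgue. Phi_LSW (z - y) * Phi_LSW y)"
  proof (rule set_LINT_pos[OF i, of "z - 1/2" "1/2"])
    fix y assume "y \<in> {z - 1/2<..<1/2}"
    thus "0 < Phi_LSW (z - y) * Phi_LSW y"
      using assms C_LSW_pos by (auto simp: Phi_LSW_def intro!: mult_pos_pos LSW_profile_pos)
  qed (use assms in \<open>auto intro!: mult_nonneg_nonneg Phi_LSW_nonneg\<close>)
  thus ?thesis by (simp add: conv_def)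
qed

lemma conv_nonneg: "(\<And>y. y \<ge> 0 \<Longrightarrow> \<Phi> y \<ge> 0) \<Longrightarrow> conv \<Phi> \<Phi> z \<ge> 0"
  unfolding conv_def set_lebesgue_integral_def
  by (intro mult_nonneg_nonneg integral_nonneg_AE AE_I2) (auto simp: indicator_def)

text \<open>On \<open>(1/2, 1]\<close> the pole of \<open>a\<close> cancels against the zero of the exponential, so the
  integrand is bounded and, on the open interval, positive.\<close>
lemma R0_LSW_pos: "R0 (conv Phi_LSW Phi_LSW) > 0"
proof -
  interpret weight 1 2 by unfold_locales auto
  let ?h = "conv Phi_LSW Phi_LSW"
  define F where "F x = x * a_fun 0 x * ?h x * exp (- (LINT y:{x..1}|lebesgue. a_fun 0 y * b_fun 0 y))" for x
  define G where "G x = x * exp (- integral {x..1} (a_fun 0)) / den 0 1" for x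
  have d1: "den 0 1 > 0" by (rule den0_pos) auto
  have FG: "F x = G x * ?h x" if x: "x \<in> {1/2<..1}" for x
  proof -
    have "den 0 x > 0" using x by (intro den0_pos) auto
    thus ?thesis unfolding F_def G_def
      using x by (subst integral_ab) (auto simp: a_fun_den intro!: den0_pos)
  qed
  have F0: "F (1/2) = 0"
    using den_factor[of "1/2"] by (simp add: F_def a_fun_den)
  have a_integrable0: "a_fun 0 integrable_on {x..1}" if "x > 1/2" for x
    using that by (intro integrable_continuous_real continuous_on_a_fun) (auto intro!: den0_pos)
  have Gc: "continuous_on {1/2<..1} G"
  proof -
    have c: "continuous_on {c..1} G" if "c > 1/2" for c
      unfolding G_def using d1 a_integrable0[OF that]
      by (intro continuous_intros indefinite_integral_continuous_1') auto
    show ?thesis unfolding continuous_on_eq_continuous_within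
    proof
      fix z :: real assume z: "z \<in> {1/2<..1}"
      have "continuous (at z within {(z+1/2)/2..1}) G"
        using c[of "(z+1/2)/2"] z by (auto simp: continuous_on_eq_continuous_within)
      moreover have "at z within {(z+1/2)/2..1} = at z within {1/2<..1}"
        using z by (intro at_within_nhd[of _ "{(z+1/2)/2<..}"]) auto
      ultimately show "continuous (at z within {1/2<..1}) G" by simp
    qed
  qed
  have G: "0 < G x" "G x \<le> 1 / den 0 1" if x: "x \<in> {1/2<..1}" for x
  proof -
    show "0 < G x" using x d1 by (simp add: G_def)
    have "0 \<le> integral {x..1} (a_fun 0)"
      using x by (intro integral_nonneg a_integrable0) (auto simp: a_fun_den intro!: den0_nonneg)
    hence "x * exp (- integral {x..1} (a_fun 0)) \<le> 1 * 1"
      using x by (intro mult_mono) auto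
    thus "G x \<le> 1 / den 0 1" using d1 by (simp add: G_def divide_right_mono)
  qed
  obtain H where H: "\<And>x. x \<ge> 0 \<Longrightarrow> \<bar>?h x\<bar> \<le> H"
    using bound_by_wt[OF conv_bound[OF Phi_LSW_bound Phi_LSW_bound]] by blast
  have "set_integrable lebesgue {1/2<..1} F"
  proof (rule measurable_bounded_by_integrable_imp_absolutely_integrable)
    have "(\<lambda>x. G x * ?h x) \<in> borel_measurable (lebesgue_on {1/2<..1})"
      by (intro borel_measurable_times borel_imp_meas conv_measurable Phi_LSW_meas
            continuous_imp_measurable_on_sets_lebesgue Gc) auto
    thus "F \<in> borel_measurable (lebesgue_on {1/2<..1})"
      by (subst measurable_cong[OF FG]) auto
    show "(\<lambda>x. 1 / den 0 1 * H) integrable_on {1/2<..1::real}"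
      by (rule set_lebesgue_integral_eq_integral(1)[OF set_integrable_subset[OF unit_const_integrable]]) auto
    fix x :: real assume x: "x \<in> {1/2<..1}"
    show "norm (F x) \<le> 1 / den 0 1 * H"
      unfolding FG[OF x] real_norm_def abs_mult using G[OF x] x H[of 0] d1 by (intro mult_mono H) auto
  qed auto
  moreover have "indicator {1/2<..1} x *\<^sub>R F x = indicator {1/2..1} x *\<^sub>R F x" for x
  proof (cases "x = 1/2")
    case True show ?thesis unfolding True F0 by simp
  qed (auto simp: indicator_def)
  ultimately have Fi: "set_integrable lebesgue {1/2..1} F"
    by (simp only: set_integrable_def)
  have "0 < (LINT x:{1/2..1}|lebesgue. F x)"
  proof (rule set_LINT_pos[OF Fi, of "1/2" 1])
    fix x :: real assume "x \<in> {1/2..1}"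
    show "0 \<le> F x"
    proof (cases "x = 1/2")
      case True show ?thesis unfolding True F0 by simp
    next
      case False
      hence "x \<in> {1/2<..1}" using \<open>x \<in> {1/2..1}\<close> by auto
      thus ?thesis using FG[of x] G(1)[of x] conv_nonneg[of Phi_LSW, OF Phi_LSW_nonneg] by simp
    qed
  next
    fix x :: real assume "x \<in> {1/2<..<1}"
    thus "0 < F x" using FG[of x] G(1)[of x] conv_LSW_pos[of x] by auto
  qed auto
  thus ?thesis by (simp add: R0_def F_def)
qed

section \<open>Moments and compatible data\<close>

text \<open>The values of \<open>\<delta>\<close> for which \<open>phi \<delta>\<close> is \<open>\<eta>\<close>-close to the limit profile. The bounds on \<open>\<eta>\<close> keep
  \<open>phi\<close> bounded and its first moment bounded away from zero.\<close>
definition near_limit :: "real \<Rightarrow> real \<Rightarrow> bool" where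
  "near_limit \<eta> \<delta> \<longleftrightarrow> 0 < \<delta> \<and> \<delta> \<le> 1/10 \<and> \<eta> \<le> 1 \<and> \<eta> \<le> LSW_moment / 2
     \<and> (\<forall>z\<in>{0..1}. \<bar>phi \<delta> z - LSW_profile z\<bar> \<le> \<eta>)"

context weight
begin

text \<open>If \<open>f\<close> is \<open>q * phi \<delta>\<close> on \<open>[0, 1]\<close> and zero beyond, up to an error, then so are its
  moments.\<close>
lemma moment_approx:
  assumes \<delta>: "\<delta> > 0" and \<gamma>: "continuous_on {0..} \<gamma>" "\<And>z. z \<ge> 0 \<Longrightarrow> \<bar>\<gamma> z\<bar> \<le> 1 + z"
    and f: "f \<in> borel_measurable (lebesgue_on {0..})"
      "\<And>z. z \<ge> 0 \<Longrightarrow> \<bar>f z - (if z \<le> 1 then q * phi \<delta> z else 0)\<bar> \<le> c * wt z"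
  shows "set_integrable lebesgue {0..} (\<lambda>z. \<gamma> z * f z)"
    and "\<bar>(LINT z:{0..}|lebesgue. \<gamma> z * f z) - q * phi_moment \<gamma> \<delta>\<bar> \<le> c * tail_const"
proof -
  define k where "k z = q * (indicator {0..1} z * (\<gamma> z * phi \<delta> z))" for z
  have c: "c \<ge> 0" using f(2)[of 0] abs_ge_zero[of "f 0 - q * phi \<delta> 0"] by (simp add: wt_def)
  have i1: "set_integrable lebesgue {0..1} (\<lambda>z. \<gamma> z * phi \<delta> z)"
    by (rule phi_integrable[OF \<delta> \<gamma>(1)])
  have ind: "indicator {0..} z *\<^sub>R (indicator {0..1} z * (\<gamma> z * phi \<delta> z)) = indicator {0..1} z *\<^sub>R (\<gamma> z * phi \<delta> z)" for z :: real
    by (auto simp: indicator_def)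
  have ki: "set_integrable lebesgue {0..} k"
    unfolding k_def using i1 by (intro set_integrable_mult_right) (simp only: set_integrable_def ind)
  have kv: "(LINT z:{0..}|lebesgue. k z) = q * phi_moment \<gamma> \<delta>"
    unfolding k_def phi_moment_def set_integral_mult_right by (simp only: set_lebesgue_integral_def ind)
  define F where "F z = \<gamma> z * f z - k z" for z
  have km: "k \<in> borel_measurable (lebesgue_on {0..})"
    using ki unfolding set_integrable_def
    by (subst borel_measurable_restrict_space_iff) (auto intro: borel_measurable_integrable)
  have Fm: "F \<in> borel_measurable (lebesgue_on {0..})"
    unfolding F_def by (intro borel_measurable_diff borel_measurable_times f km continuous_imp_meas[OF \<gamma>(1)]) auto
  have Fb: "\<bar>F z\<bar> \<le> c * ((1 + (z - 0)) ^ 12 * exp (- \<beta>1 * (z - 0)))" if z: "z \<ge> 0" for z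
  proof -
    have "F z = \<gamma> z * (f z - (if z \<le> 1 then q * phi \<delta> z else 0))"
      using z by (auto simp: F_def k_def algebra_simps)
    hence "\<bar>F z\<bar> \<le> (1 + z) * (c * wt z)"
      unfolding abs_mult using z by (simp only: abs_mult) (intro mult_mono \<gamma>(2) f(2), auto)
    also have "\<dots> \<le> (1 + z) ^ 12 * (c * (exp (- \<beta>1 * z)))"
    proof (rule mult_mono)
      show "1 + z \<le> (1 + z) ^ 12" using z power_increasing[of 1 12 "1 + z"] by simp
      show "c * wt z \<le> c * exp (- \<beta>1 * z)"
        using wt_shift[of 0 z] z c by (intro mult_left_mono) (auto simp: wt_def)
    qed (use z c wt_pos[of z] in auto)
    finally show ?thesis by (simp add: mult_ac)
  qed
  note T = tail_integral[OF Fm c Fb]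
  have "set_integrable lebesgue {0..} (\<lambda>z. F z + k z)" by (rule set_integral_add(1)[OF T(1) ki])
  moreover have "(\<lambda>z. F z + k z) = (\<lambda>z. \<gamma> z * f z)" by (simp add: F_def)
  ultimately show "set_integrable lebesgue {0..} (\<lambda>z. \<gamma> z * f z)" by simp
  have "(LINT z:{0..}|lebesgue. F z + k z) = (LINT z:{0..}|lebesgue. F z) + q * phi_moment \<gamma> \<delta>"
    using set_integral_add(2)[OF T(1) ki] kv by simp
  moreover have "(\<lambda>z. F z + k z) = (\<lambda>z. \<gamma> z * f z)" by (simp add: F_def)
  ultimately show "\<bar>(LINT z:{0..}|lebesgue. \<gamma> z * f z) - q * phi_moment \<gamma> \<delta>\<bar> \<le> c * tail_const"
    using T(2) by simp
qed

lemma total_source_diff: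
  assumes "0 < \<delta>" and h: "h1 \<in> borel_measurable (lebesgue_on {0..})" "h2 \<in> borel_measurable (lebesgue_on {0..})"
    "\<And>x. x \<ge> 0 \<Longrightarrow> \<bar>h1 x\<bar> \<le> H * wt x" "\<And>x. x \<ge> 0 \<Longrightarrow> \<bar>h2 x\<bar> \<le> H * wt x"
    "\<And>x. x \<ge> 0 \<Longrightarrow> \<bar>h1 x - h2 x\<bar> \<le> d * wt x"
  shows "\<bar>total_source \<delta> h1 - total_source \<delta> h2\<bar> \<le> d * tail_const * exp (prim_a \<delta> 1)"
proof -
  have i: "set_integrable lebesgue {0..} (\<lambda>x. x * exp (prim_a \<delta> x) * h x)"
    if "h \<in> borel_measurable (lebesgue_on {0..})" "\<And>x. x \<ge> 0 \<Longrightarrow> \<bar>h x\<bar> \<le> H * wt x" for h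
    using that assms(1) by (intro weighted_tail(1)[of \<delta> 0 h H] le_with_growth) auto
  have "total_source \<delta> h1 - total_source \<delta> h2 = total_source \<delta> (\<lambda>x. h1 x - h2 x)"
    unfolding total_source_def using set_integral_diff(2)[OF i[OF h(1,3)] i[OF h(2,4)]]
    by (simp add: right_diff_distrib)
  thus ?thesis
    using total_source_bound[OF assms(1) borel_measurable_diff[OF h(1,2)] h(5)] by simp
qed

text \<open>Right-hand sides and parameters in the range that is relevant for the fixed point
  problem.\<close>
definition compatible_data :: "real \<Rightarrow> real \<Rightarrow> (real \<Rightarrow> real) \<Rightarrow> real \<Rightarrow> real \<Rightarrow> bool" where
  "compatible_data R \<delta> h \<epsilon> \<epsilon>t \<longleftrightarrow> h \<in> borel_measurable (lebesgue_on {0..}) \<and> (\<forall>x\<ge>0. \<bar>h x\<bar> \<le> R * wt x)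
     \<and> 0 < \<epsilon> \<and> \<epsilon> \<le> exp (- prim_a \<delta> 1) * R \<and> 0 \<le> \<epsilon>t \<and> \<epsilon>t \<le> exp (- prim_a \<delta> 1) * R
     \<and> compatible h \<delta> (\<epsilon>, \<epsilon>t)"

lemma compatible_data_moments:
  assumes "compatible_data R \<delta> h \<epsilon> \<epsilon>t"
  shows "(LINT z:{0..}|lebesgue. z * I_h h \<epsilon> \<epsilon>t \<delta> z) = 1"
    "\<epsilon> * (LINT z:{0..}|lebesgue. I_h h \<epsilon> \<epsilon>t \<delta> z) = \<epsilon>t"
  using assms by (auto simp: compatible_data_def compatible_def)

lemma compatible_data_meas:
  assumes "compatible_data R \<delta> h \<epsilon> \<epsilon>t" "\<delta> > 0"
  shows "I_h h \<epsilon> \<epsilon>t \<delta> \<in> borel_measurable (lebesgue_on {0..})"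
  by (rule continuous_imp_meas[OF I_h_cont[of \<delta> \<epsilon> \<epsilon>t h R]]) (use assms in \<open>auto simp: compatible_data_def\<close>)

lemma near_limit_moments:
  assumes "near_limit \<eta> \<delta>"
  shows "\<bar>phi_moment (\<lambda>z. z) \<delta> - LSW_moment\<bar> \<le> \<eta>" "phi_moment (\<lambda>z. z) \<delta> \<ge> LSW_moment / 2"
    "0 \<le> phi_moment (\<lambda>z. 1) \<delta>" "phi_moment (\<lambda>z. 1) \<delta> \<le> profile_max + 1"
    "\<And>z. z \<in> {0..1} \<Longrightarrow> 0 \<le> phi \<delta> z" "\<And>z. z \<in> {0..1} \<Longrightarrow> phi \<delta> z \<le> profile_max + 1"
proof -
  have d: "\<delta> > 0" "\<eta> \<le> 1" "\<eta> \<le> LSW_moment / 2" "\<And>z. z \<in> {0..1} \<Longrightarrow> \<bar>phi \<delta> z - LSW_profile z\<bar> \<le> \<eta>"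
    using assms by (auto simp: near_limit_def)
  show 1: "\<bar>phi_moment (\<lambda>z. z) \<delta> - LSW_moment\<bar> \<le> \<eta>" by (rule first_moment_close[OF d(1,4)])
  thus "phi_moment (\<lambda>z. z) \<delta> \<ge> LSW_moment / 2" using d by (simp add: abs_le_iff)
  show p: "phi \<delta> z \<le> profile_max + 1" if "z \<in> {0..1}" for z
    using d(4)[OF that] d(2) LSW_le_max[of z] by (simp add: abs_le_iff)
  show "0 \<le> phi \<delta> z" if "z \<in> {0..1}" for z using that d by (intro phi_nonneg) auto
  show "0 \<le> phi_moment (\<lambda>z. 1) \<delta>" "phi_moment (\<lambda>z. 1) \<delta> \<le> profile_max + 1"
    using zeroth_moment_bounds[OF d(1) p] by auto
qed

lemma single_estimate:
  assumes c: "near_limit \<eta> \<delta>" and d: "compatible_data R \<delta> h \<epsilon> \<epsilon>t" and R: "R \<ge> 1" and z: "z \<ge> 0"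
  shows "\<bar>I_h h \<epsilon> \<epsilon>t \<delta> z - (if z \<le> 1 then \<epsilon> * total_source \<delta> h * phi \<delta> z else 0)\<bar>
     \<le> 2 * diff_const * R^3 * smallness \<delta> * wt z"
proof -
  have \<delta>: "0 < \<delta>" "\<delta> \<le> 1/10" using c by (auto simp: near_limit_def)
  have 0: "I_h (\<lambda>_. 0) 0 0 \<delta> z = 0" "total_source \<delta> (\<lambda>_. 0) = 0" by (auto simp: I_h_def total_source_def)
  have "\<bar>I_h h \<epsilon> \<epsilon>t \<delta> z - I_h (\<lambda>_. 0) 0 0 \<delta> z
           - (if z \<le> 1 then (\<epsilon> * total_source \<delta> h - 0 * total_source \<delta> (\<lambda>_. 0)) * phi \<delta> z else 0)\<bar>
         \<le> diff_const * R^2 * smallness \<delta> * (R + R) * wt z"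
  proof (rule I_h_difference[OF \<delta> R z])
    fix x :: real assume "0 \<le> x"
    thus "\<bar>0\<bar> \<le> R * wt x" using R wt_pos[of x] by simp
  qed (use d R in \<open>auto simp: compatible_data_def\<close>)
  also have "diff_const * R^2 * smallness \<delta> * (R + R) * wt z = 2 * diff_const * R^3 * smallness \<delta> * wt z"
    by (simp add: power2_eq_square power3_eq_cube)
  finally show ?thesis using 0 by (cases "z \<le> 1") simp_all
qed

text \<open>The first moment of \<open>q * phi \<delta>\<close> is almost \<open>1\<close>, and the first moment of \<open>phi \<delta>\<close> almost
  \<open>1 / C_LSW\<close>. So \<open>q\<close> is almost \<open>C_LSW\<close>, for all data.\<close>
lemma factor_estimate:
  assumes c: "near_limit \<eta> \<delta>" and d: "compatible_data R \<delta> h \<epsilon> \<epsilon>t" and R: "R \<ge> 1"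
  defines "s \<equiv> 2 * diff_const * R^3 * smallness \<delta>"
  shows "\<bar>\<epsilon> * total_source \<delta> h - C_LSW\<bar> \<le> 2 * C_LSW * (s * tail_const + C_LSW * \<eta>)"
proof -
  define q where "q = \<epsilon> * total_source \<delta> h"
  define m where "m = phi_moment (\<lambda>z. z) \<delta>"
  have \<delta>: "\<delta> > 0" using c by (simp add: near_limit_def)
  have m: "\<bar>m - LSW_moment\<bar> \<le> \<eta>" "m \<ge> LSW_moment / 2" using near_limit_moments[OF c] by (auto simp: m_def)
  have LSW_moment: "LSW_moment > 0" "m > 0" using LSW_moment_pos m by auto
  have "\<bar>(LINT z:{0..}|lebesgue. z * I_h h \<epsilon> \<epsilon>t \<delta> z) - q * phi_moment (\<lambda>z. z) \<delta>\<bar> \<le> s * tail_const"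
    unfolding q_def s_def
    by (rule moment_approx(2)[OF \<delta> _ _ compatible_data_meas[OF d \<delta>] single_estimate[OF c d R]]) (auto intro: continuous_intros)
  hence 1: "\<bar>1 - q * m\<bar> \<le> s * tail_const" unfolding compatible_data_moments(1)[OF d] m_def .
  have "(q - C_LSW) * m = (q * m - 1) + C_LSW * (LSW_moment - m)"
    using LSW_moment by (simp add: C_LSW_eq field_simps)
  hence "\<bar>q - C_LSW\<bar> * m \<le> \<bar>q * m - 1\<bar> + C_LSW * \<bar>LSW_moment - m\<bar>"
    using abs_triangle_ineq[of "q * m - 1" "C_LSW * (LSW_moment - m)"] LSW_moment C_LSW_pos
    by (metis abs_mult abs_of_pos)
  also have "\<dots> \<le> s * tail_const + C_LSW * \<eta>"
    using 1 m C_LSW_pos by (intro add_mono mult_left_mono) (auto simp: abs_minus_commute)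
  finally have 2: "\<bar>q - C_LSW\<bar> * m \<le> s * tail_const + C_LSW * \<eta>" .
  have "\<bar>q - C_LSW\<bar> * (LSW_moment / 2) \<le> \<bar>q - C_LSW\<bar> * m" using m by (intro mult_left_mono) auto
  hence "\<bar>q - C_LSW\<bar> * (LSW_moment / 2) \<le> s * tail_const + C_LSW * \<eta>" using 2 by simp
  hence "\<bar>q - C_LSW\<bar> \<le> 2 / LSW_moment * (s * tail_const + C_LSW * \<eta>)" using LSW_moment by (simp add: field_simps)
  thus ?thesis by (simp add: q_def C_LSW_eq)
qed

lemma convergence_estimate:
  assumes c: "near_limit \<eta> \<delta>" and d: "compatible_data R \<delta> h \<epsilon> \<epsilon>t" and R: "R \<ge> 1" and z: "z \<ge> 0"
  defines "s \<equiv> 2 * diff_const * R^3 * smallness \<delta>"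
  shows "\<bar>I_h h \<epsilon> \<epsilon>t \<delta> z - Phi_LSW z\<bar>
    \<le> (s + wt_const * ((profile_max + 1) * (2 * C_LSW * (s * tail_const + C_LSW * \<eta>)) + C_LSW * \<eta>)) * wt z"
proof -
  define q where "q = \<epsilon> * total_source \<delta> h"
  have E: "\<bar>I_h h \<epsilon> \<epsilon>t \<delta> z - (if z \<le> 1 then q * phi \<delta> z else 0)\<bar> \<le> s * wt z"
    unfolding q_def s_def by (rule single_estimate[OF c d R z])
  have q: "\<bar>q - C_LSW\<bar> \<le> 2 * C_LSW * (s * tail_const + C_LSW * \<eta>)"
    unfolding q_def s_def by (rule factor_estimate[OF c d R])
  have vz: "wt z > 0" using z by (rule wt_pos)
  have \<eta>: "\<bar>phi \<delta> z - LSW_profile z\<bar> \<le> \<eta>" if "z \<in> {0..1}" for z using c that by (auto simp: near_limit_def)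
  have \<eta>0: "\<eta> \<ge> 0" using \<eta>[of 0] by simp
  define B where "B = (profile_max + 1) * (2 * C_LSW * (s * tail_const + C_LSW * \<eta>)) + C_LSW * \<eta>"
  have B0: "B \<ge> 0" unfolding B_def
    using q abs_ge_zero[of "q - C_LSW"] profile_max_ge_1 C_LSW_pos \<eta>0 
    by (intro add_nonneg_nonneg mult_nonneg_nonneg[of "profile_max + 1"]) auto
  show ?thesis
  proof (cases "z \<le> 1")
    case True
    have "q * phi \<delta> z - Phi_LSW z = phi \<delta> z * (q - C_LSW) + C_LSW * (phi \<delta> z - LSW_profile z)"
      by (simp add: Phi_LSW_def algebra_simps)
    hence "\<bar>q * phi \<delta> z - Phi_LSW z\<bar> \<le> \<bar>phi \<delta> z\<bar> * \<bar>q - C_LSW\<bar> + \<bar>C_LSW\<bar> * \<bar>phi \<delta> z - LSW_profile z\<bar>"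
      by (metis abs_mult abs_triangle_ineq)
    also have "\<dots> \<le> B" unfolding B_def
      using z True C_LSW_pos near_limit_moments(5,6)[OF c, of z] profile_max_ge_1
      by (intro add_mono mult_mono q \<eta>) auto
    also have "B \<le> B * (wt_const * wt z)" using mult_left_mono[OF wt_const_inner[OF z True] B0] by simp
    finally have "\<bar>I_h h \<epsilon> \<epsilon>t \<delta> z - Phi_LSW z\<bar> \<le> s * wt z + B * (wt_const * wt z)"
      using E True by simp
    thus ?thesis by (simp add: B_def algebra_simps)
  next
    case False
    hence "\<bar>I_h h \<epsilon> \<epsilon>t \<delta> z - Phi_LSW z\<bar> \<le> s * wt z"
      using E by (simp add: Phi_LSW_def LSW_profile_zero)
    also have "\<dots> \<le> (s + wt_const * B) * wt z"
      using B0 wt_const_pos vz by (intro mult_right_mono) auto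
    finally show ?thesis by (simp add: B_def)
  qed
qed

text \<open>The parameters are implicit functions of the sources. Equality of the first moments makes
  the difference \<open>q\<close> of the two factors of \<open>phi \<delta>\<close> small compared with \<open>\<pi> + d\<close>, where \<open>\<pi>\<close> is the
  distance of the parameters, scaled by \<open>exp (prim_a \<delta> 1)\<close>. Conversely \<open>\<pi>\<close> is bounded in terms of
  \<open>q\<close>, of the difference of the zeroth moments, and of \<open>d\<close>. Inserting one bound into the other
  eliminates \<open>\<pi>\<close>, since the coefficient of \<open>\<pi>\<close> on the right is at most \<open>1/2\<close> by the assumption
  on \<open>s\<close>.\<close>
lemma Lipschitz_estimate:
  assumes c: "near_limit \<eta> \<delta>" and d1: "compatible_data R \<delta> h1 \<epsilon>1 \<epsilon>t1" and d2: "compatible_data R \<delta> h2 \<epsilon>2 \<epsilon>t2" and R: "R \<ge> 1"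
    and dd: "\<And>x. x \<ge> 0 \<Longrightarrow> \<bar>h1 x - h2 x\<bar> \<le> d * wt x"
    and q1: "\<epsilon>1 * total_source \<delta> h1 \<ge> C_LSW / 2"
    and J1: "\<And>z. z \<ge> 0 \<Longrightarrow> \<bar>I_h h1 \<epsilon>1 \<epsilon>t1 \<delta> z\<bar> \<le> N * wt z"
  defines "s \<equiv> diff_const * R^2 * smallness \<delta>"
    and "q_const \<equiv> 2 * C_LSW * tail_const"
    and "mass_const \<equiv> (profile_max + 1) * (2 * C_LSW * tail_const) + tail_const"
    and "param_lip \<equiv> 2 * R / C_LSW"
  assumes small: "((1 + N * tail_const) * param_lip * q_const + R * mass_const) * s \<le> 1 / 2"
    and z: "z \<ge> 0"
  shows "\<bar>I_h h1 \<epsilon>1 \<epsilon>t1 \<delta> z - I_h h2 \<epsilon>2 \<epsilon>t2 \<delta> z\<bar>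
     \<le> (q_const * (profile_max + 1) * wt_const + 1) * s * (2 + 2 * (1 + N * tail_const) * param_lip * R * tail_const) * d * wt z"
proof -
  let ?J1 = "I_h h1 \<epsilon>1 \<epsilon>t1 \<delta>" and ?J2 = "I_h h2 \<epsilon>2 \<epsilon>t2 \<delta>"
  define E where "E = exp (prim_a \<delta> 1)"
  define a where "a = E * \<bar>\<epsilon>1 - \<epsilon>2\<bar>"
  define b where "b = E * \<bar>\<epsilon>t1 - \<epsilon>t2\<bar>"
  define \<pi> where "\<pi> = a + b"
  define q where "q = \<epsilon>1 * total_source \<delta> h1 - \<epsilon>2 * total_source \<delta> h2"
  define m where "m = phi_moment (\<lambda>z. z) \<delta>"
  have \<delta>: "0 < \<delta>" "\<delta> \<le> 1/10" using c by (auto simp: near_limit_def)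
  note D1 = d1[unfolded compatible_data_def] and D2 = d2[unfolded compatible_data_def]
  have E: "E > 0" "exp (- prim_a \<delta> 1) * E = 1" by (auto simp: E_def simp flip: exp_add)
  have ab: "a \<ge> 0" "b \<ge> 0" "\<pi> \<ge> 0" using E by (auto simp: a_def b_def \<pi>_def)
  have d0: "0 \<le> d" using dd[of 0] abs_ge_zero[of "h1 0 - h2 0"] by (simp add: wt_def)
  have N0: "0 \<le> N" using J1[of 0] abs_ge_zero[of "?J1 0"] by (simp add: wt_def)
  have s0: "s \<ge> 0" using diff_const_pos smallness_nonneg[OF \<delta>(1)] by (simp add: s_def)
  have C: "C_LSW > 0" by (rule C_LSW_pos)
  have G: "tail_const > 0" by (rule tail_const_pos)
  have P: "profile_max \<ge> 1" by (rule profile_max_ge_1)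
  have A: "q_const > 0" "mass_const > 0" "param_lip > 0" using C G P R by (auto simp: q_const_def mass_const_def param_lip_def add_pos_pos)
  have scale: "\<bar>\<epsilon>1 - \<epsilon>2\<bar> = exp (- prim_a \<delta> 1) * a" "\<bar>\<epsilon>t1 - \<epsilon>t2\<bar> = exp (- prim_a \<delta> 1) * b"
    using E(2) by (simp_all add: a_def b_def mult.assoc[symmetric])
  have key: "\<bar>(?J1 z - ?J2 z) - (if z \<le> 1 then q * phi \<delta> z else 0)\<bar> \<le> s * (\<pi> + d) * wt z" if "z \<ge> 0" for z
    unfolding q_def s_def
  proof (rule I_h_difference[OF \<delta> R that])
    show "\<bar>\<epsilon>1 - \<epsilon>2\<bar> \<le> exp (- prim_a \<delta> 1) * \<pi>"
      unfolding scale using ab by (simp add: \<pi>_def)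
    show "\<bar>\<epsilon>t1 - \<epsilon>t2\<bar> \<le> exp (- prim_a \<delta> 1) * \<pi>"
      unfolding scale using ab by (simp add: \<pi>_def)
  qed (use D1 D2 dd in auto)
  have Jm: "(\<lambda>z. ?J1 z - ?J2 z) \<in> borel_measurable (lebesgue_on {0..})"
    by (intro borel_measurable_diff compatible_data_meas[OF d1 \<delta>(1)] compatible_data_meas[OF d2 \<delta>(1)])
  have int1: "set_integrable lebesgue {0..} (\<lambda>z. \<gamma> z * I_h h \<epsilon> \<epsilon>t \<delta> z)"
    if "continuous_on {0..} \<gamma>" "\<And>z. z \<ge> 0 \<Longrightarrow> \<bar>\<gamma> z\<bar> \<le> 1 + z" "compatible_data R \<delta> h \<epsilon> \<epsilon>t" for \<gamma> h \<epsilon> \<epsilon>t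
    by (rule moment_approx(1)[OF \<delta>(1) that(1,2) compatible_data_meas[OF that(3) \<delta>(1)] single_estimate[OF c that(3) R]])
  have phi_moment: "\<bar>(LINT z:{0..}|lebesgue. \<gamma> z * ?J1 z) - (LINT z:{0..}|lebesgue. \<gamma> z * ?J2 z) - q * phi_moment \<gamma> \<delta>\<bar> \<le> s * (\<pi> + d) * tail_const"
    if \<gamma>: "continuous_on {0..} \<gamma>" "\<And>z. z \<ge> 0 \<Longrightarrow> \<bar>\<gamma> z\<bar> \<le> 1 + z" for \<gamma>
    using moment_approx(2)[OF \<delta>(1) \<gamma> Jm key] set_integral_diff(2)[OF int1[OF \<gamma> d1] int1[OF \<gamma> d2]]
    by (simp add: right_diff_distrib)
  \<comment> \<open>Both first moments are \<open>1\<close>, so the factors of \<open>phi\<close> almost agree.\<close>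
  have "\<bar>1 - 1 - q * m\<bar> \<le> s * (\<pi> + d) * tail_const"
    using phi_moment[of "\<lambda>z. z"] unfolding compatible_data_moments(1)[OF d1] compatible_data_moments(1)[OF d2] m_def
    by (auto intro: continuous_intros)
  moreover have m: "m \<ge> LSW_moment / 2" using near_limit_moments(2)[OF c] by (simp add: m_def)
  moreover have "\<bar>q * m\<bar> = \<bar>q\<bar> * m" using m LSW_moment_pos by (simp add: abs_mult)
  moreover have "\<bar>q\<bar> * (LSW_moment / 2) \<le> \<bar>q\<bar> * m" using m by (intro mult_left_mono) auto
  ultimately have "\<bar>q\<bar> * (LSW_moment / 2) \<le> s * (\<pi> + d) * tail_const" by simp
  hence q: "\<bar>q\<bar> \<le> q_const * (s * (\<pi> + d))"
    using LSW_moment_pos by (simp add: q_const_def C_LSW_eq field_simps)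
  \<comment> \<open>The zeroth moments determine the second parameters.\<close>
  define M1 M2 where "M1 = (LINT z:{0..}|lebesgue. ?J1 z)" and "M2 = (LINT z:{0..}|lebesgue. ?J2 z)"
  have "\<bar>M1 - M2 - q * phi_moment (\<lambda>z. 1) \<delta>\<bar> \<le> s * (\<pi> + d) * tail_const"
    using phi_moment[of "\<lambda>z. 1"] by (simp add: M1_def M2_def)
  hence "\<bar>M1 - M2\<bar> \<le> \<bar>q\<bar> * phi_moment (\<lambda>z. 1) \<delta> + s * (\<pi> + d) * tail_const"
    using near_limit_moments(3)[OF c] abs_mult[of q "phi_moment (\<lambda>z. 1) \<delta>"] by simp
  also have "\<dots> \<le> q_const * (s * (\<pi> + d)) * (profile_max + 1) + s * (\<pi> + d) * tail_const"
    using q near_limit_moments(3,4)[OF c] A s0 ab d0 by (intro add_right_mono mult_mono) auto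
  also have "\<dots> = mass_const * (s * (\<pi> + d))" by (simp add: q_const_def mass_const_def algebra_simps)
  finally have M12: "\<bar>M1 - M2\<bar> \<le> mass_const * (s * (\<pi> + d))" .
  have "\<bar>(LINT z:{0..}|lebesgue. 1 * ?J1 z) - 0 * phi_moment (\<lambda>z. 1) \<delta>\<bar> \<le> N * tail_const"
    by (rule moment_approx(2)[OF \<delta>(1) _ _ compatible_data_meas[OF d1 \<delta>(1)]]) (use J1 in auto)
  hence M1: "\<bar>M1\<bar> \<le> N * tail_const" by (simp add: M1_def)
  \<comment> \<open>As \<open>\<epsilon>1 * total_source \<delta> h1\<close> is bounded below, \<open>q\<close> and \<open>d\<close> control the difference of the
     first parameters.\<close>
  have g1: "total_source \<delta> h1 \<ge> E * (C_LSW / (2 * R))"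
  proof -
    have "C_LSW / 2 * E \<le> \<epsilon>1 * total_source \<delta> h1 * E" using q1 E by (intro mult_right_mono) auto
    have gpos: "total_source \<delta> h1 > 0" using q1 C D1 by (metis half_gt_zero less_le_trans zero_less_mult_pos)
    have "\<epsilon>1 * E \<le> exp (- prim_a \<delta> 1) * R * E" using D1 E by (intro mult_right_mono) auto
    also have "\<dots> = R" using E by simp
    finally have "\<epsilon>1 * E * total_source \<delta> h1 \<le> R * total_source \<delta> h1" using gpos by (intro mult_right_mono) auto
    hence "C_LSW / 2 * E \<le> R * total_source \<delta> h1" using \<open>C_LSW / 2 * E \<le> \<epsilon>1 * total_source \<delta> h1 * E\<close> by (simp add: mult_ac)
    thus ?thesis using R by (simp add: field_simps)
  qed
  have "\<bar>total_source \<delta> h1 - total_source \<delta> h2\<bar> \<le> d * tail_const * E"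
    unfolding E_def by (rule total_source_diff[OF \<delta>(1), of _ _ R]) (use D1 D2 dd in auto)
  hence "\<bar>\<epsilon>2 * (total_source \<delta> h1 - total_source \<delta> h2)\<bar> \<le> (exp (- prim_a \<delta> 1) * R) * (d * tail_const * E)"
    unfolding abs_mult using D2 R by (intro mult_mono) auto
  also have "\<dots> = R * tail_const * d" using E by simp
  finally have e2g: "\<bar>\<epsilon>2 * (total_source \<delta> h1 - total_source \<delta> h2)\<bar> \<le> R * tail_const * d" .
  have "q = (\<epsilon>1 - \<epsilon>2) * total_source \<delta> h1 + \<epsilon>2 * (total_source \<delta> h1 - total_source \<delta> h2)"
    by (simp add: q_def algebra_simps)
  hence "\<bar>(\<epsilon>1 - \<epsilon>2) * total_source \<delta> h1\<bar> \<le> \<bar>q\<bar> + R * tail_const * d" using e2g by linarith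
  moreover have "\<bar>\<epsilon>1 - \<epsilon>2\<bar> * (E * (C_LSW / (2 * R))) \<le> \<bar>\<epsilon>1 - \<epsilon>2\<bar> * \<bar>total_source \<delta> h1\<bar>"
    using g1 by (intro mult_left_mono) auto
  ultimately have "a * (C_LSW / (2 * R)) \<le> \<bar>q\<bar> + R * tail_const * d"
    by (simp add: a_def abs_mult mult_ac)
  hence a: "a \<le> param_lip * (\<bar>q\<bar> + R * tail_const * d)" using C R by (simp add: param_lip_def field_simps)
  have "\<epsilon>t1 - \<epsilon>t2 = (\<epsilon>1 - \<epsilon>2) * M1 + \<epsilon>2 * (M1 - M2)"
    using compatible_data_moments(2)[OF d1] compatible_data_moments(2)[OF d2] by (simp add: M1_def M2_def algebra_simps)
  hence "\<bar>\<epsilon>t1 - \<epsilon>t2\<bar> \<le> \<bar>\<epsilon>1 - \<epsilon>2\<bar> * \<bar>M1\<bar> + \<bar>\<epsilon>2\<bar> * \<bar>M1 - M2\<bar>"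
    by (metis abs_mult abs_triangle_ineq)
  also have "\<dots> \<le> \<bar>\<epsilon>1 - \<epsilon>2\<bar> * (N * tail_const) + (exp (- prim_a \<delta> 1) * R) * (mass_const * (s * (\<pi> + d)))"
    using D2 R M1 M12 by (intro add_mono mult_mono) auto
  finally have "b \<le> E * (\<bar>\<epsilon>1 - \<epsilon>2\<bar> * (N * tail_const) + (exp (- prim_a \<delta> 1) * R) * (mass_const * (s * (\<pi> + d))))"
    unfolding b_def using E by (intro mult_left_mono) auto
  also have "\<dots> = a * (N * tail_const) + (exp (- prim_a \<delta> 1) * E) * (R * mass_const * (s * (\<pi> + d)))"
    by (simp add: a_def algebra_simps)
  finally have b: "b \<le> a * (N * tail_const) + R * mass_const * (s * (\<pi> + d))" unfolding E by simp
  define X where "X = s * (\<pi> + d)"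
  define n where "n = 1 + N * tail_const"
  have n: "n \<ge> 1" using N0 G by (simp add: n_def)
  have X0: "X \<ge> 0" using s0 ab d0 by (simp add: X_def)
  have "\<pi> \<le> n * a + R * mass_const * X" using b by (simp add: \<pi>_def n_def X_def algebra_simps)
  also have "n * a \<le> n * (param_lip * (q_const * X + R * tail_const * d))"
  proof (rule mult_left_mono)
    have "a \<le> param_lip * (\<bar>q\<bar> + R * tail_const * d)" by (fact a)
    also have "\<dots> \<le> param_lip * (q_const * X + R * tail_const * d)" using q A by (intro mult_left_mono) (auto simp: X_def)
    finally show "a \<le> param_lip * (q_const * X + R * tail_const * d)" .
  qed (use n in auto)
  finally have "\<pi> \<le> (n * param_lip * q_const + R * mass_const) * s * (\<pi> + d) + n * param_lip * R * tail_const * d"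
    by (simp add: X_def algebra_simps)
  also have "(n * param_lip * q_const + R * mass_const) * s * (\<pi> + d) \<le> 1/2 * (\<pi> + d)"
    using small ab d0 by (intro mult_right_mono) (auto simp: n_def)
  finally have "\<pi> + d \<le> 2 * d + 2 * (n * param_lip * R * tail_const * d)" by (simp add: field_simps)
  hence pi: "\<pi> + d \<le> (2 + 2 * n * param_lip * R * tail_const) * d" by (simp add: algebra_simps)
  have vz: "wt z > 0" using z by (rule wt_pos)
  have "\<bar>?J1 z - ?J2 z\<bar> \<le> \<bar>if z \<le> 1 then q * phi \<delta> z else 0\<bar> + s * (\<pi> + d) * wt z"
    using key[OF z] by linarith
  also have "\<bar>if z \<le> 1 then q * phi \<delta> z else 0\<bar> \<le> q_const * X * (profile_max + 1) * (wt_const * wt z)"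
  proof (cases "z \<le> 1")
    case True
    have "\<bar>q * phi \<delta> z\<bar> \<le> q_const * X * (profile_max + 1)"
      unfolding abs_mult using q z True near_limit_moments(5,6)[OF c, of z] A X0
      by (intro mult_mono) (auto simp: X_def)
    also have "\<dots> \<le> q_const * X * (profile_max + 1) * (wt_const * wt z)"
      using mult_left_mono[OF wt_const_inner[OF z True], of "q_const * X * (profile_max + 1)"] A X0 P by simp
    finally show ?thesis using True by simp
  next
    case False
    thus ?thesis using A X0 P wt_const_pos vz by simp
  qed
  finally have "\<bar>?J1 z - ?J2 z\<bar> \<le> (q_const * (profile_max + 1) * wt_const + 1) * s * (\<pi> + d) * wt z"
    by (simp add: X_def algebra_simps)
  also have "\<dots> \<le> (q_const * (profile_max + 1) * wt_const + 1) * s * ((2 + 2 * n * param_lip * R * tail_const) * d) * wt z"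
    using pi A P wt_const_pos s0 vz by (intro mult_right_mono mult_left_mono) auto
  finally show ?thesis by (simp add: n_def mult_ac)
qed

end

section \<open>The operator on the ball\<close>

lemma phi_eventually_near:
  assumes "e > 0"
  shows "\<forall>\<^sub>F \<delta> in at_right 0. \<forall>z\<in>{0..1}. \<bar>phi \<delta> z - LSW_profile z\<bar> \<le> e"
proof -
  obtain d where d: "d > 0" "\<And>\<delta>. 0 < \<delta> \<Longrightarrow> \<delta> \<le> d \<Longrightarrow> \<forall>z\<in>{0..1}. \<bar>phi \<delta> z - LSW_profile z\<bar> \<le> e"
    using phi_convergence[OF assms] by auto
  show ?thesis unfolding eventually_at_right_field
    by (intro exI[of _ d] conjI allI impI d(2)) (use d(1) in auto)
qed

context weight
begin

lemma near_limit_eventually: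
  assumes "0 < \<eta>" "\<eta> \<le> 1" "\<eta> \<le> LSW_moment / 2"
  shows "\<forall>\<^sub>F \<delta> in at_right 0. near_limit \<eta> \<delta>"
proof -
  have "\<forall>\<^sub>F \<delta> in at_right 0. (0::real) < \<delta> \<and> \<delta> < 1/10"
    by (intro eventually_conj eventually_at_right_less eventually_at_rightI[of 0 "1/10"]) auto
  with phi_eventually_near[OF assms(1)] show ?thesis
    by eventually_elim (use assms in \<open>auto simp: near_limit_def\<close>)
qed

lemma smallness_eventually:
  assumes "k > 0"
  shows "\<forall>\<^sub>F \<delta> in at_right 0. c * smallness \<delta> \<le> k"
proof -
  have e: "k / (\<bar>c\<bar> + 1) > 0" using assms by simp
  obtain d where d: "d > 0" "\<And>\<delta>. 0 < \<delta> \<Longrightarrow> \<delta> \<le> d \<Longrightarrow> smallness \<delta> \<le> k / (\<bar>c\<bar> + 1)"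
    using smallness_le[OF e] by auto
  have "c * smallness \<delta> \<le> k" if "0 < \<delta>" "\<delta> < d" for \<delta>
  proof -
    have "c * smallness \<delta> \<le> (\<bar>c\<bar> + 1) * smallness \<delta>" using smallness_nonneg[of \<delta>] that by (intro mult_right_mono) auto
    also have "\<dots> \<le> (\<bar>c\<bar> + 1) * (k / (\<bar>c\<bar> + 1))" using d that by (intro mult_left_mono) auto
    also have "\<dots> = k" by (simp add: add_nonneg_eq_0_iff)
    finally show ?thesis .
  qed
  thus ?thesis unfolding eventually_at_right_field using d(1) by blast
qed

text \<open>The factor \<open>40\<close> is \<open>2 * 10 * 2\<close>, from the upper edge of the box, from \<open>den \<delta> 1 \<ge> 1/10\<close>, and
  from the lower bound \<open>LSW_moment / 2\<close> for the first moment of \<open>phi \<delta>\<close>.\<close>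
definition param_const :: real where
  "param_const = 40 / (LSW_moment * R0 (conv Phi_LSW Phi_LSW)) * (1 + 2 * (profile_max + 1) / LSW_moment)"

text \<open>The box is centred at multiples of \<open>1 / K1\<close>, and \<open>K1\<close> is of the size of
  \<open>exp (prim_a \<delta> 1)\<close>.\<close>
lemma U_set_bounds:
  assumes c: "near_limit \<eta> \<delta>" and p: "(\<epsilon>, \<epsilon>t) \<in> U_set \<delta>"
  shows "0 < \<epsilon>" "\<epsilon> \<le> exp (- prim_a \<delta> 1) * param_const" "0 \<le> \<epsilon>t" "\<epsilon>t \<le> exp (- prim_a \<delta> 1) * param_const"
proof -
  define r where "r = R0 (conv Phi_LSW Phi_LSW)"
  define E where "E = exp (prim_a \<delta> 1)"
  define m n where "m = phi_moment (\<lambda>z. z) \<delta>" and "n = phi_moment (\<lambda>z. 1) \<delta>"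
  have \<delta>: "0 < \<delta>" "\<delta> \<le> 1/10" using c by (auto simp: near_limit_def)
  have r: "r > 0" unfolding r_def by (rule R0_LSW_pos)
  have E: "E > 0" by (simp add: E_def)
  have m: "m \<ge> LSW_moment / 2" "m > 0" using near_limit_moments(2)[OF c] LSW_moment_pos by (auto simp: m_def)
  have n: "0 \<le> n" "n \<le> profile_max + 1" using near_limit_moments(3,4)[OF c] by (auto simp: n_def)
  have d: "den \<delta> 1 \<ge> 1/10" using den_ge_linear[of 1 \<delta>] \<delta> by simp
  have K1: "K1 \<delta> = den \<delta> 1 * E * m" and K2: "K2 \<delta> = den \<delta> 1 * E * n"
    using \<delta> by (simp_all add: K_const_eq E_def m_def n_def)
  have "(1/10) * E * (LSW_moment / 2) \<le> K1 \<delta>"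
    unfolding K1 using d E m LSW_moment_pos by (intro mult_mono) auto
  hence "E * LSW_moment / 20 * r \<le> K1 \<delta> * r" using r by (intro mult_right_mono) auto
  moreover have "K1 \<delta> > 0" unfolding K1 using d E m by (intro mult_pos_pos) auto
  ultimately have "1 / (K1 \<delta> * r) \<le> 1 / (E * LSW_moment / 20 * r)"
    using E LSW_moment_pos r by (intro divide_left_mono mult_pos_pos) auto
  hence e1: "2 * eps_d \<delta> \<le> exp (- prim_a \<delta> 1) * (40 / (LSW_moment * r))"
    using E by (simp add: eps_d_def r_def E_def exp_minus field_simps)
  have e0: "eps_d \<delta> > 0" using d E m r by (simp add: eps_d_def r_def[symmetric] K1)
  have ratio: "epst_d \<delta> = eps_d \<delta> * (n / m)"
    using d E by (simp add: epst_d_def K1 K2)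
  have nm: "0 \<le> n / m" "n / m \<le> 2 * (profile_max + 1) / LSW_moment"
  proof -
    show "0 \<le> n / m" using n m by simp
    have "n / m \<le> (profile_max + 1) / (LSW_moment / 2)" using n m LSW_moment_pos by (intro frac_le) auto
    thus "n / m \<le> 2 * (profile_max + 1) / LSW_moment" by (simp add: mult.commute)
  qed
  have q: "0 \<le> 2 * (profile_max + 1) / LSW_moment" using nm by linarith
  have c0: "0 \<le> exp (- prim_a \<delta> 1) * (40 / (LSW_moment * r))" using LSW_moment_pos r by simp
  have "1/2 * eps_d \<delta> \<le> \<epsilon>" "\<epsilon> \<le> 2 * eps_d \<delta>" "1/2 * epst_d \<delta> \<le> \<epsilon>t" "\<epsilon>t \<le> 2 * epst_d \<delta>"
    using p by (auto simp: U_set_def)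
  note p = this
  show "0 < \<epsilon>" using p e0 by linarith
  have "0 \<le> epst_d \<delta>" unfolding ratio using e0 nm by (intro mult_nonneg_nonneg) auto
  thus "0 \<le> \<epsilon>t" using p by linarith
  have param_eq: "exp (- prim_a \<delta> 1) * param_const = exp (- prim_a \<delta> 1) * (40 / (LSW_moment * r)) * (1 + 2 * (profile_max + 1) / LSW_moment)"
    by (simp add: param_const_def r_def)
  have "\<epsilon> \<le> exp (- prim_a \<delta> 1) * (40 / (LSW_moment * r)) * 1" using p e1 by simp
  also have "\<dots> \<le> exp (- prim_a \<delta> 1) * param_const" unfolding param_eq using q c0 by (intro mult_left_mono) auto
  finally show "\<epsilon> \<le> exp (- prim_a \<delta> 1) * param_const" .
  have "\<epsilon>t \<le> (2 * eps_d \<delta>) * (n / m)" using p by (simp add: ratio)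
  also have "\<dots> \<le> (exp (- prim_a \<delta> 1) * (40 / (LSW_moment * r))) * (1 + 2 * (profile_max + 1) / LSW_moment)"
    by (rule mult_mono[OF e1]) (use nm c0 in auto)
  finally show "\<epsilon>t \<le> exp (- prim_a \<delta> 1) * param_const" unfolding param_eq .
qed

definition ball_Z :: "real \<Rightarrow> (real \<Rightarrow> real) set" where
  "ball_Z r = {\<Phi> \<in> Z_space \<beta>1 \<beta>2. Z_dist \<beta>1 \<beta>2 \<Phi> Phi_LSW \<le> r}"

lemma ball_Z_bound:
  assumes "\<Phi> \<in> ball_Z r" "z \<ge> 0"
  shows "\<bar>\<Phi> z\<bar> \<le> (C_LSW * profile_max * wt_const + wt_const * r) * wt z"
proof -
  have "\<bar>\<Phi> z - Phi_LSW z\<bar> \<le> wt_const * Z_dist \<beta>1 \<beta>2 \<Phi> Phi_LSW * wt z"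
    using assms by (intro le_Z_dist Phi_LSW_Z) (auto simp: ball_Z_def)
  also have "\<dots> \<le> wt_const * r * wt z"
    using assms wt_const_pos wt_pos[of z] by (intro mult_right_mono mult_left_mono) (auto simp: ball_Z_def)
  finally show ?thesis using Phi_LSW_bound[OF assms(2)] by (simp add: algebra_simps)
qed

lemma ball_Z_meas: "\<Phi> \<in> ball_Z r \<Longrightarrow> \<Phi> \<in> borel_measurable (lebesgue_on {0..})"
  by (simp add: ball_Z_def Z_space_def)

lemma compatible_data_of_ball:
  assumes c: "near_limit \<eta> \<delta>" and \<Phi>: "\<Phi> \<in> ball_Z r"
    and ex1: "\<exists>!p. p \<in> U_set \<delta> \<and> compatible (conv \<Phi> \<Phi>) \<delta> p"
    and R: "param_const \<le> R" "(C_LSW * profile_max * wt_const + wt_const * r)^2 * conv_const \<le> R"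
  shows "compatible_data R \<delta> (conv \<Phi> \<Phi>) (fst (eps_sol (conv \<Phi> \<Phi>) \<delta>)) (snd (eps_sol (conv \<Phi> \<Phi>) \<delta>))"
proof -
  let ?p = "eps_sol (conv \<Phi> \<Phi>) \<delta>"
  have p: "?p \<in> U_set \<delta>" "compatible (conv \<Phi> \<Phi>) \<delta> ?p"
    using theI'[OF ex1] by (auto simp: eps_sol_def)
  have U: "(fst ?p, snd ?p) \<in> U_set \<delta>" using p by simp
  note b = U_set_bounds[OF c U]
  have ER: "exp (- prim_a \<delta> 1) * param_const \<le> exp (- prim_a \<delta> 1) * R" using R by simp
  have "\<bar>conv \<Phi> \<Phi> x\<bar> \<le> R * wt x" if "x \<ge> 0" for x
  proof -
    let ?M = "C_LSW * profile_max * wt_const + wt_const * r"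
    have "\<bar>conv \<Phi> \<Phi> x\<bar> \<le> ?M * ?M * conv_const * wt x"
      by (rule conv_bound[OF ball_Z_bound[OF \<Phi>] ball_Z_bound[OF \<Phi>] that])
    also have "\<dots> \<le> R * wt x"
      using R wt_pos[OF that] by (intro mult_right_mono) (auto simp: power2_eq_square)
    finally show ?thesis .
  qed
  moreover have "conv \<Phi> \<Phi> \<in> borel_measurable (lebesgue_on {0..})"
    by (intro borel_imp_meas conv_measurable ball_Z_meas[OF \<Phi>])
  ultimately show ?thesis unfolding compatible_data_def
    using b(1,3) order_trans[OF b(2) ER] order_trans[OF b(4) ER] p(2) by simp
qed

lemma I_bar_eq: "I_bar \<delta> \<Phi> = I_h (conv \<Phi> \<Phi>) (fst (eps_sol (conv \<Phi> \<Phi>) \<delta>)) (snd (eps_sol (conv \<Phi> \<Phi>) \<delta>)) \<delta>"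
  by (simp add: I_bar_def I_op_def)

text \<open>What the fixed point argument needs to know about \<open>I_bar\<close>. The Lipschitz condition is
  formulated with bounds by multiples of \<open>wt\<close> and not with a norm, so that it applies to functions on
  the half-line without choosing values on the negative axis.\<close>
definition contracting :: "real \<Rightarrow> real \<Rightarrow> ((real \<Rightarrow> real) \<Rightarrow> real \<Rightarrow> real) \<Rightarrow> bool" where
  "contracting r \<rho> T \<longleftrightarrow>
     (\<forall>\<Phi>\<in>ball_Z r. continuous_on {0..} (T \<Phi>) \<and>
        (\<forall>z\<ge>0. \<bar>T \<Phi> z - Phi_LSW z\<bar> \<le> \<rho> * wt z) \<and>
        ((\<forall>z\<ge>0. 0 \<le> \<Phi> z) \<longrightarrow> (\<forall>z\<ge>0. 0 \<le> T \<Phi> z))) \<and>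
     (\<forall>\<Phi>\<in>ball_Z r. \<forall>\<Psi>\<in>ball_Z r. \<forall>D. (\<forall>z\<ge>0. \<bar>\<Phi> z - \<Psi> z\<bar> \<le> D * wt z) \<longrightarrow>
        (\<forall>z\<ge>0. \<bar>T \<Phi> z - T \<Psi> z\<bar> \<le> D / 2 * wt z))"

text \<open>The numbers \<open>e1\<close>, ..., \<open>e4\<close> collect the factors in front of \<open>smallness\<close> in the
  conditions of the preceding estimates; for small \<open>\<delta>\<close> all conditions hold.\<close>
lemma I_bar_properties:
  assumes r: "r > 0" and \<rho>: "\<rho> > 0"
    and ex1: "\<And>\<delta> \<Phi>. 0 < \<delta> \<Longrightarrow> \<delta> \<le> \<delta>s \<Longrightarrow> \<Phi> \<in> ball_Z r \<Longrightarrow>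
       \<exists>!p. p \<in> U_set \<delta> \<and> compatible (conv \<Phi> \<Phi>) \<delta> p" and \<delta>s: "\<delta>s > 0"
  shows "\<forall>\<^sub>F \<delta> in at_right 0. contracting r \<rho> (I_bar \<delta>)"
proof -
  define M where "M = C_LSW * profile_max * wt_const + wt_const * r"
  define R where "R = max 1 (max param_const (M^2 * conv_const))"
  have R: "R \<ge> 1" "param_const \<le> R" "M^2 * conv_const \<le> R" by (auto simp: R_def)
  have C: "C_LSW > 0" by (rule C_LSW_pos)
  define c2 where "c2 = wt_const * C_LSW * ((profile_max + 1) * (2 * C_LSW) + 1)"
  have c2: "c2 > 0" using wt_const_pos C profile_max_ge_1 by (auto simp: c2_def intro!: mult_pos_pos add_pos_pos)
  define \<eta> where "\<eta> = min (min 1 (LSW_moment / 2)) (min (\<rho> / (2 * c2)) (1 / (8 * C_LSW)))"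
  have \<eta>: "0 < \<eta>" "\<eta> \<le> 1" "\<eta> \<le> LSW_moment / 2" "c2 * \<eta> \<le> \<rho> / 2" "C_LSW * \<eta> \<le> 1 / 8"
  proof -
    have pos: "LSW_moment / 2 > 0" "\<rho> / (2 * c2) > 0" "1 / (8 * C_LSW) > 0" using LSW_moment_pos \<rho> c2 C by auto
    show "0 < \<eta>" unfolding \<eta>_def using pos by (simp only: min_less_iff_conj) simp
    show "\<eta> \<le> 1" "\<eta> \<le> LSW_moment / 2" by (auto simp: \<eta>_def)
    have "c2 * \<eta> \<le> c2 * (\<rho> / (2 * c2))" using c2 by (intro mult_left_mono) (auto simp: \<eta>_def)
    thus "c2 * \<eta> \<le> \<rho> / 2" using c2 by simp
    have "C_LSW * \<eta> \<le> C_LSW * (1 / (8 * C_LSW))" using C by (intro mult_left_mono) (auto simp: \<eta>_def)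
    thus "C_LSW * \<eta> \<le> 1 / 8" using C by simp
  qed
  define N where "N = C_LSW * profile_max * wt_const + \<rho>"
  define q_const where "q_const = 2 * C_LSW * tail_const"
  define mass_const where "mass_const = (profile_max + 1) * (2 * C_LSW * tail_const) + tail_const"
  define param_lip where "param_lip = 2 * R / C_LSW"
  define e1 where "e1 = 2 * diff_const * R^3 * (1 + wt_const * ((profile_max + 1) * (2 * C_LSW * tail_const)))"
  define e2 where "e2 = 2 * diff_const * R^3 * tail_const"
  define e3 where "e3 = ((1 + N * tail_const) * param_lip * q_const + R * mass_const) * (diff_const * R^2)"
  define e4 where "e4 = (q_const * (profile_max + 1) * wt_const + 1) * (diff_const * R^2) * (2 + 2 * (1 + N * tail_const) * param_lip * R * tail_const) * (2 * M * conv_const)"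
  have "\<forall>\<^sub>F \<delta> in at_right 0. (0::real) < \<delta> \<and> \<delta> \<le> \<delta>s"
    by (rule eventually_at_rightI[of 0 \<delta>s]) (use \<delta>s in auto)
  moreover have "\<forall>\<^sub>F \<delta> in at_right 0. e1 * smallness \<delta> \<le> \<rho> / 2" by (rule smallness_eventually) (use \<rho> in simp)
  moreover have "\<forall>\<^sub>F \<delta> in at_right 0. e2 * smallness \<delta> \<le> 1 / 8" by (rule smallness_eventually) simp
  moreover have "\<forall>\<^sub>F \<delta> in at_right 0. e3 * smallness \<delta> \<le> 1 / 2" by (rule smallness_eventually) simp
  moreover have "\<forall>\<^sub>F \<delta> in at_right 0. e4 * smallness \<delta> \<le> 1 / 2" by (rule smallness_eventually) simp
  moreover have "\<forall>\<^sub>F \<delta> in at_right 0. near_limit \<eta> \<delta>" by (rule near_limit_eventually[OF \<eta>(1-3)])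
  ultimately show ?thesis
  proof eventually_elim
    case (elim \<delta>)
    note c = elim(6)
    let ?e = "\<lambda>\<Phi>. fst (eps_sol (conv \<Phi> \<Phi>) \<delta>)" and ?t = "\<lambda>\<Phi>. snd (eps_sol (conv \<Phi> \<Phi>) \<delta>)"
    have \<delta>: "0 < \<delta>" "\<delta> \<le> \<delta>s" using elim(1) by auto
    have dat: "compatible_data R \<delta> (conv \<Phi> \<Phi>) (?e \<Phi>) (?t \<Phi>)" if "\<Phi> \<in> ball_Z r" for \<Phi>
      by (rule compatible_data_of_ball[OF c that ex1[OF \<delta> that] R(2) R(3)[unfolded M_def]])
    have near: "\<bar>I_bar \<delta> \<Phi> z - Phi_LSW z\<bar> \<le> \<rho> * wt z" if \<Phi>: "\<Phi> \<in> ball_Z r" and z: "z \<ge> 0" for \<Phi> z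
    proof -
      let ?s = "2 * diff_const * R^3 * smallness \<delta>"
      have "\<bar>I_bar \<delta> \<Phi> z - Phi_LSW z\<bar> \<le> (?s + wt_const * ((profile_max + 1) * (2 * C_LSW * (?s * tail_const + C_LSW * \<eta>)) + C_LSW * \<eta>)) * wt z"
        unfolding I_bar_eq by (rule convergence_estimate[OF c dat[OF \<Phi>] R(1) z])
      also have "?s + wt_const * ((profile_max + 1) * (2 * C_LSW * (?s * tail_const + C_LSW * \<eta>)) + C_LSW * \<eta>)
         = e1 * smallness \<delta> + c2 * \<eta>"
        by (simp add: e1_def c2_def algebra_simps)
      also have "(e1 * smallness \<delta> + c2 * \<eta>) * wt z \<le> \<rho> * wt z"
        using elim(2) \<eta>(4) wt_pos[OF z] by (intro mult_right_mono) auto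
      finally show ?thesis .
    qed
    have cont: "continuous_on {0..} (I_bar \<delta> \<Phi>)" if "\<Phi> \<in> ball_Z r" for \<Phi>
      unfolding I_bar_eq
      by (rule I_h_cont[OF \<delta>(1)]) (use dat[OF that] in \<open>auto simp: compatible_data_def\<close>)
    have nonneg: "0 \<le> I_bar \<delta> \<Phi> z" if "\<Phi> \<in> ball_Z r" "\<forall>z\<ge>0. 0 \<le> \<Phi> z" "z \<ge> 0" for \<Phi> z
      unfolding I_bar_eq
      by (rule I_h_nonneg[OF \<delta>(1)]) (use dat[OF that(1)] that in \<open>auto simp: compatible_data_def intro!: conv_nonneg\<close>)
    have lip: "\<bar>I_bar \<delta> \<Phi> z - I_bar \<delta> \<Psi> z\<bar> \<le> D / 2 * wt z"
      if \<Phi>: "\<Phi> \<in> ball_Z r" and \<Psi>: "\<Psi> \<in> ball_Z r"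
        and D: "\<forall>z\<ge>0. \<bar>\<Phi> z - \<Psi> z\<bar> \<le> D * wt z" and z: "z \<ge> 0" for \<Phi> \<Psi> D z
    proof -
      have D0: "D \<ge> 0" using D[rule_format, of 0] abs_ge_zero[of "\<Phi> 0 - \<Psi> 0"] by (simp add: wt_def)
      let ?s = "diff_const * R^2 * smallness \<delta>"
      have "\<bar>I_bar \<delta> \<Phi> z - I_bar \<delta> \<Psi> z\<bar> \<le> (q_const * (profile_max + 1) * wt_const + 1) * ?s * (2 + 2 * (1 + N * tail_const) * param_lip * R * tail_const) * (2 * M * conv_const * D) * wt z"
        unfolding I_bar_eq q_const_def param_lip_def
      proof (rule Lipschitz_estimate[OF c dat[OF \<Phi>] dat[OF \<Psi>] R(1)])
        show "\<bar>conv \<Phi> \<Phi> x - conv \<Psi> \<Psi> x\<bar> \<le> 2 * M * conv_const * D * wt x" if "x \<ge> 0" for x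
          unfolding M_def
          by (rule conv_diff_bound[OF ball_Z_meas[OF \<Phi>] ball_Z_meas[OF \<Psi>] ball_Z_bound[OF \<Phi>] ball_Z_bound[OF \<Psi>]])
             (use D that in auto)
        have "\<bar>?e \<Phi> * total_source \<delta> (conv \<Phi> \<Phi>) - C_LSW\<bar> \<le> 2 * C_LSW * (2 * diff_const * R^3 * smallness \<delta> * tail_const + C_LSW * \<eta>)"
          by (rule factor_estimate[OF c dat[OF \<Phi>] R(1)])
        also have "2 * diff_const * R^3 * smallness \<delta> * tail_const = e2 * smallness \<delta>" by (simp add: e2_def)
        also have "2 * C_LSW * (e2 * smallness \<delta> + C_LSW * \<eta>) \<le> 2 * C_LSW * (1 / 4)"
          using elim(3) \<eta>(5) C by (intro mult_left_mono) auto
        finally show "C_LSW / 2 \<le> ?e \<Phi> * total_source \<delta> (conv \<Phi> \<Phi>)"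
          unfolding abs_le_iff by linarith
        show "\<bar>I_h (conv \<Phi> \<Phi>) (?e \<Phi>) (?t \<Phi>) \<delta> x\<bar> \<le> N * wt x" if "x \<ge> 0" for x
          using near[OF \<Phi> that] Phi_LSW_bound[OF that] unfolding I_bar_eq N_def distrib_right by linarith
        show "((1 + N * tail_const) * (2 * R / C_LSW) * (2 * C_LSW * tail_const) + R * ((profile_max + 1) * (2 * C_LSW * tail_const) + tail_const)) * ?s \<le> 1 / 2"
          using elim(4) by (simp add: e3_def q_const_def mass_const_def param_lip_def mult.assoc)
      qed (rule z)
      also have "\<dots> = (e4 * smallness \<delta>) * D * wt z" by (simp add: e4_def)
      also have "\<dots> \<le> (1 / 2) * D * wt z"
        using elim(5) D0 wt_pos[OF z] by (intro mult_right_mono) auto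
      finally show ?thesis by simp
    qed
    show ?case unfolding contracting_def using near cont nonneg lip by blast
  qed
qed

section \<open>The fixed point argument\<close>

lemma continuous_on_eval: "continuous_on UNIV (\<lambda>f. apply_bcontfun f z)"
  unfolding continuous_on_iff by (meson dist_bounded le_less_trans)

text \<open>Banach's theorem in the complete space of bounded continuous functions on the real line,
  applied to the quotient by \<open>wt\<close>, extended constantly to the left of \<open>0\<close>. Working with continuous
  functions is possible since the values of the operator are continuous.\<close>
lemma fixed_point_exists:
  fixes T :: "(real \<Rightarrow> real) \<Rightarrow> real \<Rightarrow> real" and \<Phi>0 :: "real \<Rightarrow> real" and \<rho> :: real
  defines "X \<equiv> {\<Phi>. continuous_on {0..} \<Phi> \<and> (\<forall>z\<ge>0. 0 \<le> \<Phi> z \<and> \<bar>\<Phi> z - \<Phi>0 z\<bar> \<le> \<rho> * wt z)}"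
  assumes \<Phi>0: "\<And>z. z \<ge> 0 \<Longrightarrow> \<bar>\<Phi>0 z\<bar> \<le> M * wt z"
    and ne: "\<Phi>1 \<in> X"
    and maps: "\<And>\<Phi>. \<Phi> \<in> X \<Longrightarrow> T \<Phi> \<in> X"
    and lip: "\<And>\<Phi> \<Psi> D z. \<Phi> \<in> X \<Longrightarrow> \<Psi> \<in> X \<Longrightarrow> (\<And>z. z \<ge> 0 \<Longrightarrow> \<bar>\<Phi> z - \<Psi> z\<bar> \<le> D * wt z) \<Longrightarrow> z \<ge> 0
       \<Longrightarrow> \<bar>T \<Phi> z - T \<Psi> z\<bar> \<le> D / 2 * wt z"
  shows "\<exists>\<Phi>\<in>X. \<forall>z\<ge>0. T \<Phi> z = \<Phi> z"
proof -
  define emb where "emb f z = apply_bcontfun f z * wt z" for f :: "real \<Rightarrow>\<^sub>C real" and z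
  define S where "S = {f :: real \<Rightarrow>\<^sub>C real. \<forall>z\<ge>0. 0 \<le> emb f z \<and> \<bar>emb f z - \<Phi>0 z\<bar> \<le> \<rho> * wt z}"
  define pull where "pull \<Phi> = Bcontfun (\<lambda>z. \<Phi> (max 0 z) / wt (max 0 z))" for \<Phi> :: "real \<Rightarrow> real"
  have pull: "apply_bcontfun (pull \<Phi>) z = \<Phi> (max 0 z) / wt (max 0 z)" if X: "\<Phi> \<in> X" for \<Phi> z
  proof -
    have Xc: "continuous_on {0..} \<Phi>" and Xb: "\<And>z. z \<ge> 0 \<Longrightarrow> \<bar>\<Phi> z - \<Phi>0 z\<bar> \<le> \<rho> * wt z"
      using X unfolding X_def by blast+
    have mc: "continuous_on UNIV (\<lambda>z::real. max 0 z)"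
      by (intro continuous_on_max continuous_on_const continuous_on_id)
    have "continuous_on UNIV (\<lambda>z. \<Phi> (max 0 z) / wt (max 0 z))"
    proof (rule continuous_on_divide)
      show "continuous_on UNIV (\<lambda>z. \<Phi> (max 0 z))"
        by (rule continuous_on_compose2[OF Xc mc]) auto
      show "continuous_on UNIV (\<lambda>z. wt (max 0 z))"
        by (rule continuous_on_compose2[OF wt_cont mc]) auto
      show "\<forall>z\<in>UNIV. wt (max 0 z) \<noteq> 0"
      proof
        fix z show "wt (max 0 z) \<noteq> 0" using wt_pos[of "max 0 z"] by simp
      qed
    qed
    moreover have "bounded (range (\<lambda>z. \<Phi> (max 0 z) / wt (max 0 z)))"
    proof (rule boundedI[of _ "\<rho> + M"])
      fix x assume "x \<in> range (\<lambda>z. \<Phi> (max 0 z) / wt (max 0 z))"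
      then obtain y where "x = \<Phi> (max 0 y) / wt (max 0 y)" by blast
      define z where "z = max 0 y"
      have z: "z \<ge> 0" "x = \<Phi> z / wt z" using \<open>x = _\<close> by (simp_all add: z_def)
      have "\<bar>\<Phi> z\<bar> \<le> (\<rho> + M) * wt z"
        using Xb[OF z(1)] \<Phi>0[OF z(1)] unfolding distrib_right by linarith
      thus "norm x \<le> \<rho> + M"
        unfolding z(2) real_norm_def abs_divide using wt_pos[OF z(1)] by (simp add: pos_divide_le_eq)
    qed
    ultimately have "(\<lambda>z. \<Phi> (max 0 z) / wt (max 0 z)) \<in> bcontfun" by (simp add: bcontfun_def)
    thus ?thesis by (simp add: pull_def Bcontfun_inverse)
  qed
  have emb_pull: "emb (pull \<Phi>) z = \<Phi> z" if "\<Phi> \<in> X" "z \<ge> 0" for \<Phi> z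
    using that wt_pos[of z] by (simp add: emb_def pull)
  have embX: "emb f \<in> X" if "f \<in> S" for f
  proof -
    have "continuous_on {0..} (emb f)"
      unfolding emb_def[abs_def] by (intro continuous_on_mult wt_cont continuous_on_apply_bcontfun)
    thus ?thesis using that unfolding X_def S_def by blast
  qed
  have pullS: "pull \<Phi> \<in> S" if "\<Phi> \<in> X" for \<Phi>
    using that emb_pull[OF that] unfolding S_def X_def by simp
  have "closed S"
    unfolding S_def emb_def
    by (intro closed_Collect_all closed_Collect_imp closed_Collect_conj closed_Collect_le open_Collect_const
          continuous_intros continuous_on_eval)
  hence "complete S" by (simp add: complete_eq_closed)
  moreover have "S \<noteq> {}" using pullS[OF ne] by blast
  moreover have "(\<lambda>f. pull (T (emb f))) ` S \<subseteq> S"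
    using pullS maps embX by blast
  moreover have "dist (pull (T (emb f))) (pull (T (emb g))) \<le> 1/2 * dist f g" if fg: "f \<in> S" "g \<in> S" for f g
  proof (rule dist_bound)
    fix x :: real
    define z where "z = max 0 x"
    have z: "z \<ge> 0" by (simp add: z_def)
    have vz: "wt z > 0" using z by (rule wt_pos)
    have "\<bar>T (emb f) z - T (emb g) z\<bar> \<le> dist f g / 2 * wt z"
    proof (rule lip[OF embX[OF fg(1)] embX[OF fg(2)] _ z])
      fix y :: real assume y: "y \<ge> 0"
      have "\<bar>emb f y - emb g y\<bar> = \<bar>f y - g y\<bar> * wt y"
        using wt_pos[OF y] by (simp add: emb_def abs_mult flip: left_diff_distrib)
      also have "\<dots> \<le> dist f g * wt y"
        using dist_bounded[of f y g] wt_pos[OF y] by (intro mult_right_mono) (auto simp: dist_real_def)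
      finally show "\<bar>emb f y - emb g y\<bar> \<le> dist f g * wt y" .
    qed
    hence "\<bar>T (emb f) z / wt z - T (emb g) z / wt z\<bar> \<le> 1/2 * dist f g"
      using vz by (simp add: field_simps flip: diff_divide_distrib)
    thus "dist (pull (T (emb f)) x) (pull (T (emb g)) x) \<le> 1/2 * dist f g"
      by (simp add: pull maps embX fg dist_real_def z_def)
  qed
  ultimately have "\<exists>!f\<in>S. pull (T (emb f)) = f"
    by (intro Banach_fix[of S "1/2"]) auto
  then obtain f where f: "f \<in> S" "pull (T (emb f)) = f" by auto
  have "T (emb f) z = emb f z" if "z \<ge> 0" for z
    using emb_pull[OF maps[OF embX[OF f(1)]] that] f(2) by simp
  thus ?thesis using embX[OF f(1)] by blast
qed

text \<open>A bound that halves itself forces zero. It is used for uniqueness, because a competing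
  solution is not given as an element of the set to which Banach's theorem was applied.\<close>
lemma halving_eq:
  assumes "\<And>D. (\<And>z. z \<ge> 0 \<Longrightarrow> \<bar>f z\<bar> \<le> D * wt z) \<Longrightarrow> (\<And>z. z \<ge> 0 \<Longrightarrow> \<bar>f z\<bar> \<le> D / 2 * wt z)"
    and start: "\<And>z. z \<ge> 0 \<Longrightarrow> \<bar>f z\<bar> \<le> D0 * wt z" and z: "z \<ge> 0"
  shows "f z = 0"
proof -
  have "\<forall>z\<ge>0. \<bar>f z\<bar> \<le> D0 * (1/2) ^ n * wt z" for n
  proof (induction n)
    case 0 thus ?case using start by simp
  next
    case (Suc n)
    thus ?case using assms(1)[of "D0 * (1/2) ^ n"] by simp
  qed
  hence le: "\<bar>f z\<bar> \<le> D0 * (1/2) ^ n * wt z" for n using z by blast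
  have "(\<lambda>n. D0 * (1/2) ^ n * wt z) \<longlonglongrightarrow> D0 * 0 * wt z"
    by (intro tendsto_intros LIMSEQ_power_zero) auto
  hence "\<bar>f z\<bar> \<le> D0 * 0 * wt z" by (rule LIMSEQ_le_const) (use le in auto)
  thus ?thesis by simp
qed

end

theorem theorem2p4:
  fixes \<beta>1 \<beta>2 r_star \<delta>_star :: real
  assumes "\<beta>1 > 0" and "\<beta>2 > 1" and "r_star > 0" and "\<delta>_star > 0"
    and "\<And>\<delta> \<Phi>. 0 < \<delta> \<Longrightarrow> \<delta> \<le> \<delta>_star \<Longrightarrow> \<Phi> \<in> Z_space \<beta>1 \<beta>2 \<Longrightarrow>
           Z_dist \<beta>1 \<beta>2 \<Phi> Phi_LSW \<le> r_star \<Longrightarrow>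
           \<exists>!p. p \<in> U_set \<delta> \<and> compatible (conv \<Phi> \<Phi>) \<delta> p"
  shows "\<forall>r1. 0 < r1 \<and> r1 \<le> r_star \<longrightarrow>
    (\<exists>\<delta>1. 0 < \<delta>1 \<and> \<delta>1 \<le> \<delta>_star \<and>
      (\<forall>\<delta>. 0 < \<delta> \<and> \<delta> \<le> \<delta>1 \<longrightarrow>
        (\<exists>\<Phi>\<in>Z_space \<beta>1 \<beta>2.
           (\<forall>z\<ge>0. 0 \<le> \<Phi> z) \<and>
           Z_dist \<beta>1 \<beta>2 \<Phi> Phi_LSW \<le> r1 \<and>
           is_solution \<beta>1 \<beta>2 r_star \<delta> \<Phi> \<and>
           (\<exists>\<rho>>0. \<forall>\<Psi>\<in>Z_space \<beta>1 \<beta>2.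
              Z_dist \<beta>1 \<beta>2 \<Psi> \<Phi> < \<rho> \<and> is_solution \<beta>1 \<beta>2 r_star \<delta> \<Psi>
                \<longrightarrow> (\<forall>z\<ge>0. \<Psi> z = \<Phi> z)))))"
proof (intro allI impI)
  interpret weight \<beta>1 \<beta>2 by unfold_locales fact+
  fix r1 assume r1: "0 < r1 \<and> r1 \<le> r_star"
  define \<rho> where "\<rho> = r1 / 2"
  have \<rho>: "\<rho> > 0" using r1 by (simp add: \<rho>_def)
  have ex1: "\<exists>!p. p \<in> U_set \<delta> \<and> compatible (conv \<Phi> \<Phi>) \<delta> p"
    if "0 < \<delta>" "\<delta> \<le> \<delta>_star" "\<Phi> \<in> ball_Z r_star" for \<delta> \<Phi>
    using assms(5)[of \<delta> \<Phi>] that by (simp add: ball_Z_def)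
  have "\<forall>\<^sub>F \<delta> in at_right 0. contracting r_star \<rho> (I_bar \<delta>)"
    by (rule I_bar_properties[OF \<open>r_star > 0\<close> \<rho> ex1 \<open>\<delta>_star > 0\<close>])
  then obtain b where b: "b > 0"
    and mapping: "\<And>\<delta>. 0 < \<delta> \<Longrightarrow> \<delta> < b \<Longrightarrow> contracting r_star \<rho> (I_bar \<delta>)"
    unfolding eventually_at_right_field by auto
  show "\<exists>\<delta>1. 0 < \<delta>1 \<and> \<delta>1 \<le> \<delta>_star \<and>
      (\<forall>\<delta>. 0 < \<delta> \<and> \<delta> \<le> \<delta>1 \<longrightarrow>
        (\<exists>\<Phi>\<in>Z_space \<beta>1 \<beta>2.
           (\<forall>z\<ge>0. 0 \<le> \<Phi> z) \<and>
           Z_dist \<beta>1 \<beta>2 \<Phi> Phi_LSW \<le> r1 \<and>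
           is_solution \<beta>1 \<beta>2 r_star \<delta> \<Phi> \<and>
           (\<exists>\<rho>>0. \<forall>\<Psi>\<in>Z_space \<beta>1 \<beta>2.
              Z_dist \<beta>1 \<beta>2 \<Psi> \<Phi> < \<rho> \<and> is_solution \<beta>1 \<beta>2 r_star \<delta> \<Psi>
                \<longrightarrow> (\<forall>z\<ge>0. \<Psi> z = \<Phi> z))))"
  proof (intro exI[of _ "min \<delta>_star (b / 2)"] conjI allI impI)
    show "0 < min \<delta>_star (b / 2)" using b \<open>\<delta>_star > 0\<close> by simp
    fix \<delta> assume "0 < \<delta> \<and> \<delta> \<le> min \<delta>_star (b / 2)"
    hence \<delta>: "0 < \<delta>" "\<delta> < b" using b by auto
    let ?T = "I_bar \<delta>"
    have cont: "continuous_on {0..} (?T \<Phi>)" and near: "\<And>z. z \<ge> 0 \<Longrightarrow> \<bar>?T \<Phi> z - Phi_LSW z\<bar> \<le> \<rho> * wt z"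
      and pos: "(\<And>z. z \<ge> 0 \<Longrightarrow> 0 \<le> \<Phi> z) \<Longrightarrow> (\<And>z. z \<ge> 0 \<Longrightarrow> 0 \<le> ?T \<Phi> z)"
      if "\<Phi> \<in> ball_Z r_star" for \<Phi>
      using mapping[OF \<delta>] that unfolding contracting_def by blast+
    have lip: "\<bar>?T \<Phi> z - ?T \<Psi> z\<bar> \<le> D / 2 * wt z"
      if "\<Phi> \<in> ball_Z r_star" "\<Psi> \<in> ball_Z r_star" "\<And>z. z \<ge> 0 \<Longrightarrow> \<bar>\<Phi> z - \<Psi> z\<bar> \<le> D * wt z" "z \<ge> 0" for \<Phi> \<Psi> D z
      using mapping[OF \<delta>] that unfolding contracting_def by blast
    define X where "X = {\<Phi>. continuous_on {0..} \<Phi> \<and> (\<forall>z\<ge>0. 0 \<le> \<Phi> z \<and> \<bar>\<Phi> z - Phi_LSW z\<bar> \<le> \<rho> * wt z)}"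
    have Xdist: "Z_dist \<beta>1 \<beta>2 \<Phi> Phi_LSW \<le> r1" if "\<Phi> \<in> X" for \<Phi>
      using Z_dist_le[of \<Phi> Phi_LSW \<rho>] that by (simp add: X_def \<rho>_def)
    have Xball: "\<Phi> \<in> ball_Z r_star" if X: "\<Phi> \<in> X" for \<Phi>
    proof -
      have "\<Phi> \<in> borel_measurable (lebesgue_on {0..})"
        using X by (intro continuous_imp_meas) (auto simp: X_def)
      moreover have "\<bar>\<Phi> z\<bar> \<le> (\<rho> + C_LSW * profile_max * wt_const) * wt z" if "z \<ge> 0" for z
      proof -
        have "\<bar>\<Phi> z - Phi_LSW z\<bar> \<le> \<rho> * wt z" using X that by (simp add: X_def)
        thus ?thesis using Phi_LSW_bound[OF that] unfolding distrib_right by linarith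
      qed
      ultimately have "\<Phi> \<in> Z_space \<beta>1 \<beta>2" by (rule Z_space_I)
      thus ?thesis using Xdist[OF X] r1 by (simp add: ball_Z_def)
    qed
    have TX: "?T \<Phi> \<in> X" if "\<Phi> \<in> ball_Z r_star" "\<And>z. z \<ge> 0 \<Longrightarrow> 0 \<le> \<Phi> z" for \<Phi>
      unfolding X_def using cont[OF that(1)] near[OF that(1)] pos[OF that] by blast
    have "Z_dist \<beta>1 \<beta>2 Phi_LSW Phi_LSW \<le> 2 * 0" by (rule Z_dist_le) simp
    hence LSW_ball: "Phi_LSW \<in> ball_Z r_star" using r1 Phi_LSW_Z by (simp add: ball_Z_def)
    have "\<exists>\<Phi>\<in>X. \<forall>z\<ge>0. ?T \<Phi> z = \<Phi> z"
    proof (rule fixed_point_exists[OF Phi_LSW_bound, where \<rho> = \<rho> and T = ?T, folded X_def])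
      show "?T Phi_LSW \<in> X" by (rule TX[OF LSW_ball Phi_LSW_nonneg])
      show "?T \<Phi> \<in> X" if "\<Phi> \<in> X" for \<Phi>
        by (rule TX[OF Xball[OF that]]) (use that in \<open>auto simp: X_def\<close>)
    qed (assumption, rule lip[OF Xball Xball])
    then obtain \<Phi> where \<Phi>: "\<Phi> \<in> X" "\<And>z. z \<ge> 0 \<Longrightarrow> ?T \<Phi> z = \<Phi> z" by blast
    have \<Phi>b: "\<Phi> \<in> ball_Z r_star" by (rule Xball[OF \<Phi>(1)])
    have unique: "\<Psi> z = \<Phi> z" if \<Psi>: "is_solution \<beta>1 \<beta>2 r_star \<delta> \<Psi>" and z: "z \<ge> 0" for \<Psi> z
    proof -
      have \<Psi>b: "\<Psi> \<in> ball_Z r_star" and \<Psi>T: "\<And>z. z \<ge> 0 \<Longrightarrow> \<Psi> z = ?T \<Psi> z"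
        using \<Psi> by (auto simp: is_solution_def ball_Z_def)
      have "(\<lambda>z. \<Psi> z - \<Phi> z) z = 0"
      proof (rule halving_eq[OF _ _ z])
        show "\<bar>\<Psi> z - \<Phi> z\<bar> \<le> wt_const * Z_dist \<beta>1 \<beta>2 \<Psi> \<Phi> * wt z" if "z \<ge> 0" for z
          using \<Psi>b \<Phi>b that by (intro le_Z_dist) (auto simp: ball_Z_def)
        show "\<bar>\<Psi> z - \<Phi> z\<bar> \<le> D / 2 * wt z" if "\<And>z. z \<ge> 0 \<Longrightarrow> \<bar>\<Psi> z - \<Phi> z\<bar> \<le> D * wt z" "z \<ge> 0" for D z
          using lip[OF \<Psi>b \<Phi>b that] \<Psi>T[OF that(2)] \<Phi>(2)[OF that(2)] by simp
      qed
      thus ?thesis by simp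
    qed
    have sol: "is_solution \<beta>1 \<beta>2 r_star \<delta> \<Phi>"
      using \<Phi>b \<Phi>(2) by (simp add: is_solution_def ball_Z_def)
    show "\<exists>\<Phi>\<in>Z_space \<beta>1 \<beta>2.
           (\<forall>z\<ge>0. 0 \<le> \<Phi> z) \<and>
           Z_dist \<beta>1 \<beta>2 \<Phi> Phi_LSW \<le> r1 \<and>
           is_solution \<beta>1 \<beta>2 r_star \<delta> \<Phi> \<and>
           (\<exists>\<rho>>0. \<forall>\<Psi>\<in>Z_space \<beta>1 \<beta>2.
              Z_dist \<beta>1 \<beta>2 \<Psi> \<Phi> < \<rho> \<and> is_solution \<beta>1 \<beta>2 r_star \<delta> \<Psi>
                \<longrightarrow> (\<forall>z\<ge>0. \<Psi> z = \<Phi> z))"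
    proof (intro bexI[of _ \<Phi>] conjI)
      show "\<forall>z\<ge>0. 0 \<le> \<Phi> z" using \<Phi>(1) by (simp add: X_def)
      show "Z_dist \<beta>1 \<beta>2 \<Phi> Phi_LSW \<le> r1" by (rule Xdist[OF \<Phi>(1)])
      show "\<exists>\<rho>>0. \<forall>\<Psi>\<in>Z_space \<beta>1 \<beta>2. Z_dist \<beta>1 \<beta>2 \<Psi> \<Phi> < \<rho> \<and> is_solution \<beta>1 \<beta>2 r_star \<delta> \<Psi>
                \<longrightarrow> (\<forall>z\<ge>0. \<Psi> z = \<Phi> z)"
        using unique by (intro exI[of _ 1]) auto
    qed (use sol \<Phi>b in \<open>auto simp: ball_Z_def\<close>)
  qed auto
qed

end
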